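(* Let $f(x)=\alpha_k x^k+\alpha_{k-1}x^{k-1}+\dots+\alpha_1 x$ be a polynomial with integer coefficients and degree $k\geq 3$, such that $\alpha_j=0$ for every even $j$ and $\alpha_k>0$. Then there is a constant $C>0$ (depending only on $f$) such that for every integer $N\geq 2$ there exists a cosine polynomial $$T(x)=b_0+\sum_{m\in D_N} b_m\cos(2\pi m x),\qquad D_N=\{f(j): j\geq 1 \text{ an integer},\ 0<f(j)\leq N\},$$ with all coefficients $b_0$ and $b_m$ ($m\in D_N$) non-negative, normed so that $b_0+\sum_{m\in D_N}b_m=1$, satisfying $T(x)\geq 0$ for all real $x$, and with $b_0\leq C(\log N)^{-1/k}$.
   Context: The sum is over the distinct integer values $m=f(j)$ with $j$ a positive integer and $0<m\le N$; each such value carries one coefficient $b_m$. *)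

theory Defs
  imports Complex_Main "HOL-Computational_Algebra.Polynomial"
begin

definition poly_values :: "int poly \<Rightarrow> int \<Rightarrow> int set" where
  "poly_values f N = {m. \<exists>j\<ge>1. m = poly f j \<and> 0 < m \<and> m \<le> N}"

lemma finite_poly_values: "finite (poly_values f N)"
  by (rule finite_subset[of _ "{1..N}"]) (auto simp: poly_values_def)

definition cos_poly :: "int set \<Rightarrow> real \<Rightarrow> (int \<Rightarrow> real) \<Rightarrow> real \<Rightarrow> real" where
  "cos_poly D b0 b x = b0 + (\<Sum>m\<in>D. b m * cos (2 * pi * of_int m * x))"

end

theory Submission
  imports Defs "HOL-Number_Theory.Cong" "HOL-Library.FuncSet" "HOL-Computational_Algebra.Computational_Algebra"
begin

text \<open>
  After a substitution \<open>x \<mapsto> M x\<close> one may replace \<open>f\<close> by \<open>g = \<plusminus>x^v + x^(v+1) g1(x)\<close>.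
  The polynomial \<open>T\<close> is an average of the sums over \<open>j\<close> of \<open>\<phi>(j) cos (2 \<pi> g(d j) x)\<close> over a random dilation
  \<open>d = \<Prod> p^(s p)\<close> with independent exponents, where \<open>\<phi>(j) = (g(d(j+1)) - g(d j)) (1 - g(d j) / N)\<close>.
  Near a rational \<open>a/q\<close> such a sum is the complete sum \<open>S d a q\<close> (a mean over the residues mod \<open>q\<close>) times a
  Fejer integral that is non-negative and does not depend on \<open>d\<close>; away from rationals with small denominator
  Weyl's inequality makes it negligible.

  Since \<open>g\<close> is odd, \<open>S\<close> is real, and it is multiplicative in \<open>q\<close>, so it suffices to keep the mean over
  \<open>d\<close> at every prime power above \<open>- \<epsilon>\<close> with \<open>\<epsilon>\<close> of order \<open>Q^(-1/k)\<close>: numbers in \<open>[- \<epsilon>, 1]\<close> multiply to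
  numbers in \<open>[- \<epsilon>, 1]\<close>. For \<open>p > Q\<close> Mordell's bound \<open>p^(-1/k)\<close> suffices without any dilation. For
  \<open>p \<le> Q < p^2\<close> one mixes the exponents \<open>0\<close> and \<open>1\<close>, the latter with weight of order \<open>p^(-1/k)\<close>. For
  \<open>p^2 \<le> Q\<close> a uniform exponent below \<open>Q^(1/k)\<close> works, because only boundedly much of the sum over \<open>s\<close> can be negative.
  As the primorial of \<open>Q\<close> is \<open>exp (O(Q))\<close>, all this fits below \<open>N = exp (O(Q))\<close>, which gives the exponent \<open>1/k\<close>.
\<close>

section \<open>Exponentials and sums over residues\<close>

text \<open>The obstacle: for small \<open>q\<close> a complete sum \<open>S d a q\<close> may be
  negative and bounded away from 0, and longer sums do not help. Dilation is the cure, because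
  \<open>p^(s*v)\<close> divides \<open>g (p^s * x)\<close>, so at the modulus \<open>p^r\<close>
  with \<open>r \<le> s*v\<close> the local factor becomes 1. Dilations are paid for by the size of
  \<open>d\<close>, hence the split of the primes: for \<open>p > Q\<close> the bound
  \<open>p^(-1/k)\<close> is enough as it stands; a single factor \<open>p\<close> improves it to
  \<open>p^(-2/k)\<close>, enough when \<open>p^2 > Q\<close>; a long range of exponents is spent
  only on the at most \<open>sqrt Q\<close> remaining primes. Their cost is the exponential of order
  \<open>Q^(1/2 + 1/k) * ln Q\<close>, which is \<open>O(Q)\<close> since \<open>k \<ge> 3\<close>.
  The substitution makes the lowest coefficient a unit, so that no dilate degenerates modulo any
  prime once \<open>c^v\<close> is removed, and the local bounds are uniform in \<open>d\<close>.
  The remaining analysis may lose any fixed power of \<open>exp Q\<close>, because \<open>Q\<close>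
  can be taken as a small multiple of \<open>ln N\<close>; crude forms of Weyl's inequality and of
  the Riemann sum comparison therefore suffice.\<close>

definition ee :: "real \<Rightarrow> complex" where
  "ee x = cis (2 * pi * x)"

lemma ee_add: "ee (x + y) = ee x * ee y"
  by (simp add: ee_def cis_mult algebra_simps)

lemma ee_diff: "ee (x - y) = ee x * cnj (ee y)"
  by (simp add: ee_def cis_mult cis_cnj algebra_simps)

lemma norm_ee [simp]: "norm (ee x) = 1"
  by (simp add: ee_def)

lemma ee_0 [simp]: "ee 0 = 1"
  by (simp add: ee_def)

lemma ee_int: "x \<in> \<int> \<Longrightarrow> ee x = 1"
  by (simp add: ee_def)

lemma ee_of_int [simp]: "ee (of_int n) = 1"
  by (simp add: ee_int)

lemma ee_minus: "ee (- x) = cnj (ee x)"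
  by (simp add: ee_def cis_cnj)

lemma ee_cong_int: "x - y \<in> \<int> \<Longrightarrow> ee x = ee y"
  using ee_add[of "x - y" y] by (simp add: ee_int)

lemma Re_ee: "Re (ee x) = cos (2 * pi * x)"
  by (simp add: ee_def)

lemma ee_of_nat_mult: "ee (real n * x) = ee x ^ n"
  by (simp add: ee_def DeMoivre algebra_simps)

text \<open>Weaker than Jordan's inequality but elementary: up to pi/3 the difference increases
  because cos is at least 1/2, and beyond it sin z is at least sqrt 3 / 2 while z / 3 is at most
  2/3.\<close>

lemma sin_ge_third:
  fixes z :: real
  assumes "0 \<le> z" "z \<le> pi / 2"
  shows "z / 3 \<le> sin z"
proof (cases "z \<le> pi / 3")
  case True
  have "(\<lambda>y. sin y - y / 3) 0 \<le> (\<lambda>y. sin y - y / 3) z"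
  proof (rule DERIV_nonneg_imp_nondecreasing[OF assms(1)])
    fix x assume x: "0 \<le> x" "x \<le> z"
    have "cos (pi / 3) \<le> cos x"
      using x True by (intro cos_monotone_0_pi_le) auto
    then have "0 \<le> cos x - 1 / 3" by (simp add: cos_60)
    moreover have "((\<lambda>y. sin y - y / 3) has_real_derivative (cos x - 1 / 3)) (at x)"
      by (auto intro!: derivative_eq_intros)
    ultimately show "\<exists>y. ((\<lambda>y. sin y - y / 3) has_real_derivative y) (at x) \<and> 0 \<le> y"
      by (intro exI[of _ "cos x - 1 / 3"] conjI)
  qed
  then show ?thesis by simp
next
  case False
  have "sin (pi / 3) \<le> sin z"
    using False assms by (intro sin_monotone_2pi_le) auto
  then have "sqrt 3 / 2 \<le> sin z" by (simp add: sin_60)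
  moreover have "(1.7::real) \<le> sqrt 3" by (rule real_le_rsqrt) (simp add: power2_eq_square)
  moreover have "z \<le> 2" using assms pi_less_4 by simp
  ultimately show ?thesis by simp
qed

lemma norm_ee_minus_one:
  assumes "\<bar>t\<bar> \<le> 1 / 2"
  shows "\<bar>t\<bar> \<le> norm (ee t - 1)"
proof -
  have "(norm (ee t - 1))\<^sup>2 = (cos (2*pi*t) - 1)\<^sup>2 + (sin (2*pi*t))\<^sup>2"
    by (simp add: ee_def cmod_power2)
  also have "\<dots> = 2 - 2 * cos (2 * (pi * t))"
    using sin_cos_squared_add[of "2*pi*t"] by (simp add: power2_eq_square algebra_simps)
  also have "\<dots> = (2 * sin (pi * \<bar>t\<bar>))\<^sup>2"
    by (cases "t \<ge> 0") (simp_all add: cos_double_sin[of "pi * t"] power2_eq_square)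
  finally have e: "(norm (ee t - 1))\<^sup>2 = (2 * sin (pi * \<bar>t\<bar>))\<^sup>2" .
  have "pi * \<bar>t\<bar> / 3 \<le> sin (pi * \<bar>t\<bar>)"
    using assms mult_left_mono[OF assms, of pi] by (intro sin_ge_third) auto
  moreover have "2 * \<bar>t\<bar> \<le> pi * \<bar>t\<bar>"
    by (intro mult_right_mono) (use pi_ge_two in auto)
  ultimately have s: "\<bar>t\<bar> \<le> 2 * sin (pi * \<bar>t\<bar>)" by simp
  then have "\<bar>t\<bar>\<^sup>2 \<le> (norm (ee t - 1))\<^sup>2"
    unfolding e by (intro power_mono) auto
  then show ?thesis by (rule power2_le_imp_le) simp
qed

text \<open>Differencing with control of the top coefficient, for Weyl's method and for the
  substitution \<open>t + m\<close> in Mordell's argument. The clause for \<open>k = 0\<close>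
  carries the induction, where the truncated \<open>k - 1\<close> alone would not give
  \<open>r = 0\<close>.\<close>

lemma poly_difference:
  fixes p :: "'a::comm_ring_1 poly"
  assumes "degree p \<le> k"
  shows "\<exists>r. (k = 0 \<longrightarrow> r = 0) \<and> degree r \<le> k - 1 \<and> (k > 0 \<longrightarrow> coeff r (k - 1) = of_nat k * h * coeff p k) \<and>
             (\<forall>x. poly r x = poly p (x + h) - poly p x)"
  using assms
proof (induction k arbitrary: p)
  case 0
  then show ?case by (intro exI[of _ 0]) (auto elim!: degree_eq_zeroE)
next
  case (Suc k)
  obtain a p' where p: "p = pCons a p'" by (cases p)
  have dp: "degree p' \<le> k" using Suc.prems p by (auto split: if_splits)
  from Suc.IH[OF dp] obtain r where r: "k = 0 \<longrightarrow> r = 0" "degree r \<le> k - 1"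
    "k > 0 \<longrightarrow> coeff r (k - 1) = of_nat k * h * coeff p' k"
    "\<And>x. poly r x = poly p' (x + h) - poly p' x" by blast
  let ?r = "pCons 0 r + smult h (p' + r)"
  have "degree (pCons 0 r) \<le> k" using r(1,2) by (cases "k = 0") (auto simp: degree_pCons_le intro: order_trans[OF degree_pCons_le])
  then have "degree ?r \<le> k"
    using r(2) dp by (intro degree_add_le) (auto intro!: order_trans[OF degree_smult_le] degree_add_le)
  moreover have "coeff r k = 0" using r(1,2) by (cases k) (auto intro: coeff_eq_0)
  then have "coeff ?r k = of_nat (Suc k) * h * coeff p (Suc k)"
    using r(1,3) p by (cases k) (auto simp: algebra_simps)
  moreover have "poly ?r x = poly p (x + h) - poly p x" for x
  proof -
    have "poly p' (x + h) = poly p' x + poly r x" using r(4)[of x] by simp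
    then show ?thesis by (simp add: p algebra_simps)
  qed
  ultimately show ?case by (intro exI[of _ ?r]) auto
qed


section \<open>Sums over complete residue systems\<close>

lemma sum_mod_reindex:
  fixes F :: "int \<Rightarrow> 'a::comm_monoid_add" and q u c :: int
  assumes q: "q > 0" and u: "coprime u q" and per: "\<And>x y. [x = y] (mod q) \<Longrightarrow> F x = F y"
  shows "(\<Sum>x\<in>{0..<q}. F (u * x + c)) = (\<Sum>x\<in>{0..<q}. F x)"
proof -
  let ?f = "\<lambda>x. (u * x + c) mod q"
  have "inj_on ?f {0..<q}"
  proof (rule inj_onI)
    fix x y assume xy: "x \<in> {0..<q}" "y \<in> {0..<q}" "?f x = ?f y"
    then have "[u * x + c = u * y + c] (mod q)" by (simp add: cong_def)
    then have "[u * x = u * y] (mod q)" by (simp add: cong_add_rcancel)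
    then have "[x = y] (mod q)" using u by (simp add: cong_mult_lcancel)
    then show "x = y" using xy by (simp add: cong_def)
  qed
  moreover have "?f ` {0..<q} \<subseteq> {0..<q}" using q by auto
  ultimately have "bij_betw ?f {0..<q} {0..<q}"
    by (simp add: bij_betw_def endo_inj_surj)
  then have "(\<Sum>x\<in>{0..<q}. F (?f x)) = (\<Sum>x\<in>{0..<q}. F x)"
    by (rule sum.reindex_bij_betw)
  moreover have "F (?f x) = F (u * x + c)" for x by (rule per) (simp add: cong_def)
  ultimately show ?thesis by simp
qed

lemma sum_multiple_period:
  fixes F :: "int \<Rightarrow> complex" and q m :: int
  assumes q: "q > 0" and m: "m \<ge> 0" and per: "\<And>x y. [x = y] (mod q) \<Longrightarrow> F x = F y"
  shows "(\<Sum>x\<in>{0..<q * m}. F x) = of_int m * (\<Sum>x\<in>{0..<q}. F x)"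
proof -
  have "(\<Sum>x\<in>{0..<q * m}. F x) = (\<Sum>(i, r)\<in>{0..<m} \<times> {0..<q}. F (q * i + r))"
  proof (rule sum.reindex_bij_witness[of _ "\<lambda>(i, r). q * i + r" "\<lambda>x. (x div q, x mod q)"])
    fix x assume "x \<in> {0..<q * m}"
    then have "0 \<le> x" "x < q * m" by auto
    moreover have "q * (x div q) \<le> x" using q minus_mod_eq_mult_div[of x q] pos_mod_sign[of q x] by linarith
    ultimately have "q * (x div q) < q * m" by linarith
    then show "(x div q, x mod q) \<in> {0..<m} \<times> {0..<q}"
      using q \<open>0 \<le> x\<close> by (simp add: pos_imp_zdiv_nonneg_iff)
  next
    fix b assume "b \<in> {0..<m} \<times> {0..<q}"
    then obtain i r where b: "b = (i, r)" "0 \<le> i" "i < m" "0 \<le> r" "r < q" by auto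
    then have "q * i + r < q * (i + 1)" by (simp add: algebra_simps)
    also have "\<dots> \<le> q * m" using b q by (intro mult_left_mono) auto
    finally show "(case b of (i, r) \<Rightarrow> q * i + r) \<in> {0..<q * m}" using b q by auto
  qed (use q in auto)
  also have "\<dots> = (\<Sum>(i, r)\<in>{0..<m} \<times> {0..<q}. F r)"
    by (intro sum.cong refl) (auto intro!: per simp: cong_def)
  also have "\<dots> = (\<Sum>i\<in>{0..<m}. \<Sum>r\<in>{0..<q}. F r)" by (rule sum.cartesian_product[symmetric])
  also have "\<dots> = of_int m * (\<Sum>x\<in>{0..<q}. F x)" using m by simp
  finally show ?thesis .
qed

lemma sum_crt:
  fixes F G :: "int \<Rightarrow> complex" and q r :: int
  assumes q: "q > 0" and r: "r > 0" and cop: "coprime q r"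
    and F: "\<And>x y. [x = y] (mod q) \<Longrightarrow> F x = F y"
    and G: "\<And>x y. [x = y] (mod r) \<Longrightarrow> G x = G y"
  shows "(\<Sum>x\<in>{0..<q * r}. F x * G x) = (\<Sum>x\<in>{0..<q}. F x) * (\<Sum>x\<in>{0..<r}. G x)"
proof -
  let ?f = "\<lambda>x. (x mod q, x mod r)"
  have "inj_on ?f {0..<q * r}"
  proof (rule inj_onI)
    fix x y assume xy: "x \<in> {0..<q * r}" "y \<in> {0..<q * r}" "?f x = ?f y"
    then have "[x = y] (mod q * r)"
      using cop by (intro coprime_cong_mult) (auto simp: cong_def)
    then show "x = y" using xy by (simp add: cong_def)
  qed
  moreover have "?f ` {0..<q * r} \<subseteq> {0..<q} \<times> {0..<r}" using q r by auto
  moreover have "card {0..<q * r} = card ({0..<q} \<times> {0..<r})"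
    using q r by (simp add: card_cartesian_product nat_mult_distrib)
  ultimately have bij: "bij_betw ?f {0..<q * r} ({0..<q} \<times> {0..<r})"
    by (simp add: bij_betw_def card_image card_subset_eq)
  have "(\<Sum>x\<in>{0..<q}. F x) * (\<Sum>x\<in>{0..<r}. G x) = (\<Sum>z\<in>{0..<q} \<times> {0..<r}. F (fst z) * G (snd z))"
    by (simp add: sum_product sum.cartesian_product case_prod_beta)
  also have "\<dots> = (\<Sum>x\<in>{0..<q * r}. F (x mod q) * G (x mod r))"
    by (subst sum.reindex_bij_betw[OF bij, symmetric]) simp
  also have "\<dots> = (\<Sum>x\<in>{0..<q * r}. F x * G x)"
    by (intro sum.cong refl arg_cong2[of _ _ _ _ "(*)"] F G) (auto simp: cong_def)
  finally show ?thesis ..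
qed

lemma ee_cong_mod:
  fixes a b q :: int
  assumes "[a = b] (mod q)"
  shows "ee (of_int a / of_int q) = ee (of_int b / of_int q)"
proof (cases "q = 0")
  case False
  obtain c where c: "a - b = q * c" using assms by (auto simp: cong_iff_dvd_diff)
  have "real_of_int a / of_int q - of_int b / of_int q = of_int (a - b) / of_int q"
    by (simp add: diff_divide_distrib)
  also have "\<dots> = of_int c" using False c by simp
  finally show ?thesis by (intro ee_cong_int) simp
qed simp

lemma ee_eq_1_iff:
  fixes a q :: int
  assumes "q > 0"
  shows "ee (of_int a / of_int q) = 1 \<longleftrightarrow> q dvd a"
proof
  assume "q dvd a"
  then show "ee (of_int a / of_int q) = 1"
    using ee_cong_mod[of a 0 q] by (simp add: cong_0_iff)
next
  assume 1: "ee (of_int a / of_int q) = 1"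
  obtain m :: int where m: "\<bar>of_int a / of_int q - of_int m\<bar> \<le> (1 / 2 :: real)"
    using of_int_round_abs_le[of "of_int a / of_int q :: real"] by (metis abs_minus_commute)
  have "ee (of_int a / of_int q - of_int m) = ee (of_int a / of_int q)" by (rule ee_cong_int) simp
  then have "\<bar>of_int a / of_int q - of_int m\<bar> \<le> (0::real)"
    using norm_ee_minus_one[OF m] 1 by simp
  then have "real_of_int a = of_int (m * q)" using assms by (simp add: field_simps)
  then have "a = m * q" by (simp only: of_int_eq_iff)
  then show "q dvd a" by simp
qed

lemma ee_orthogonality:
  fixes q c :: int
  assumes "q > 0"
  shows "(\<Sum>b\<in>{0..<q}. ee (of_int (b * c) / of_int q)) = (if q dvd c then of_int q else 0)"
proof (cases "q dvd c")
  case True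
  then have "ee (of_int (b * c) / of_int q) = 1" for b using assms by (simp only: ee_eq_1_iff dvd_mult)
  then show ?thesis using True assms by simp
next
  case False
  let ?S = "\<Sum>b\<in>{0..<q}. ee (of_int (b * c) / of_int q)"
  have "?S = (\<Sum>b\<in>{0..<q}. ee (of_int ((1 * b + 1) * c) / of_int q))"
    by (rule sum_mod_reindex[symmetric]) (use assms in \<open>auto intro!: ee_cong_mod cong_mult simp del: of_int_mult\<close>)
  also have "\<dots> = ee (of_int c / of_int q) * ?S"
    by (simp add: sum_distrib_left ee_add add_divide_distrib ring_distribs mult.commute)
  finally have "?S * (ee (of_int c / of_int q) - 1) = 0" by (simp add: algebra_simps)
  moreover have "ee (of_int c / of_int q) \<noteq> 1" using False assms by (simp add: ee_eq_1_iff)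
  ultimately show ?thesis using False by simp
qed

text \<open>Translation by \<open>c\<close> permutes the residues mod \<open>q\<close> and keeps the
  class of \<open>x0\<close>, so the class sum equals \<open>\<omega>\<close> times itself. The
  cancellation at prime powers rests on this.\<close>

lemma class_sum_zero:
  fixes F :: "int \<Rightarrow> complex" and q p c x0 :: int
  assumes q: "q > 0" "p dvd q" and per: "\<And>x y. [x = y] (mod q) \<Longrightarrow> F x = F y"
    and c: "p dvd c" and \<omega>: "\<omega> \<noteq> 1" and sh: "\<And>x. [x = x0] (mod p) \<Longrightarrow> F (x + c) = \<omega> * F x"
  shows "(\<Sum>x\<in>{0..<q}. if [x = x0] (mod p) then F x else 0) = 0"
proof -
  let ?G = "\<lambda>x. if [x = x0] (mod p) then F x else 0"
  have "[x = x0] (mod p) \<longleftrightarrow> [y = x0] (mod p)" if "[x = y] (mod q)" for x y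
    using cong_dvd_modulus[OF that q(2)] by (meson cong_sym cong_trans)
  then have "(\<Sum>x\<in>{0..<q}. ?G (1 * x + c)) = (\<Sum>x\<in>{0..<q}. ?G x)"
    using q(1) per by (intro sum_mod_reindex) auto
  moreover have "?G (1 * x + c) = \<omega> * ?G x" for x
  proof -
    have "[x + c = x0] (mod p) \<longleftrightarrow> [x = x0] (mod p)"
      using c dvd_add_left_iff[of p c "x - x0"] by (simp add: cong_iff_dvd_diff algebra_simps)
    then show ?thesis using sh by simp
  qed
  ultimately have "\<omega> * (\<Sum>x\<in>{0..<q}. ?G x) = (\<Sum>x\<in>{0..<q}. ?G x)" by (simp add: sum_distrib_left)
  then show ?thesis using \<omega> by simp
qed

lemma sum_residue_classes:
  fixes F :: "int \<Rightarrow> complex" and p :: int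
  assumes "p > 0"
  shows "(\<Sum>x\<in>{0..<q}. F x) = (\<Sum>x0\<in>{0..<p}. \<Sum>x\<in>{0..<q}. if [x = x0] (mod p) then F x else 0)"
proof -
  have "(\<Sum>x0\<in>{0..<p}. if [x = x0] (mod p) then F x else 0) = F x" for x
  proof -
    have "(\<Sum>x0\<in>{0..<p}. if [x = x0] (mod p) then F x else 0) = (\<Sum>x0\<in>{0..<p}. if x0 = x mod p then F x else 0)"
      by (intro sum.cong refl) (auto simp: cong_def)
    then show ?thesis using assms by simp
  qed
  then show ?thesis by (subst sum.swap) simp
qed

lemma poly_cong_int:
  fixes P :: "int poly"
  assumes "[x = y] (mod q)"
  shows "[poly P x = poly P y] (mod q)"
  using assms by (induction P) (auto intro: cong_add cong_mult)

lemma poly_taylor2: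
  fixes P :: "int poly"
  shows "\<exists>c. poly P (y + z) = poly P y + z * poly (pderiv P) y + z\<^sup>2 * c"
proof (induction P)
  case 0
  then show ?case by auto
next
  case (pCons a P)
  then obtain c where c: "poly P (y + z) = poly P y + z * poly (pderiv P) y + z\<^sup>2 * c" by blast
  show ?case
    by (intro exI[of _ "poly (pderiv P) y + z * c + y * c"])
       (simp add: c pderiv_pCons power2_eq_square algebra_simps)
qed

section \<open>Weyl sums\<close>

text \<open>\<open>\<phi>\<close> is a phase of degree at most \<open>k\<close> with leading coefficient \<open>\<theta>\<close>, characterised by its iterated differences.\<close>

primrec pphase :: "nat \<Rightarrow> real \<Rightarrow> (int \<Rightarrow> real) \<Rightarrow> bool" where
  "pphase 0 \<theta> \<phi> = (\<forall>j. \<phi> j = \<theta>)"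
| "pphase (Suc k) \<theta> \<phi> = (\<forall>h. pphase k (real (Suc k) * of_int h * \<theta>) (\<lambda>j. \<phi> (j + h) - \<phi> j))"

lemma pphase_poly:
  fixes p :: "real poly"
  assumes "degree p \<le> k"
  shows "pphase k (coeff p k) (\<lambda>j. poly p (of_int j))"
  using assms
proof (induction k arbitrary: p)
  case 0
  then show ?case by (auto elim!: degree_eq_zeroE)
next
  case (Suc k)
  show ?case
  proof (simp only: pphase.simps, intro allI)
    fix h :: int
    from poly_difference[OF Suc.prems, of "of_int h"] obtain r where
      r: "degree r \<le> k" "coeff r k = real (Suc k) * of_int h * coeff p (Suc k)"
      "\<And>x. poly r x = poly p (x + of_int h) - poly p x" by auto
    from Suc.IH[OF r(1)] show "pphase k (real (Suc k) * of_int h * coeff p (Suc k))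
       (\<lambda>j. poly p (of_int (j + h)) - poly p (of_int j))"
      by (simp add: r(2) r(3))
  qed
qed

lemma round_error: "\<exists>a::int. \<bar>x - of_int a\<bar> \<le> 1 / 2" for x :: real
  using of_int_round_abs_le[of x] by (intro exI[of _ "round x"]) (simp add: abs_minus_commute)

text \<open>Geometric series: the sum times \<open>ee t - 1\<close> has norm at most 2, and
  \<open>ee t - 1\<close> is at least the distance \<open>\<bar>t\<bar>\<close> of
  \<open>\<theta>\<close> to the nearest integer.\<close>

lemma weyl_linear:
  fixes \<theta> c :: real
  assumes "X > 0" and b: "X \<le> norm (\<Sum>i<l. ee (\<theta> * real i + c))"
  shows "\<exists>a::int. \<bar>\<theta> - of_int a\<bar> * X \<le> 2"
proof -
  obtain a :: int where a: "\<bar>\<theta> - of_int a\<bar> \<le> 1 / 2" using round_error by blast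
  define t where "t = \<theta> - of_int a"
  have e: "ee (\<theta> * real i + c) = ee c * ee t ^ i" for i
  proof -
    have "\<theta> * real i + c - (c + real i * t) \<in> \<int>" by (simp add: t_def algebra_simps)
    then have "ee (\<theta> * real i + c) = ee (c + real i * t)" by (rule ee_cong_int)
    then show ?thesis by (simp add: ee_add ee_of_nat_mult)
  qed
  have "(\<Sum>i<l. ee (\<theta> * real i + c)) * (ee t - 1) = ee c * ((\<Sum>i<l. ee t ^ i) * (ee t - 1))"
    by (simp add: e sum_distrib_left mult.assoc)
  also have "(\<Sum>i<l. ee t ^ i) * (ee t - 1) = ee t ^ l - 1"
    using power_diff_1_eq[of "ee t" l] by (simp add: mult.commute)
  finally have "norm (\<Sum>i<l. ee (\<theta> * real i + c)) * norm (ee t - 1) = norm (ee t ^ l - 1)"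
    by (metis norm_mult norm_ee mult_1)
  also have "\<dots> \<le> 2"
    by (rule order_trans[OF norm_triangle_ineq4]) (simp add: norm_power)
  finally have "norm (\<Sum>i<l. ee (\<theta> * real i + c)) * norm (ee t - 1) \<le> 2" .
  moreover have "X * \<bar>t\<bar> \<le> norm (\<Sum>i<l. ee (\<theta> * real i + c)) * norm (ee t - 1)"
    using b assms(1) norm_ee_minus_one[of t] a by (intro mult_mono) (auto simp: t_def)
  ultimately show ?thesis by (intro exI[of _ a]) (simp add: t_def mult.commute)
qed

text \<open>Weyl differencing as an exact identity: off-diagonal pairs are grouped by their distance
  \<open>h\<close>, and the pairs in reverse order are the conjugates. In the induction the new term
  \<open>z l\<close> meets every earlier \<open>z (l - h)\<close> once.\<close>

lemma norm_sum_square: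
  fixes z :: "nat \<Rightarrow> complex"
  shows "(norm (\<Sum>i<l. z i))\<^sup>2 = (\<Sum>i<l. (norm (z i))\<^sup>2) +
           2 * Re (\<Sum>h=1..<l. \<Sum>j<l - h. z (j + h) * cnj (z j))"
proof (induction l)
  case 0
  then show ?case by simp
next
  case (Suc l)
  have n2: "(norm (a + b))\<^sup>2 = (norm a)\<^sup>2 + (norm b)\<^sup>2 + 2 * Re (b * cnj a)" for a b :: complex
    unfolding cmod_power2 by (simp add: power2_eq_square algebra_simps)
  have "(\<Sum>h=1..<Suc l. \<Sum>j<Suc l - h. z (j + h) * cnj (z j)) =
        (\<Sum>h=1..<Suc l. (\<Sum>j<l - h. z (j + h) * cnj (z j)) + z l * cnj (z (l - h)))"
  proof (rule sum.cong[OF refl])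
    fix h assume h: "h \<in> {1..<Suc l}"
    then have "Suc l - h = Suc (l - h)" "l - h + h = l" by auto
    then show "(\<Sum>j<Suc l - h. z (j + h) * cnj (z j)) = (\<Sum>j<l - h. z (j + h) * cnj (z j)) + z l * cnj (z (l - h))"
      by simp
  qed
  also have "\<dots> = (\<Sum>h=1..<Suc l. \<Sum>j<l - h. z (j + h) * cnj (z j)) + z l * cnj (\<Sum>h=1..<Suc l. z (l - h))"
    by (simp only: sum.distrib sum_distrib_left cnj_sum)
  also have "(\<Sum>h=1..<Suc l. z (l - h)) = (\<Sum>i<l. z i)"
    by (rule sum.reindex_bij_witness[of _ "\<lambda>i. l - i" "\<lambda>h. l - h"]) auto
  also have "(\<Sum>h=1..<Suc l. \<Sum>j<l - h. z (j + h) * cnj (z j)) = (\<Sum>h=1..<l. \<Sum>j<l - h. z (j + h) * cnj (z j))"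
    by (cases "l = 0") (auto simp: sum.atLeastLessThan_Suc)
  finally show ?case
    using Suc.IH n2[of "\<Sum>i<l. z i" "z l"] by (simp add: algebra_simps)
qed

section \<open>Pigeonhole counting and spacing modulo 1\<close>

lemma card_le_fibres:
  assumes "finite A" "\<And>y. y \<in> f ` A \<Longrightarrow> real (card {x \<in> A. f x = y}) \<le> m"
  shows "real (card A) \<le> m * real (card (f ` A))"
proof -
  have "real (card A) = (\<Sum>x\<in>A. 1)" by simp
  also have "\<dots> = (\<Sum>y\<in>f ` A. \<Sum>x\<in>{x \<in> A. f x = y}. 1)"
    by (rule sum.image_gen[OF assms(1)])
  also have "\<dots> \<le> (\<Sum>y\<in>f ` A. m)"
    using assms(2) by (intro sum_mono) simp
  finally show ?thesis by (simp add: mult.commute)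
qed

lemma exists_big_fibre:
  assumes "finite A" "A \<noteq> {}" "real (card (f ` A)) \<le> M"
  shows "\<exists>y\<in>f ` A. real (card A) \<le> M * real (card {x \<in> A. f x = y})"
proof (rule ccontr)
  assume "\<not> ?thesis"
  then have "\<And>y. y \<in> f ` A \<Longrightarrow> M * real (card {x \<in> A. f x = y}) < real (card A)" by (auto simp: not_le)
  moreover have "card (f ` A) > 0" using assms by (simp add: card_gt_0_iff)
  then have M: "M > 0" using assms(3) by linarith
  ultimately have l: "\<And>y. y \<in> f ` A \<Longrightarrow> real (card {x \<in> A. f x = y}) < real (card A) / M"
    by (simp add: field_simps)
  have "real (card A) = (\<Sum>x\<in>A. 1)" by simp
  also have "\<dots> = (\<Sum>y\<in>f ` A. \<Sum>x\<in>{x \<in> A. f x = y}. 1)"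
    by (rule sum.image_gen[OF assms(1)])
  also have "\<dots> < (\<Sum>y\<in>f ` A. real (card A) / M)"
    using assms(1,2) l by (intro sum_strict_mono) auto
  also have "\<dots> = real (card (f ` A)) * (real (card A) / M)" by simp
  also have "\<dots> \<le> M * (real (card A) / M)" using assms(3) M by (intro mult_right_mono) auto
  finally show False using M by simp
qed


lemma of_nat_div_le_divide: "real (m div n) \<le> real m / real n"
  using of_int_floor_le[of "real m / real n"] by (simp add: floor_divide_of_nat_eq)

lemma same_div_less:
  fixes a b B :: nat
  assumes "a div B = b div B" "B > 0"
  shows "b < a + B"
proof -
  have "b div B * B + b mod B = b" "b mod B < B" using assms(2) by simp_all
  moreover have "b div B * B \<le> a" using div_times_less_eq_dividend[of a B] assms(1) by simp
  ultimately show ?thesis by linarith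
qed

text \<open>If \<open>h \<psi>\<close> is close to an integer for a positive proportion of the \<open>h < X\<close>, then two of them give a small \<open>q\<close>
  with \<open>q \<psi> = a0 + \<kappa>\<close>, \<open>\<kappa>\<close> small; were \<open>\<kappa>\<close> not of size \<open>1/X\<close>, then along each progression modulo \<open>q\<close> the multiples
  of \<open>\<kappa>\<close> would leave the neighbourhood of the integers most of the time.\<close>

lemma vinogradov_spacing:
  fixes \<psi> \<epsilon> W :: real and X :: nat and H :: "nat set"
  assumes H: "H \<subseteq> {..<X}" and W: "W \<ge> 1" and card_H: "real X \<le> real (card H) * W"
    and eps: "0 \<le> \<epsilon>" "32 * \<epsilon> * W \<le> 1" and X: "12 * W\<^sup>2 \<le> real X"
    and close: "\<And>h. h \<in> H \<Longrightarrow> \<exists>a::int. \<bar>real h * \<psi> - of_int a\<bar> \<le> \<epsilon>"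
  shows "\<exists>q::nat. q \<ge> 1 \<and> real q \<le> 3 * W \<and> (\<exists>a::int. \<bar>real q * \<psi> - of_int a\<bar> * real X \<le> 24 * W\<^sup>2 * \<epsilon>)"
proof -
  have finH: "finite H" using H finite_subset by blast
  have "W \<le> W\<^sup>2" using W by (simp add: power2_eq_square)
  then have WX: "12 * W \<le> real X" using X by linarith
  have diff: "\<exists>a::int. \<bar>real (h' - h) * \<psi> - of_int a\<bar> \<le> 2 * \<epsilon>" if "h \<in> H" "h' \<in> H" "h \<le> h'" for h h'
  proof -
    obtain a b :: int where "\<bar>real h * \<psi> - of_int a\<bar> \<le> \<epsilon>" "\<bar>real h' * \<psi> - of_int b\<bar> \<le> \<epsilon>"
      using close \<open>h \<in> H\<close> \<open>h' \<in> H\<close> by meson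
    then have "\<bar>(real h' * \<psi> - of_int b) - (real h * \<psi> - of_int a)\<bar> \<le> 2 * \<epsilon>" by linarith
    then show ?thesis using \<open>h \<le> h'\<close>
      by (intro exI[of _ "b - a"]) (simp add: of_nat_diff algebra_simps)
  qed
  \<comment> \<open>There are at most \<open>X / (2 * W) + 1\<close> blocks of this length, fewer
    than \<open>card H\<close>, so two elements of \<open>H\<close> share a block and their
    difference serves as \<open>q\<close>.\<close>
  define B where "B = nat \<lceil>2 * W\<rceil>"
  have B: "2 * W \<le> real B" "real B \<le> 3 * W" "B > 0" using W unfolding B_def by linarith+
  have "card ((\<lambda>h. h div B) ` H) \<le> card {..X div B}"
    using H by (intro card_mono) (auto intro!: div_le_mono dest!: subsetD)
  then have "real (card ((\<lambda>h. h div B) ` H)) \<le> real (X div B) + 1" by simp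
  also have "\<dots> \<le> real X / real B + 1" by (simp add: of_nat_div_le_divide)
  also have "\<dots> \<le> real X / (2 * W) + 1" using B W by (intro add_mono divide_left_mono) auto
  also have "\<dots> < real X / W" using W WX by (simp add: field_simps)
  also have "\<dots> \<le> real (card H)" using card_H W by (simp add: field_simps)
  finally have "\<not> inj_on (\<lambda>h. h div B) H" by (intro pigeonhole) simp
  then obtain h1 h2 where h12: "h1 \<in> H" "h2 \<in> H" "h1 < h2" "h1 div B = h2 div B"
    unfolding inj_on_def using linorder_neqE_nat by (smt (verit))
  define q where "q = h2 - h1"
  have "h2 < h1 + B"
    using h12(4) B(3) by (rule same_div_less)
  then have q: "1 \<le> q" "q < B" using h12(3) unfolding q_def by auto
  have q3: "real q \<le> 3 * W" using q B by simp
  obtain a0 :: int where a0: "\<bar>real q * \<psi> - of_int a0\<bar> \<le> 2 * \<epsilon>"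
    using diff[OF h12(1,2)] h12(3) unfolding q_def by auto
  define \<kappa> where "\<kappa> = real q * \<psi> - of_int a0"
  have \<kappa>: "\<bar>\<kappa>\<bar> \<le> 2 * \<epsilon>" using a0 by (simp add: \<kappa>_def)
  have e32: "32 * \<epsilon> \<le> 1" using eps W mult_left_mono[of 1 W "32 * \<epsilon>"] by simp
  have "\<bar>\<kappa>\<bar> * real X \<le> 24 * W\<^sup>2 * \<epsilon>"
  proof (cases "\<kappa> = 0")
    case True
    then show ?thesis using eps by simp
  next
    case False
    \<comment> \<open>For \<open>m < K\<close> the multiple \<open>m * \<kappa>\<close> stays within
      1/2 of 0, so if it is close to an integer, that integer is 0 and \<open>m\<close> itself must
      be small.\<close>
    define K where "K = nat \<lfloor>1 / (2 * \<bar>\<kappa>\<bar>)\<rfloor>"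
    have one: "1 / (2 * \<bar>\<kappa>\<bar>) \<ge> 1" using \<kappa> e32 False by (simp add: field_simps)
    have K: "real K \<le> 1 / (2 * \<bar>\<kappa>\<bar>)" "1 / (2 * \<bar>\<kappa>\<bar>) < real K + 1" "K \<ge> 1"
      using one unfolding K_def by linarith+
    have K4: "1 \<le> 4 * \<bar>\<kappa>\<bar> * real K"
    proof -
      have "1 / (2 * \<bar>\<kappa>\<bar>) < 2 * real K" using K by linarith
      then show ?thesis using False by (simp add: field_simps)
    qed
    \<comment> \<open>A fibre is the part of \<open>H\<close> in one residue class mod
      \<open>q\<close> inside one block of length \<open>q * K\<close>; relative to its least
      element the multiples of \<open>\<psi>\<close> are \<open>m * \<kappa>\<close> modulo 1 with
      \<open>m < K\<close>.\<close>
    define F where "F = (\<lambda>h. (h div (q * K), h mod q))"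
    have fib: "real (card {h \<in> H. F h = y}) \<le> 2 * \<epsilon> / \<bar>\<kappa>\<bar> + 1" if y: "y \<in> F ` H" for y
    proof -
      let ?Z = "{h \<in> H. F h = y}"
      have finZ: "finite ?Z" using finH by simp
      have neZ: "?Z \<noteq> {}" using y by auto
      define h0 where "h0 = Min ?Z"
      have h0: "h0 \<in> ?Z" "\<And>h. h \<in> ?Z \<Longrightarrow> h0 \<le> h" using Min_in[OF finZ neZ] Min_le[OF finZ] by (simp_all add: h0_def)
      have key: "q dvd h - h0 \<and> real ((h - h0) div q) \<le> 2 * \<epsilon> / \<bar>\<kappa>\<bar>" if h: "h \<in> ?Z" for h
      proof -
        have eq: "h div (q * K) = h0 div (q * K)" "h mod q = h0 mod q" using h h0(1) by (auto simp: F_def)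
        have dv: "q dvd h - h0" using mod_eq_dvd_iff_nat[OF h0(2)[OF h], of q] eq(2) by simp
        define m where "m = (h - h0) div q"
        have m: "h - h0 = q * m" using dv by (simp add: m_def)
        have "h < h0 + q * K"
          using eq(1)[symmetric] q(1) K(3) by (intro same_div_less) auto
        then have "q * m < q * K" using m h0(2)[OF h] by linarith
        then have "m < K" by simp
        then have "real m * \<bar>\<kappa>\<bar> \<le> real K * \<bar>\<kappa>\<bar>" by (intro mult_right_mono) auto
        also have "\<dots> \<le> 1 / 2" using K(1) False by (simp add: field_simps)
        finally have mk: "\<bar>real m * \<kappa>\<bar> \<le> 1 / 2" by (simp add: abs_mult)
        obtain b :: int where "\<bar>real (h - h0) * \<psi> - of_int b\<bar> \<le> 2 * \<epsilon>"
          using diff h h0(1) h0(2)[OF h] by blast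
        moreover have "real (h - h0) * \<psi> = real m * \<kappa> + of_int (int m * a0)"
          unfolding m \<kappa>_def by (simp add: algebra_simps)
        ultimately have b: "\<bar>real m * \<kappa> - of_int (b - int m * a0)\<bar> \<le> 2 * \<epsilon>" by (simp add: algebra_simps)
        then have "\<bar>real_of_int (b - int m * a0)\<bar> < 1" using mk e32 eps by linarith
        then have "b - int m * a0 = 0" by linarith
        then have "real m * \<bar>\<kappa>\<bar> \<le> 2 * \<epsilon>" using b by (simp add: abs_mult)
        then show ?thesis using dv False by (simp add: m_def field_simps)
      qed
      have "inj_on (\<lambda>h. (h - h0) div q) ?Z"
      proof (rule inj_onI)
        fix h h' assume h: "h \<in> ?Z" "h' \<in> ?Z" "(h - h0) div q = (h' - h0) div q"
        have "h - h0 = q * ((h - h0) div q)" "h' - h0 = q * ((h' - h0) div q)"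
          using key[OF h(1)] key[OF h(2)] by auto
        then have "h - h0 = h' - h0" using h(3) by simp
        then show "h = h'" using h0(2)[OF h(1)] h0(2)[OF h(2)] by simp
      qed
      moreover have "(\<lambda>h. (h - h0) div q) ` ?Z \<subseteq> {..nat \<lfloor>2 * \<epsilon> / \<bar>\<kappa>\<bar>\<rfloor>}"
        using key by (auto simp: le_nat_floor)
      ultimately have "card ?Z \<le> card {..nat \<lfloor>2 * \<epsilon> / \<bar>\<kappa>\<bar>\<rfloor>}" by (intro card_inj_on_le) auto
      then have "real (card ?Z) \<le> real (nat \<lfloor>2 * \<epsilon> / \<bar>\<kappa>\<bar>\<rfloor>) + 1" by simp
      also have "\<dots> \<le> 2 * \<epsilon> / \<bar>\<kappa>\<bar> + 1" using eps by simp
      finally show ?thesis .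
    qed
    have "card (F ` H) \<le> card ({..X div (q * K)} \<times> {..<q})"
      using H q by (intro card_mono) (auto simp: F_def intro!: div_le_mono dest!: subsetD)
    also have "\<dots> = (X div (q * K) + 1) * q" by (simp add: card_cartesian_product)
    finally have "real (card (F ` H)) \<le> real ((X div (q * K) + 1) * q)" by (rule of_nat_mono)
    also have "\<dots> = (real (X div (q * K)) + 1) * real q" by (simp only: of_nat_mult of_nat_add of_nat_1)
    also have "\<dots> \<le> (real X / (real q * real K) + 1) * real q"
      by (intro mult_right_mono add_mono) (use of_nat_div_le_divide[of X "q*K"] in auto)
    also have "\<dots> = real X / real K + real q" using q K by (simp add: field_simps)
    also have "\<dots> \<le> 4 * \<bar>\<kappa>\<bar> * real X + real q"
    proof -
      have "real X * 1 \<le> real X * (4 * \<bar>\<kappa>\<bar> * real K)" using K4 by (intro mult_left_mono) auto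
      then show ?thesis using K(3) by (simp add: field_simps)
    qed
    finally have cI: "real (card (F ` H)) \<le> 4 * \<bar>\<kappa>\<bar> * real X + real q" .
    \<comment> \<open>Fibre size times number of fibres. The terms in \<open>\<epsilon> * X\<close>
      and \<open>q\<close> use up at most three quarters of \<open>X / W\<close>, so
      \<open>2 * \<epsilon> * q / \<bar>\<kappa>\<bar>\<close> is at least
      \<open>X / (4 * W)\<close>, which bounds \<open>\<kappa>\<close>.\<close>
    have "real X / W \<le> real (card H)" using card_H W by (simp add: field_simps)
    also have "\<dots> \<le> (2 * \<epsilon> / \<bar>\<kappa>\<bar> + 1) * real (card (F ` H))" by (rule card_le_fibres[OF finH fib])
    also have "\<dots> \<le> (2 * \<epsilon> / \<bar>\<kappa>\<bar> + 1) * (4 * \<bar>\<kappa>\<bar> * real X + real q)"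
      using cI eps by (intro mult_left_mono) auto
    also have "\<dots> = 8 * \<epsilon> * real X + 4 * \<bar>\<kappa>\<bar> * real X + 2 * \<epsilon> * real q / \<bar>\<kappa>\<bar> + real q"
      using False by (simp add: field_simps)
    also have "\<dots> \<le> 8 * \<epsilon> * real X + 8 * \<epsilon> * real X + 2 * \<epsilon> * real q / \<bar>\<kappa>\<bar> + real q"
      using mult_right_mono[OF \<kappa>, of "4 * real X"] by (simp add: algebra_simps)
    finally have "real X / W \<le> 16 * \<epsilon> * real X + 2 * \<epsilon> * real q / \<bar>\<kappa>\<bar> + real q" by simp
    moreover have "16 * \<epsilon> * real X \<le> real X / (2 * W)"
      using mult_right_mono[OF eps(2), of "real X"] W by (simp add: field_simps)
    moreover have "real q \<le> real X / (4 * W)"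
    proof -
      have "W * (real q * 4) \<le> W * (3 * W * 4)" using q3 W by (intro mult_left_mono) auto
      then have "W * (real q * 4) \<le> real X" using X by (simp add: power2_eq_square)
      then show ?thesis using W by (simp add: field_simps)
    qed
    ultimately have "real X / (4 * W) \<le> 2 * \<epsilon> * real q / \<bar>\<kappa>\<bar>" by (simp add: field_simps)
    then have "\<bar>\<kappa>\<bar> * real X \<le> 8 * W * \<epsilon> * real q" using W False by (simp add: field_simps)
    also have "\<dots> \<le> 8 * W * \<epsilon> * (3 * W)" using q3 W eps by (intro mult_left_mono) auto
    finally show ?thesis by (simp add: power2_eq_square mult_ac)
  qed
  then show ?thesis using q(1) q3 unfolding \<kappa>_def by blast
qed

text \<open>Iterated differencing. In place of the divisor bound, the many good approximations to \<open>h \<theta>\<close>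
  are combined into one approximation to \<open>\<theta>\<close> by \<open>vinogradov_spacing\<close>; this only loses powers of \<open>Z\<close>.\<close>

theorem weyl:
  "\<exists>C::nat. C \<ge> 1 \<and> (\<forall>\<theta> \<phi> X l Z m. pphase (Suc k) \<theta> \<phi> \<longrightarrow> l \<le> X \<longrightarrow> X \<ge> 1 \<longrightarrow> Z \<ge> 1 \<longrightarrow>
     real X \<le> Z * norm (\<Sum>i<l. ee (\<phi> (m + int i))) \<longrightarrow>
     (\<exists>q::nat. q \<ge> 1 \<and> real q \<le> real C * Z ^ C \<and>
        (\<exists>a::int. \<bar>real q * \<theta> - of_int a\<bar> * real X ^ Suc k \<le> real C * Z ^ C)))"
proof (induction k)
  case 0
  show ?case
  proof (rule exI[of _ 2], intro conjI allI impI)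
    fix \<theta> :: real and \<phi> :: "int \<Rightarrow> real" and X l :: nat and Z :: real and m :: int
    assume pp: "pphase (Suc 0) \<theta> \<phi>" and "X \<ge> 1" "Z \<ge> 1"
      and b: "real X \<le> Z * norm (\<Sum>i<l. ee (\<phi> (m + int i)))"
    have "\<phi> (m + int i) - \<phi> m = of_int (int i) * \<theta>" for i using pp by simp
    then have "\<phi> (m + int i) = \<theta> * real i + \<phi> m" for i by (simp add: algebra_simps)
    then have "real X / Z \<le> norm (\<Sum>i<l. ee (\<theta> * real i + \<phi> m))"
      using b \<open>Z \<ge> 1\<close> by (simp add: field_simps)
    then obtain a :: int where a: "\<bar>\<theta> - of_int a\<bar> * (real X / Z) \<le> 2"
      using weyl_linear[of "real X / Z"] \<open>X \<ge> 1\<close> \<open>Z \<ge> 1\<close> by fastforce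
    have ZZ: "1 \<le> Z\<^sup>2" "Z \<le> Z\<^sup>2" using \<open>Z \<ge> 1\<close> by (auto simp: power2_eq_square one_le_power mult_ge1_I)
    show "\<exists>q::nat. q \<ge> 1 \<and> real q \<le> real 2 * Z ^ 2 \<and>
        (\<exists>a::int. \<bar>real q * \<theta> - of_int a\<bar> * real X ^ Suc 0 \<le> real 2 * Z ^ 2)"
      using a ZZ \<open>Z \<ge> 1\<close> by (intro exI[of _ "1::nat"] conjI exI[of _ a]) (auto simp: field_simps)
  qed auto
next
  case (Suc k)
  define n where "n = Suc k"
  from Suc obtain C :: nat where C: "C \<ge> 1" and IH: "\<And>\<theta> \<phi> X l Z m. pphase n \<theta> \<phi> \<Longrightarrow> l \<le> X \<Longrightarrow> X \<ge> 1 \<Longrightarrow> Z \<ge> 1 \<Longrightarrow>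
     real X \<le> Z * norm (\<Sum>i<l. ee (\<phi> (m + int i))) \<Longrightarrow>
     (\<exists>q::nat. q \<ge> 1 \<and> real q \<le> real C * Z ^ C \<and>
        (\<exists>a::int. \<bar>real q * \<theta> - of_int a\<bar> * real X ^ n \<le> real C * Z ^ C))"
    unfolding n_def by blast
  \<comment> \<open>With \<open>W = Y * A\<close> below, \<open>c * Z ^ e\<close> equals
    \<open>46 ^ Suc n * Suc n * W ^ (2 * n + 3)\<close>, which dominates the bounds of both cases;
    the one number \<open>C'\<close> then serves as constant and as exponent.\<close>
  define c where "c = 46 ^ Suc n * Suc n * (8 ^ Suc C * C) ^ (2 * n + 3)"
  define e where "e = (2 * C + 2) * (2 * n + 3)"
  define C' where "C' = c + e"
  have c1: "c \<ge> 1" using C unfolding c_def by (simp add: Suc_le_eq)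
  show ?case unfolding n_def[symmetric]
  proof (rule exI[of _ C'], intro conjI allI impI)
    show "1 \<le> C'" using c1 by (simp add: C'_def)
    fix \<theta> :: real and \<phi> :: "int \<Rightarrow> real" and X l :: nat and Z :: real and m :: int
    assume pp: "pphase (Suc n) \<theta> \<phi>" and lX: "l \<le> X" and X1: "X \<ge> 1" and Z1: "Z \<ge> 1"
      and b: "real X \<le> Z * norm (\<Sum>i<l. ee (\<phi> (m + int i)))"
    \<comment> \<open>Differences \<open>h\<close> whose sum is below \<open>X / Y\<close>
      contribute at most a quarter of \<open>(X / Z)^2\<close>, and the diagonal at most half; the
      remaining quarter forces many good \<open>h\<close>.\<close>
    define Y where "Y = 8 * Z\<^sup>2"
    define A where "A = real C * Y ^ C"
    define W where "W = Y * A"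
    have ZZ: "1 \<le> Z\<^sup>2" using Z1 by simp
    have Y: "Y \<ge> 8" using ZZ by (simp add: Y_def)
    have "1 * 1 \<le> real C * Y ^ C" using C Y by (intro mult_mono one_le_power) auto
    then have A: "A \<ge> 1" by (simp add: A_def)
    have W: "W \<ge> 1" "A \<le> W" "Z\<^sup>2 \<le> W" 
    proof -
      show "A \<le> W" using A Y mult_right_mono[of 1 Y A] by (simp add: W_def)
      then show "W \<ge> 1" using A by simp
      have "Z\<^sup>2 \<le> Y * 1" using ZZ by (simp add: Y_def)
      also have "\<dots> \<le> W" unfolding W_def using A Y by (intro mult_left_mono) auto
      finally show "Z\<^sup>2 \<le> W" .
    qed
    have "W = real (8 ^ Suc C * C) * Z ^ (2 * C + 2)"
      by (simp add: W_def A_def Y_def power_mult_distrib power_add power_mult power2_eq_square)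
    then have "W ^ (2 * n + 3) = (real (8 ^ Suc C * C) * Z ^ (2 * C + 2)) ^ (2 * n + 3)" by (rule arg_cong)
    also have "\<dots> = real ((8 ^ Suc C * C) ^ (2 * n + 3)) * Z ^ e"
      unfolding power_mult_distrib[of "real _"] e_def power_mult of_nat_power ..
    finally have "W ^ (2 * n + 3) = real ((8 ^ Suc C * C) ^ (2 * n + 3)) * Z ^ e" .
    then have "46 ^ Suc n * Suc n * W ^ (2 * n + 3) = c * Z ^ e"
      by (simp add: c_def)
    also have "\<dots> \<le> C' * Z ^ C'"
      using Z1 by (intro mult_mono power_increasing) (auto simp: C'_def)
    finally have fin: "46 ^ Suc n * Suc n * W ^ (2 * n + 3) \<le> C' * Z ^ C'" .
    have W23: "W ^ i \<le> W ^ (2 * n + 3)" if "i \<le> 2 * n + 3" for i using W that by (intro power_increasing) auto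
    have p46: "(46::real) \<le> 46 ^ Suc n" by simp
    show "\<exists>q::nat. q \<ge> 1 \<and> real q \<le> real C' * Z ^ C' \<and>
        (\<exists>a::int. \<bar>real q * \<theta> - of_int a\<bar> * real X ^ Suc n \<le> real C' * Z ^ C')"
    proof (cases "real X \<le> 46 * W\<^sup>2")
      \<comment> \<open>In a short range \<open>q = 1\<close> with the nearest integer to
        \<open>\<theta>\<close> is good enough, as \<open>X\<close> is at most a constant times a
        power of \<open>Z\<close>.\<close>
      case True
      obtain a :: int where a: "\<bar>\<theta> - of_int a\<bar> \<le> 1 / 2" using round_error by blast
      have "\<bar>\<theta> - of_int a\<bar> * real X ^ Suc n \<le> 1 * (46 * W\<^sup>2) ^ Suc n"
        using a True by (intro mult_mono power_mono) auto
      also have "\<dots> = 46 ^ Suc n * 1 * W ^ (2 * n + 2)" by (simp add: power_mult_distrib power_mult power_add power2_eq_square)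
      also have "\<dots> \<le> 46 ^ Suc n * Suc n * W ^ (2 * n + 3)"
        using W by (intro mult_mono W23) auto
      finally have 1: "\<bar>\<theta> - of_int a\<bar> * real X ^ Suc n \<le> C' * Z ^ C'" using fin by simp
      have "(1::nat) \<le> 46 ^ Suc n * Suc n" by (simp add: Suc_le_eq)
      then have "(1::real) \<le> 46 ^ Suc n * Suc n" by (metis of_nat_mono of_nat_1)
      moreover have "1 \<le> W ^ (2 * n + 3)" using W by (intro one_le_power)
      ultimately have "1 * 1 \<le> 46 ^ Suc n * Suc n * W ^ (2 * n + 3)" by (intro mult_mono) auto
      then have "1 \<le> C' * Z ^ C'" using fin by simp
      then show ?thesis using 1 by (intro exI[of _ "1::nat"] conjI exI[of _ a]) auto
    next
      case False
      then have XW: "46 * W\<^sup>2 < real X" by simp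
      have W2: "W \<le> W\<^sup>2" using W by (simp add: power2_eq_square)
      define s where "s = (\<lambda>h. \<Sum>j<l - h. ee (\<phi> (m + int j + int h) - \<phi> (m + int j)))"
      have "(real X / Z)\<^sup>2 \<le> (norm (\<Sum>i<l. ee (\<phi> (m + int i))))\<^sup>2"
        using b Z1 by (intro power_mono) (auto simp: field_simps)
      also have "\<dots> = real l + 2 * Re (\<Sum>h=1..<l. s h)"
        by (subst norm_sum_square) (simp add: s_def ee_diff algebra_simps)
      also have "\<dots> \<le> real X + 2 * (\<Sum>h=1..<l. norm (s h))"
        using lX complex_Re_le_cmod[of "\<Sum>h=1..<l. s h"] norm_sum[of s "{1..<l}"] by simp
      finally have 1: "(real X / Z)\<^sup>2 \<le> real X + 2 * (\<Sum>h=1..<l. norm (s h))" .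
      define G where "G = {h \<in> {1..<l}. real X \<le> Y * norm (s h)}"
      have finG: "finite G" by (simp add: G_def)
      have sX: "norm (s h) \<le> real X" for h
        unfolding s_def by (rule order_trans[OF norm_sum]) (use lX in simp)
      have "(\<Sum>h=1..<l. norm (s h)) \<le> (\<Sum>h=1..<l. (if h \<in> G then real X else 0) + real X / Y)"
      proof (rule sum_mono)
        fix h assume h: "h \<in> {1..<l}"
        show "norm (s h) \<le> (if h \<in> G then real X else 0) + real X / Y"
        proof (cases "h \<in> G")
          case True
          have "0 \<le> real X / Y" using Y by simp
          then show ?thesis using True sX[of h] by simp
        next
          case False
          then have "Y * norm (s h) \<le> real X" using h by (simp add: G_def)
          then show ?thesis using False Y by (simp add: field_simps)
        qed
      qed
      also have "\<dots> = (\<Sum>h\<in>{1..<l} \<inter> {h. h \<in> G}. real X) + real (l - 1) * (real X / Y)"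
        by (simp add: sum.distrib sum.If_cases)
      also have "{1..<l} \<inter> {h. h \<in> G} = G" by (auto simp: G_def)
      also have "(\<Sum>h\<in>G. real X) + real (l - 1) * (real X / Y) \<le> real (card G) * real X + real X * (real X / Y)"
        using lX Y by (intro add_mono mult_right_mono) auto
      finally have 2: "(\<Sum>h=1..<l. norm (s h)) \<le> real (card G) * real X + real X * (real X / Y)" .
      have "2 * Z\<^sup>2 \<le> real X" using W(3) W2 XW by linarith
      then have "real X * (2 * Z\<^sup>2) \<le> real X * real X" by (intro mult_left_mono) auto
      moreover have Zp: "0 < 2 * Z\<^sup>2" using ZZ by linarith
      ultimately have 3: "real X \<le> real X * real X / (2 * Z\<^sup>2)" by (simp add: pos_le_divide_eq)
      define r where "r = real X * real X / Z\<^sup>2"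
      have "(real X / Z)\<^sup>2 = r" "real X * real X / (2 * Z\<^sup>2) = r / 2" "real X * (real X / Y) = r / 8"
        by (simp_all add: r_def Y_def power2_eq_square)
      then have "real X * (real X / Y) \<le> real X * real (card G)"
        using 1 2 3 by (simp add: mult.commute)
      then have cG: "real X \<le> Y * real (card G)" using X1 Y by (simp add: field_simps)
      then have neG: "G \<noteq> {}" using X1 by auto
      have "\<exists>q::nat. q \<ge> 1 \<and> real q \<le> A \<and>
         (\<exists>a::int. \<bar>real q * (real (Suc n) * of_int (int h) * \<theta>) - of_int a\<bar> * real X ^ n \<le> A)" if "h \<in> G" for h
      proof (unfold A_def, rule IH)
        show "pphase n (real (Suc n) * of_int (int h) * \<theta>) (\<lambda>j. \<phi> (j + int h) - \<phi> j)"
          using pp unfolding pphase.simps by blast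
        show "real X \<le> Y * norm (\<Sum>i<l - h. ee (\<phi> (m + int i + int h) - \<phi> (m + int i)))"
          using that by (simp add: G_def s_def)
      qed (use lX X1 Y in auto)
      then obtain qf where qf: "\<And>h. h \<in> G \<Longrightarrow> qf h \<ge> 1 \<and> real (qf h) \<le> A \<and>
         (\<exists>a::int. \<bar>real (qf h) * (real (Suc n) * of_int (int h) * \<theta>) - of_int a\<bar> * real X ^ n \<le> A)"
        by metis
      \<comment> \<open>The denominators depend on \<open>h\<close> but take at most
        \<open>A\<close> values. The most frequent one, \<open>q0\<close>, leaves a set
        \<open>H\<close> of density at least \<open>1 / W\<close> on which all
        \<open>h * \<psi>\<close> are close to integers.\<close>
      have "qf ` G \<subseteq> {1..nat \<lfloor>A\<rfloor>}" using qf by (auto simp: le_nat_floor)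
      then have "card (qf ` G) \<le> nat \<lfloor>A\<rfloor>" using card_mono[of "{1..nat \<lfloor>A\<rfloor>}" "qf ` G"] by simp
      then have "real (card (qf ` G)) \<le> A" using A by linarith
      from exists_big_fibre[OF finG neG this] obtain q0 where
        q0: "q0 \<in> qf ` G" "real (card G) \<le> A * real (card {h \<in> G. qf h = q0})" by blast
      define H where "H = {h \<in> G. qf h = q0}"
      have q0A: "q0 \<ge> 1" "real q0 \<le> A" using q0(1) qf by auto
      define \<psi> where "\<psi> = real q0 * real (Suc n) * \<theta>"
      have Xn: "real X \<le> real X ^ n" using X1 self_le_power[of "real X" n] by (simp add: n_def)
      have "\<exists>q::nat. q \<ge> 1 \<and> real q \<le> 3 * W \<and> (\<exists>a::int. \<bar>real q * \<psi> - of_int a\<bar> * real X \<le> 24 * W\<^sup>2 * (A / real X ^ n))"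
      proof (rule vinogradov_spacing)
        show "H \<subseteq> {..<X}" using lX by (auto simp: H_def G_def)
        have "Y * real (card G) \<le> Y * (A * real (card H))" using q0(2) Y by (intro mult_left_mono) (auto simp: H_def)
        then show "real X \<le> real (card H) * W" using cG by (simp add: W_def algebra_simps)
        have "32 * A * W \<le> 32 * W * W" using W A by (intro mult_right_mono) auto
        also have "\<dots> \<le> real X" using XW W by (simp add: power2_eq_square)
        finally have "32 * A * W \<le> real X ^ n" using Xn by linarith
        then show "32 * (A / real X ^ n) * W \<le> 1" using X1 by (simp add: field_simps)
        show "12 * W\<^sup>2 \<le> real X" using XW zero_le_power2[of W] by linarith
        show "0 \<le> A / real X ^ n" using A by simp
        fix h assume h: "h \<in> H"
        then obtain a :: int where "\<bar>real q0 * (real (Suc n) * of_int (int h) * \<theta>) - of_int a\<bar> * real X ^ n \<le> A"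
          using qf[of h] by (auto simp: H_def)
        then show "\<exists>a::int. \<bar>real h * \<psi> - of_int a\<bar> \<le> A / real X ^ n"
          using X1 by (intro exI[of _ a]) (simp add: field_simps \<psi>_def)
      qed (use W in auto)
      then obtain q a where q: "q \<ge> (1::nat)" "real q \<le> 3 * W"
        and a: "\<bar>real q * \<psi> - of_int (a::int)\<bar> * real X \<le> 24 * W\<^sup>2 * (A / real X ^ n)" by blast
      have "real (q * q0 * Suc n) \<le> 3 * W * W * Suc n"
        using q q0A W(2) W(1) by (simp only: of_nat_mult, intro mult_mono) auto
      also have "\<dots> = 3 * Suc n * W ^ 2" by (simp add: power2_eq_square)
      also have "\<dots> \<le> 46 ^ Suc n * Suc n * W ^ (2 * n + 3)"
      proof (rule mult_mono)
        have "real (Suc n) * 3 \<le> real (Suc n) * 46 ^ Suc n" using p46 by (intro mult_left_mono; linarith)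
        then show "real (3 * Suc n) \<le> real (46 ^ Suc n * Suc n)"
          by (simp only: of_nat_mult of_nat_numeral of_nat_power mult.commute)
      qed (use W W23 in auto)
      finally have r1: "real (q * q0 * Suc n) \<le> C' * Z ^ C'" using fin by simp
      have "\<bar>real (q * q0 * Suc n) * \<theta> - of_int a\<bar> * real X ^ Suc n = (\<bar>real q * \<psi> - of_int a\<bar> * real X) * real X ^ n"
        by (simp add: \<psi>_def algebra_simps)
      also have "\<dots> \<le> 24 * W\<^sup>2 * (A / real X ^ n) * real X ^ n" using a by (intro mult_right_mono) auto
      also have "\<dots> = 24 * 1 * (W\<^sup>2 * A)" using X1 by simp
      also have "\<dots> \<le> 46 ^ Suc n * Suc n * W ^ (2 * n + 3)"
      proof (rule mult_mono)
        have "W\<^sup>2 * A \<le> W\<^sup>2 * W" using W by (intro mult_left_mono) auto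
        also have "\<dots> = W ^ 3" by (simp add: power2_eq_square power3_eq_cube)
        finally show "W\<^sup>2 * A \<le> W ^ (2 * n + 3)" using W23[of 3] by simp
        have "(24::real) \<le> 46 ^ Suc n * 1" using p46 by linarith
        also have "\<dots> \<le> 46 ^ Suc n * real (Suc n)" by (intro mult_left_mono) auto
        finally show "24 * 1 \<le> real (46 ^ Suc n * Suc n)"
          by (simp only: of_nat_mult of_nat_numeral of_nat_power mult_1_right)
      qed (use A in auto)
      finally have r2: "\<bar>real (q * q0 * Suc n) * \<theta> - of_int a\<bar> * real X ^ Suc n \<le> C' * Z ^ C'" using fin by simp
      have "q * q0 * Suc n \<ge> 1" using q q0A by (simp add: Suc_le_eq)
      then show ?thesis using r1 r2 by (intro exI[of _ "q * q0 * Suc n"]) blast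
    qed
  qed
qed

section \<open>Complete sums modulo prime powers\<close>

text \<open>Clearing denominators in the logarithmic derivative keeps the identity valid over any
  commutative ring; each factor contributes a geometric series, and their sum generates the power
  sums.\<close>

lemma newton_fps:
  fixes x :: "nat \<Rightarrow> 'a::comm_ring_1"
  shows "fps_deriv (\<Prod>i<n. 1 - fps_const (x i) * fps_X) =
         - (\<Prod>i<n. 1 - fps_const (x i) * fps_X) * (\<Sum>i<n. Abs_fps (\<lambda>j. x i ^ Suc j))"
proof (induction n)
  case 0
  then show ?case by simp
next
  case (Suc n)
  let ?A = "\<Prod>i<n. 1 - fps_const (x i) * fps_X" and ?P = "\<Sum>i<n. Abs_fps (\<lambda>j. x i ^ Suc j)"
  let ?L = "1 - fps_const (x n) * fps_X" and ?G = "Abs_fps (\<lambda>j. x n ^ Suc j)"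
  have g: "?L * ?G = fps_const (x n)"
  proof (rule fps_ext)
    fix j
    have "(?L * ?G) $ j = x n ^ Suc j - x n * (fps_X * ?G) $ j"
      by (simp add: left_diff_distrib mult.assoc)
    also have "\<dots> = fps_const (x n) $ j" by (cases j) simp_all
    finally show "(?L * ?G) $ j = fps_const (x n) $ j" .
  qed
  have "fps_deriv (?A * ?L) = - ?A * ?P * ?L - fps_const (x n) * ?A"
  proof -
    have "fps_deriv (?A * ?L) = fps_deriv ?A * ?L - fps_const (x n) * ?A" by (simp add: algebra_simps)
    then show ?thesis by (simp only: Suc.IH)
  qed
  also have "\<dots> = - ?A * ?P * ?L - (?L * ?G) * ?A" by (simp only: g)
  also have "\<dots> = - (?A * ?L) * (?P + ?G)" by (simp add: algebra_simps)
  finally show ?case by simp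
qed

text \<open>Reversal links two forms: the coefficients that Newton's recursion computes are those of
  the polynomial with roots \<open>x i\<close>. Their vanishing beyond \<open>n\<close> lets the
  induction extend the sum by one term.\<close>

lemma prod_roots_expand:
  fixes x :: "nat \<Rightarrow> 'a::comm_ring_1"
  defines "A \<equiv> \<lambda>n. \<Prod>i<n. 1 - fps_const (x i) * fps_X"
  shows "(\<Prod>i<n. t - x i) = (\<Sum>m\<le>n. A n $ m * t ^ (n - m)) \<and> (\<forall>m>n. A n $ m = 0)"
proof (induction n)
  case 0
  then show ?case by (simp add: A_def)
next
  case (Suc n)
  have step: "A (Suc n) = A n - fps_const (x n) * (fps_X * A n)"
    by (simp add: A_def algebra_simps)
  have c0: "A (Suc n) $ 0 = A n $ 0" by (simp add: step)
  have cS: "A (Suc n) $ Suc m = A n $ Suc m - x n * A n $ m" for m by (simp add: step)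
  have "(\<Sum>m\<le>Suc n. A (Suc n) $ m * t ^ (Suc n - m)) = A n $ 0 * t ^ Suc n + (\<Sum>m\<le>n. A (Suc n) $ Suc m * t ^ (n - m))"
    by (subst sum.atMost_Suc_shift) (simp add: c0)
  also have "\<dots> = (A n $ 0 * t ^ Suc n + (\<Sum>m\<le>n. A n $ Suc m * t ^ (n - m))) - x n * (\<Sum>m\<le>n. A n $ m * t ^ (n - m))"
    by (simp only: cS left_diff_distrib sum_subtractf sum_distrib_left mult.assoc add_diff_eq)
  also have "A n $ 0 * t ^ Suc n + (\<Sum>m\<le>n. A n $ Suc m * t ^ (n - m)) = (\<Sum>m\<le>Suc n. A n $ m * t ^ (Suc n - m))"
    by (subst sum.atMost_Suc_shift) simp
  also have "\<dots> = (\<Sum>m\<le>n. A n $ m * t ^ (Suc n - m))" using Suc by simp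
  also have "\<dots> = t * (\<Sum>m\<le>n. A n $ m * t ^ (n - m))"
    unfolding sum_distrib_left by (intro sum.cong refl) (simp add: Suc_diff_le mult_ac)
  also have "\<dots> - x n * (\<Sum>m\<le>n. A n $ m * t ^ (n - m)) = (\<Prod>i<Suc n. t - x i)"
    using Suc by (simp add: algebra_simps)
  finally have "(\<Prod>i<Suc n. t - x i) = (\<Sum>m\<le>Suc n. A (Suc n) $ m * t ^ (Suc n - m))" ..
  moreover have "A (Suc n) $ m = 0" if "m > Suc n" for m
    using that Suc by (cases m) (auto simp: cS)
  ultimately show ?case by blast
qed

text \<open>Newton's identities, read off from the logarithmic derivative of \<open>\<Prod> (1 - x i X)\<close>.\<close>

lemma newton_cong:
  fixes x y :: "nat \<Rightarrow> int" and p :: int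
  assumes p: "prime p" "int n < p"
    and eq: "\<And>j. 1 \<le> j \<Longrightarrow> j \<le> n \<Longrightarrow> [(\<Sum>i<n. x i ^ j) = (\<Sum>i<n. y i ^ j)] (mod p)"
    and i: "i < n"
  shows "\<exists>l<n. [x i = y l] (mod p)"
proof -
  define A where "A = (\<lambda>x :: nat \<Rightarrow> int. \<Prod>i<n. 1 - fps_const (x i) * fps_X)"
  define P where "P = (\<lambda>x :: nat \<Rightarrow> int. \<Sum>i<n. Abs_fps (\<lambda>j. x i ^ Suc j))"
  have P: "P x $ j = (\<Sum>i<n. x i ^ Suc j)" for x j by (simp add: P_def fps_sum_nth)
  have rec: "int (Suc m) * A x $ Suc m = - (\<Sum>i\<le>m. A x $ i * P x $ (m - i))" for x m
  proof -
    have "fps_deriv (A x) $ m = (- A x * P x) $ m" unfolding A_def P_def newton_fps ..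
    then show ?thesis by (simp add: fps_mult_nth sum_negf atLeast0AtMost)
  qed
  have A: "m \<le> n \<Longrightarrow> [A x $ m = A y $ m] (mod p)" for m
  proof (induction m rule: less_induct)
    case (less m)
    show ?case
    proof (cases m)
      case 0
      have "(\<Prod>i<N. 1 - fps_const (x i) * fps_X) $ 0 = 1" for x :: "nat \<Rightarrow> int" and N :: nat
        by (induction N) (auto simp: fps_mult_nth_0)
      then show ?thesis using 0 by (simp add: A_def)
    next
      case (Suc l)
      have "[int (Suc l) * A x $ Suc l = int (Suc l) * A y $ Suc l] (mod p)"
        unfolding rec P cong_minus_minus_iff
        by (rule cong_sum, rule cong_mult) (use less Suc in \<open>auto intro!: eq simp del: power_Suc\<close>)
      \<comment> \<open>The recursion yields only \<open>Suc l\<close> times the coefficient;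
        \<open>Suc l \<le> n < p\<close> allows cancelling it.\<close>
      moreover have "coprime (int (Suc l)) p"
      proof -
        have "\<not> p dvd int (Suc l)" using p(2) less.prems Suc by (intro zdvd_not_zless) auto
        then show ?thesis using p(1) by (simp add: prime_imp_coprime coprime_commute)
      qed
      ultimately show ?thesis using Suc by (simp add: cong_mult_lcancel)
    qed
  qed
  \<comment> \<open>Equal coefficients give equal polynomials mod \<open>p\<close>, and the one with
    roots \<open>x l\<close> vanishes at \<open>x i\<close>; so \<open>p\<close> divides some factor
    \<open>x i - y l\<close>.\<close>
  have "[(\<Prod>l<n. x i - x l) = (\<Prod>l<n. x i - y l)] (mod p)"
  proof -
    have e: "(\<Prod>l<n. x i - z l) = (\<Sum>m\<le>n. A z $ m * x i ^ (n - m))" for z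
      using prod_roots_expand[where t = "x i" and x = z] unfolding A_def by blast
    show ?thesis unfolding e by (rule cong_sum, rule cong_mult) (use A in auto)
  qed
  moreover have "(\<Prod>l<n. x i - x l) = 0" using i by (auto intro!: prod_zero)
  ultimately have "p dvd (\<Prod>l<n. x i - y l)" by (simp add: cong_0_iff cong_sym_eq[of 0])
  then obtain l where "l < n" "p dvd x i - y l"
    using p(1) by (auto simp: prime_dvd_prod_iff)
  then show ?thesis by (auto simp: cong_iff_dvd_diff)
qed

section \<open>Power sum systems and Mordell's moment method\<close>

text \<open>Lagrange's bound by synthetic division over the integers. The hypothesis is that
  \<open>P\<close> does not vanish mod \<open>p\<close> as a polynomial; its leading coefficient may
  be divisible by \<open>p\<close>.\<close>

lemma card_roots_mod_prime:
  fixes P :: "int poly" and p :: int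
  assumes p: "prime p" and "\<not> [:p:] dvd P"
  shows "card {x \<in> {0..<p}. p dvd poly P x} \<le> degree P"
  using assms(2)
proof (induction "degree P" arbitrary: P)
  case 0
  then obtain a where a: "P = [:a:]" by (auto elim!: degree_eq_zeroE)
  then have "\<not> p dvd a" using 0 by (simp add: const_poly_dvd_const_poly_iff)
  then have "{x \<in> {0..<p}. p dvd poly P x} = {}" using a by auto
  then show ?case by (simp only: card.empty)
next
  case (Suc n)
  show ?case
  proof (cases "\<exists>x0\<in>{0..<p}. p dvd poly P x0")
    case False
    then have "{x \<in> {0..<p}. p dvd poly P x} = {}" by auto
    then show ?thesis by (simp only: card.empty)
  next
    case True
    then obtain x0 where x0: "x0 \<in> {0..<p}" "p dvd poly P x0" by blast
    define S where "S = synthetic_div P x0"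
    define c where "c = poly P x0"
    have P: "P = [:- x0, 1:] * S + [:c:]"
      unfolding S_def c_def by (simp only: synthetic_div_correct')
    have "[:p:] dvd [:c:]" unfolding c_def using x0 by (simp add: const_poly_dvd_const_poly_iff)
    then have "\<not> [:p:] dvd S" using Suc.prems P dvd_add[OF dvd_mult, of "[:p:]" S "[:c:]" "[:- x0, 1:]"] by auto
    moreover have dS: "n = degree S" using Suc.hyps(2) by (simp add: S_def degree_synthetic_div)
    ultimately have IH: "card {x \<in> {0..<p}. p dvd poly S x} \<le> n" using Suc.hyps(1) by blast
    have "{x \<in> {0..<p}. p dvd poly P x} \<subseteq> insert x0 {x \<in> {0..<p}. p dvd poly S x}"
    proof
      fix x assume x: "x \<in> {x \<in> {0..<p}. p dvd poly P x}"
      have "poly P x = (x - x0) * poly S x + c" unfolding P by (simp add: algebra_simps)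
      then have "p dvd (x - x0) * poly S x" using x x0(2) dvd_add_left_iff[of p c "(x - x0) * poly S x"] by (simp add: c_def)
      then have "p dvd x - x0 \<or> p dvd poly S x" using p by (simp add: prime_dvd_mult_iff)
      moreover have "x = x0" if "p dvd x - x0"
      proof -
        have "[x = x0] (mod p)" using that by (simp add: cong_iff_dvd_diff)
        then show ?thesis using x x0(1) by (simp add: cong_def)
      qed
      ultimately show "x \<in> insert x0 {x \<in> {0..<p}. p dvd poly S x}" using x by auto
    qed
    moreover have fin: "finite {x \<in> {0..<p}. p dvd poly S x}"
      by (rule finite_subset[of _ "{0..<p}"]) auto
    ultimately have "card {x \<in> {0..<p}. p dvd poly P x} \<le> card (insert x0 {x \<in> {0..<p}. p dvd poly S x})"
      by (intro card_mono finite.insertI)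
    also have "\<dots> \<le> Suc (card {x \<in> {0..<p}. p dvd poly S x})" by (rule card_insert_le_m1) auto
    finally show ?thesis using IH Suc.hyps(2) by simp
  qed
qed

definition csum :: "(int \<Rightarrow> int) \<Rightarrow> int \<Rightarrow> complex" where
  "csum h q = (\<Sum>x\<in>{0..<q}. ee (of_int (h x) / of_int q))"

text \<open>By Newton's identities each \<open>x i\<close> is one of the \<open>y l\<close>, so a
  given \<open>y\<close> leaves at most \<open>n ^ n\<close> vectors \<open>x\<close>.\<close>

lemma card_power_sum_solutions:
  fixes p :: int
  assumes p: "prime p" "int n < p"
  defines "V \<equiv> PiE {..<n} (\<lambda>_. {0..<p})"
  shows "card {(x, y) \<in> V \<times> V. \<forall>j\<in>{1..n}. p dvd (\<Sum>i<n. x i ^ j) - (\<Sum>i<n. y i ^ j)} \<le> nat p ^ n * n ^ n"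
proof -
  let ?S = "{(x, y) \<in> V \<times> V. \<forall>j\<in>{1..n}. p dvd (\<Sum>i<n. x i ^ j) - (\<Sum>i<n. y i ^ j)}"
  let ?T = "SIGMA y:V. PiE {..<n} (\<lambda>_. y ` {..<n})"
  have finV: "finite V" by (auto simp: V_def intro!: finite_PiE)
  have "(\<lambda>(x, y). (y, x)) ` ?S \<subseteq> ?T"
  proof
    fix w assume "w \<in> (\<lambda>(x, y). (y, x)) ` ?S"
    then obtain x y where w: "w = (y, x)" and xy: "x \<in> V" "y \<in> V" and d: "\<forall>j\<in>{1..n}. p dvd (\<Sum>i<n. x i ^ j) - (\<Sum>i<n. y i ^ j)"
      by auto
    have "x i \<in> y ` {..<n}" if "i < n" for i
    proof -
      have "\<exists>l<n. [x i = y l] (mod p)"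
        by (rule newton_cong[OF p _ that]) (use d in \<open>auto simp: cong_iff_dvd_diff\<close>)
      then obtain l where l: "l < n" "[x i = y l] (mod p)" by blast
      have "x i \<in> {0..<p}" "y l \<in> {0..<p}" using xy that l by (auto simp: V_def PiE_iff)
      then have "x i = y l" using l by (simp add: cong_def)
      then show ?thesis using l by auto
    qed
    then show "w \<in> ?T" using xy w by (auto simp: V_def PiE_iff)
  qed
  then have "card ((\<lambda>(x, y). (y, x)) ` ?S) \<le> card ?T"
    using finV by (intro card_mono) (auto intro!: finite_PiE)
  also have "card ((\<lambda>(x, y). (y, x)) ` ?S) = card ?S" by (rule card_image) (auto simp: inj_on_def)
  also have "card ?T = (\<Sum>y\<in>V. card (PiE {..<n} (\<lambda>_. y ` {..<n})))"
    using finV by (intro card_SigmaI) (auto intro!: finite_PiE)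
  also have "\<dots> \<le> (\<Sum>y\<in>V. n ^ n)"
  proof (rule sum_mono)
    fix y assume "y \<in> V"
    have "card (y ` {..<n}) \<le> n" using card_image_le[of "{..<n}" y] by simp
    then show "card (PiE {..<n} (\<lambda>_. y ` {..<n})) \<le> n ^ n" by (simp add: card_PiE power_mono)
  qed
  also have "\<dots> = nat p ^ n * n ^ n" by (simp add: V_def card_PiE)
  finally show ?thesis .
qed

text \<open>The power \<open>2 * n\<close> expands into \<open>n\<close> variables \<open>x\<close>
  against \<open>n\<close> conjugated variables \<open>y\<close>; orthogonality in each
  \<open>a j\<close> then leaves the power sum system. There are as many variables as exponents, the
  case that Newton's identities resolve.\<close>

lemma moment_identity:
  fixes p :: int and n :: nat
  assumes p: "p > 0"
  defines "V \<equiv> PiE {..<n} (\<lambda>_. {0..<p})"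
  shows "(\<Sum>a\<in>PiE {1..n} (\<lambda>_. {0..<p}). norm (csum (\<lambda>t. \<Sum>i\<in>{1..n}. a i * t ^ i) p) ^ (2 * n)) =
    real_of_int p ^ n * real (card {(x, y) \<in> V \<times> V. \<forall>j\<in>{1..n}. p dvd (\<Sum>i<n. x i ^ j) - (\<Sum>i<n. y i ^ j)})"
proof -
  have finV: "finite V" by (auto simp: V_def intro!: finite_PiE)
  define d where "d = (\<lambda>(x :: nat \<Rightarrow> int, y :: nat \<Rightarrow> int) j. (\<Sum>i<n. x i ^ j) - (\<Sum>i<n. y i ^ j))"
  have expand: "complex_of_real (norm (csum (\<lambda>t. \<Sum>i\<in>{1..n}. a i * t ^ i) p) ^ (2 * n)) =
      (\<Sum>z\<in>V \<times> V. \<Prod>j\<in>{1..n}. ee (of_int (a j * d z j) / of_int p))" for a :: "nat \<Rightarrow> int"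
  proof -
    let ?h = "\<lambda>t. \<Sum>i\<in>{1..n}. a i * t ^ i"
    have pw: "csum ?h p ^ n = (\<Sum>x\<in>V. ee (of_int (\<Sum>l<n. ?h (x l)) / of_int p))"
    proof -
      have "csum ?h p ^ n = (\<Prod>l<n. \<Sum>t\<in>{0..<p}. ee (of_int (?h t) / of_int p))" by (simp add: csum_def)
      also have "\<dots> = (\<Sum>x\<in>V. \<Prod>l<n. ee (of_int (?h (x l)) / of_int p))"
        unfolding V_def by (rule prod_sum_PiE) auto
      also have "\<dots> = (\<Sum>x\<in>V. ee (of_int (\<Sum>l<n. ?h (x l)) / of_int p))"
      proof (rule sum.cong[OF refl])
        have "(\<Prod>l\<in>L. ee (f l)) = ee (\<Sum>l\<in>L. f l)" if "finite L" for f and L :: "nat set"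
          using that by (induction L rule: finite_induct) (auto simp: ee_add)
        then show "(\<Prod>l<n. ee (of_int (?h (x l)) / of_int p)) = ee (of_int (\<Sum>l<n. ?h (x l)) / of_int p)" for x
          by (simp only: of_int_sum sum_divide_distrib finite_lessThan)
      qed
      finally show ?thesis .
    qed
    have "complex_of_real (norm (csum ?h p) ^ (2 * n)) = complex_of_real ((norm (csum ?h p))\<^sup>2) ^ n"
      by (simp add: power_mult)
    also have "\<dots> = csum ?h p ^ n * cnj (csum ?h p ^ n)"
      by (simp only: complex_norm_square power_mult_distrib complex_cnj_power)
    also have "\<dots> = (\<Sum>z\<in>V \<times> V. ee (of_int (\<Sum>l<n. ?h (fst z l)) / of_int p) * cnj (ee (of_int (\<Sum>l<n. ?h (snd z l)) / of_int p)))"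
      unfolding pw cnj_sum sum_product sum.cartesian_product by (simp add: case_prod_beta)
    also have "\<dots> = (\<Sum>z\<in>V \<times> V. \<Prod>j\<in>{1..n}. ee (of_int (a j * d z j) / of_int p))"
    proof (rule sum.cong[OF refl])
      fix z :: "(nat \<Rightarrow> int) \<times> (nat \<Rightarrow> int)"
      have pr: "(\<Prod>l\<in>L. ee (f l)) = ee (\<Sum>l\<in>L. f l)" if "finite L" for f and L :: "nat set"
        using that by (induction L rule: finite_induct) (auto simp: ee_add)
      have sw: "(\<Sum>l<n. ?h (x l)) = (\<Sum>j\<in>{1..n}. a j * (\<Sum>l<n. x l ^ j))" for x
        by (subst sum.swap) (simp add: sum_distrib_left)
      have "(\<Sum>l<n. ?h (fst z l)) - (\<Sum>l<n. ?h (snd z l)) = (\<Sum>j\<in>{1..n}. a j * d z j)"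
        unfolding sw by (simp add: d_def case_prod_beta sum_subtractf right_diff_distrib)
      then have "(\<Prod>j\<in>{1..n}. ee (of_int (a j * d z j) / of_int p)) =
          ee (of_int ((\<Sum>l<n. ?h (fst z l)) - (\<Sum>l<n. ?h (snd z l))) / of_int p)"
        by (subst pr) (simp_all add: sum_divide_distrib)
      then show "ee (of_int (\<Sum>l<n. ?h (fst z l)) / of_int p) * cnj (ee (of_int (\<Sum>l<n. ?h (snd z l)) / of_int p)) =
          (\<Prod>j\<in>{1..n}. ee (of_int (a j * d z j) / of_int p))"
        by (simp only: of_int_diff diff_divide_distrib ee_diff)
    qed
    finally show ?thesis .
  qed
  have "complex_of_real (\<Sum>a\<in>PiE {1..n} (\<lambda>_. {0..<p}). norm (csum (\<lambda>t. \<Sum>i\<in>{1..n}. a i * t ^ i) p) ^ (2 * n)) =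
      (\<Sum>z\<in>V \<times> V. \<Sum>a\<in>PiE {1..n} (\<lambda>_. {0..<p}). \<Prod>j\<in>{1..n}. ee (of_int (a j * d z j) / of_int p))"
    unfolding of_real_sum expand by (rule sum.swap)
  also have "\<dots> = (\<Sum>z\<in>V \<times> V. \<Prod>j\<in>{1..n}. \<Sum>b\<in>{0..<p}. ee (of_int (b * d z j) / of_int p))"
    by (intro sum.cong refl prod_sum_PiE[symmetric]) auto
  also have "\<dots> = (\<Sum>z\<in>V \<times> V. if \<forall>j\<in>{1..n}. p dvd d z j then of_int p ^ n else 0)"
  proof (intro sum.cong refl)
    fix z
    show "(\<Prod>j\<in>{1..n}. \<Sum>b\<in>{0..<p}. ee (of_int (b * d z j) / of_int p)) = (if \<forall>j\<in>{1..n}. p dvd d z j then of_int p ^ n else 0)"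
      unfolding ee_orthogonality[OF p] by (auto intro!: prod_zero)
  qed
  also have "\<dots> = of_int p ^ n * of_nat (card {z \<in> V \<times> V. \<forall>j\<in>{1..n}. p dvd d z j})"
    using finV by (simp add: sum.If_cases Int_def mult.commute)
  also have "{z \<in> V \<times> V. \<forall>j\<in>{1..n}. p dvd d z j} = {(x, y) \<in> V \<times> V. \<forall>j\<in>{1..n}. p dvd (\<Sum>i<n. x i ^ j) - (\<Sum>i<n. y i ^ j)}"
    by (auto simp: d_def)
  finally have "complex_of_real (\<Sum>a\<in>PiE {1..n} (\<lambda>_. {0..<p}). norm (csum (\<lambda>t. \<Sum>i\<in>{1..n}. a i * t ^ i) p) ^ (2 * n)) =
     complex_of_real (real_of_int p ^ n * real (card {(x, y) \<in> V \<times> V. \<forall>j\<in>{1..n}. p dvd (\<Sum>i<n. x i ^ j) - (\<Sum>i<n. y i ^ j)}))"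
    by simp
  then show ?thesis by (simp only: of_real_eq_iff)
qed

lemma csum_cong:
  assumes "\<And>t. [h t = h' t] (mod q)"
  shows "csum h q = csum h' q"
  unfolding csum_def by (intro sum.cong refl ee_cong_mod assms)

lemma csum_affine:
  fixes h :: "int poly"
  assumes "q > 0" "coprime u q"
  shows "csum (\<lambda>t. poly h (u * t + c)) q = csum (poly h) q"
  unfolding csum_def
  by (rule sum_mod_reindex[OF assms, of "\<lambda>t. ee (of_int (poly h t) / of_int q)"]) (intro ee_cong_mod poly_cong_int)

lemma csum_add_const: "csum (\<lambda>t. c + h t) q = ee (of_int c / of_int q) * csum h q"
  by (simp add: csum_def sum_distrib_left add_divide_distrib ee_add)

lemma poly_eq_sum_coeffs:
  fixes P :: "'a::comm_ring_1 poly"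
  assumes "degree P \<le> n"
  shows "poly P t = coeff P 0 + (\<Sum>i\<in>{1..n}. coeff P i * t ^ i)"
proof -
  have "poly P t = (\<Sum>i\<le>n. coeff P i * t ^ i)"
    unfolding poly_altdef using assms by (intro sum.mono_neutral_left) (auto simp: coeff_eq_0)
  also have "{..n} = insert 0 {1..n}" by auto
  finally show ?thesis by simp
qed

text \<open>Modulo a prime the two top coefficients identify the substitution: the first fixes
  \<open>l ^ n\<close>, and for given \<open>l\<close> the second fixes \<open>m\<close>, provided
  \<open>n\<close>, \<open>l\<close> and the leading coefficient are units.\<close>

lemma coeff_pcompose_affine:
  fixes h :: "int poly"
  assumes "degree h \<le> n" "n \<ge> 1"
  shows "degree (pcompose h [:m, l:]) \<le> n"
    and "coeff (pcompose h [:m, l:]) n = l ^ n * coeff h n"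
    and "coeff (pcompose h [:m, l:]) (n - 1) = l ^ (n - 1) * (int n * m * coeff h n + coeff h (n - 1))"
proof -
  obtain r where r: "degree r \<le> n - 1" "coeff r (n - 1) = int n * m * coeff h n"
    "\<And>x. poly r x = poly h (x + m) - poly h x"
    using poly_difference[OF assms(1), of m] assms(2) by auto
  have "pcompose h [:m, 1:] = h + r"
    by (rule poly_ext) (simp add: r(3) poly_pcompose add.commute)
  moreover have "pcompose h [:m, l:] = pcompose (pcompose h [:m, 1:]) [:0, l:]"
    unfolding pcompose_assoc[symmetric] by (simp add: pcompose_pCons)
  ultimately have eq: "pcompose h [:m, l:] = pcompose (h + r) [:0, l:]" by simp
  have "coeff r n = 0" using r(1) assms(2) by (intro coeff_eq_0) auto
  then show "coeff (pcompose h [:m, l:]) n = l ^ n * coeff h n" unfolding eq by (simp add: coeff_pcompose_linear)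
  show "coeff (pcompose h [:m, l:]) (n - 1) = l ^ (n - 1) * (int n * m * coeff h n + coeff h (n - 1))"
    unfolding eq by (simp add: coeff_pcompose_linear r(2) del: One_nat_def)
  show "degree (pcompose h [:m, l:]) \<le> n"
    using assms(1) by (intro order_trans[OF degree_pcompose_le]) (auto split: if_splits)
qed

text \<open>All substitutions \<open>t \<mapsto> l t + m\<close> leave the modulus of the sum unchanged, and at most \<open>n\<close> of them lead to
  the same polynomial modulo \<open>p\<close>, so the sum occurs about \<open>p^2 / n\<close> times in the moment of order \<open>2 n\<close>.\<close>

lemma mordell_moment:
  fixes h :: "int poly" and p :: int
  assumes p: "prime p" "int n < p" and n: "n \<ge> 2" and deg: "degree h \<le> n" and lead: "\<not> p dvd coeff h n"
  shows "norm (csum (poly h) p) ^ (2 * n) * real_of_int (p * (p - 1)) \<le>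
           real n * (real_of_int p ^ n * (real_of_int p ^ n * real n ^ n))"
proof -
  have p0: "p > 0" using p(1) by (simp add: prime_gt_0_int)
  define B where "B = norm (csum (poly h) p) ^ (2 * n)"
  define I where "I = {1..<p} \<times> {0..<p}"
  define T where "T = (\<lambda>(l, m). restrict (\<lambda>i. coeff (pcompose h [:m, l:]) i mod p) {1..n})"
  define N where "N = (\<lambda>a. norm (csum (\<lambda>t. \<Sum>i\<in>{1..n}. a i * t ^ i) p) ^ (2 * n))"
  let ?U = "PiE {1..n} (\<lambda>_. {0..<p})"
  have cop: "coprime l p" if "l \<in> {1..<p}" for l
  proof -
    have "\<not> p dvd l" using that by (intro zdvd_not_zless) auto
    then show ?thesis using prime_imp_coprime[of p l] p(1) by (simp add: coprime_commute)
  qed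
  have copn: "coprime (int n) p" using cop[of "int n"] p n by auto
  have copl: "coprime (coeff h n) p" using prime_imp_coprime[of p "coeff h n"] p(1) lead by (simp add: coprime_commute)
  have NB: "N (T z) = B" if z: "z \<in> I" for z
  proof -
    obtain l m where lm: "z = (l, m)" "l \<in> {1..<p}" using z by (auto simp: I_def)
    let ?H = "pcompose h [:m, l:]"
    have "csum (poly h) p = csum (\<lambda>t. poly h (l * t + m)) p"
      by (rule csum_affine[symmetric]) (use p0 cop lm in auto)
    also have "\<dots> = csum (\<lambda>t. coeff ?H 0 + (\<Sum>i\<in>{1..n}. coeff ?H i * t ^ i)) p"
    proof (rule csum_cong)
      fix t
      have "poly h (l * t + m) = poly ?H t" by (simp add: poly_pcompose algebra_simps)
      also have "\<dots> = coeff ?H 0 + (\<Sum>i\<in>{1..n}. coeff ?H i * t ^ i)"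
        by (rule poly_eq_sum_coeffs) (rule coeff_pcompose_affine(1)[OF deg], use n in simp)
      finally show "[poly h (l * t + m) = coeff ?H 0 + (\<Sum>i\<in>{1..n}. coeff ?H i * t ^ i)] (mod p)" by simp
    qed
    also have "norm \<dots> = norm (csum (\<lambda>t. \<Sum>i\<in>{1..n}. coeff ?H i * t ^ i) p)"
      by (simp only: csum_add_const norm_mult norm_ee mult_1)
    also have "csum (\<lambda>t. \<Sum>i\<in>{1..n}. coeff ?H i * t ^ i) p = csum (\<lambda>t. \<Sum>i\<in>{1..n}. T z i * t ^ i) p"
      by (intro csum_cong cong_sum cong_mult cong_refl) (simp add: T_def lm cong_def)
    finally show ?thesis by (simp add: N_def B_def)
  qed
  have TU: "T ` I \<subseteq> ?U" using p0 by (auto simp: T_def I_def)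
  have finI: "finite I" by (simp add: I_def)
  have fib: "card {z \<in> I. T z = T z0} \<le> n" if z0: "z0 \<in> I" for z0
  proof -
    let ?Z = "{z \<in> I. T z = T z0}"
    obtain l0 m0 where z0': "z0 = (l0, m0)" by (cases z0)
    have Teq: "[coeff (pcompose h [:m, l:]) i = coeff (pcompose h [:m', l':]) i] (mod p)"
      if "T (l, m) = T (l', m')" "i \<in> {1..n}" for l m l' m' i
      using fun_cong[OF that(1), of i] that(2) by (simp add: T_def cong_def)
    have "inj_on fst ?Z"
    proof (rule inj_onI)
      fix z z' assume zz: "z \<in> ?Z" "z' \<in> ?Z" "fst z = fst z'"
      obtain l m m' where z: "z = (l, m)" "z' = (l, m')" using zz(3) by (cases z; cases z') auto
      have lI: "l \<in> {1..<p}" "m \<in> {0..<p}" "m' \<in> {0..<p}" using zz z by (auto simp: I_def)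
      have "T (l, m) = T (l, m')" using zz z by auto
      note Tz = this
      \<comment> \<open>\<open>T\<close> forgets the constant coefficient; \<open>n \<ge> 2\<close>
        ensures that the coefficient of index \<open>n - 1\<close> is still seen.\<close>
      have n1: "n - 1 \<in> {1..n}" "1 \<le> n" using n by auto
      have "[coeff (pcompose h [:m, l:]) (n - 1) = coeff (pcompose h [:m', l:]) (n - 1)] (mod p)"
        by (rule Teq[OF Tz n1(1)])
      then have "[l ^ (n - 1) * (int n * m * coeff h n + coeff h (n - 1)) = l ^ (n - 1) * (int n * m' * coeff h n + coeff h (n - 1))] (mod p)"
        unfolding coeff_pcompose_affine(3)[OF deg n1(2)] .
      then have "[int n * m * coeff h n + coeff h (n - 1) = int n * m' * coeff h n + coeff h (n - 1)] (mod p)"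
        using cop[OF lI(1)] by (simp add: cong_mult_lcancel)
      then have "[int n * m * coeff h n = int n * m' * coeff h n] (mod p)" by (simp add: cong_add_rcancel)
      then have "[int n * m = int n * m'] (mod p)" using copl by (simp add: cong_mult_rcancel)
      then have "[m = m'] (mod p)" using copn by (simp add: cong_mult_lcancel)
      then show "z = z'" using lI z by (simp add: cong_def)
    qed
    moreover have "fst ` ?Z \<subseteq> {x \<in> {0..<p}. p dvd poly (monom (coeff h n) n - [:l0 ^ n * coeff h n:]) x}"
    proof
      fix x assume "x \<in> fst ` ?Z"
      then obtain m where m: "(x, m) \<in> I" "T (x, m) = T (l0, m0)" by (auto simp: z0')
      from Teq[OF m(2), of n] n deg have "[x ^ n * coeff h n = l0 ^ n * coeff h n] (mod p)"
        by (simp add: coeff_pcompose_affine(2))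
      then show "x \<in> {x \<in> {0..<p}. p dvd poly (monom (coeff h n) n - [:l0 ^ n * coeff h n:]) x}"
        using m(1) by (auto simp: I_def cong_iff_dvd_diff poly_monom mult.commute)
    qed
    moreover have "finite {x \<in> {0..<p}. p dvd poly (monom (coeff h n) n - [:l0 ^ n * coeff h n:]) x}"
      by (rule finite_subset[of _ "{0..<p}"]) auto
    ultimately have "card ?Z \<le> card {x \<in> {0..<p}. p dvd poly (monom (coeff h n) n - [:l0 ^ n * coeff h n:]) x}"
      by (rule card_inj_on_le)
    also have "\<dots> \<le> degree (monom (coeff h n) n - [:l0 ^ n * coeff h n:])"
    proof (rule card_roots_mod_prime[OF p(1)])
      have "coeff (monom (coeff h n) n - [:l0 ^ n * coeff h n:]) n = coeff h n"
        using n by (simp add: coeff_pCons split: nat.splits)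
      then show "\<not> [:p:] dvd monom (coeff h n) n - [:l0 ^ n * coeff h n:]"
        using lead unfolding const_poly_dvd_iff by metis
    qed
    also have "\<dots> \<le> n"
      by (intro degree_diff_le) (auto simp: degree_monom_le)
    finally show ?thesis .
  qed
  have "real (card I) * B = (\<Sum>z\<in>I. N (T z))" by (simp add: NB)
  also have "\<dots> = (\<Sum>a\<in>T ` I. \<Sum>z\<in>{z \<in> I. T z = a}. N (T z))" by (rule sum.image_gen[OF finI])
  also have "\<dots> = (\<Sum>a\<in>T ` I. real (card {z \<in> I. T z = a}) * N a)" by simp
  also have "\<dots> \<le> (\<Sum>a\<in>T ` I. real n * N a)"
    using fib by (intro sum_mono mult_right_mono) (auto simp: N_def)
  also have "\<dots> \<le> (\<Sum>a\<in>?U. real n * N a)"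
    by (intro sum_mono2 TU finite_PiE) (auto simp: N_def)
  also have "\<dots> = real n * (\<Sum>a\<in>?U. N a)" by (simp add: sum_distrib_left)
  also have "(\<Sum>a\<in>?U. N a) = real_of_int p ^ n * real (card {(x, y) \<in> PiE {..<n} (\<lambda>_. {0..<p}) \<times> PiE {..<n} (\<lambda>_. {0..<p}).
      \<forall>j\<in>{1..n}. p dvd (\<Sum>i<n. x i ^ j) - (\<Sum>i<n. y i ^ j)})"
    unfolding N_def by (rule moment_identity[OF p0])
  also have "real n * \<dots> \<le> real n * (real_of_int p ^ n * real (nat p ^ n * n ^ n))"
    using p0 by (intro mult_left_mono of_nat_mono card_power_sum_solutions[OF p]) auto
  also have "real (nat p ^ n * n ^ n) = real_of_int p ^ n * real n ^ n" using p0 by simp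
  also have "real (card I) = real_of_int (p * (p - 1))"
    using p0 by (simp add: I_def card_cartesian_product mult.commute)
  finally show ?thesis by (simp add: B_def mult.commute)
qed

section \<open>Bounds modulo primes and prime powers\<close>

text \<open>Dropping the top coefficients divisible by \<open>p\<close> leaves degree
  \<open>n \<le> k\<close> with a unit leading coefficient, and
  \<open>p^(-1/n) \<le> p^(-1/k)\<close>. Degree 1 lies outside the moment argument; there the sum
  vanishes.\<close>

lemma csum_bound_prime:
  fixes h :: "int poly" and p :: int
  assumes p: "prime p" "int k < p" and deg: "degree h \<le> k" and nz: "\<exists>i\<in>{1..k}. \<not> p dvd coeff h i"
  shows "norm (csum (poly h) p) / p \<le> 2 * real k ^ Suc k * real_of_int p powr (- (1 / real k))"
proof -
  define n where "n = Max {i \<in> {1..k}. \<not> p dvd coeff h i}"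
  have "n \<in> {i \<in> {1..k}. \<not> p dvd coeff h i}" unfolding n_def using nz by (intro Max_in) auto
  then have n: "1 \<le> n" "n \<le> k" "\<not> p dvd coeff h n" by auto
  have nmax: "p dvd coeff h i" if "i > n" for i
  proof (cases "i \<le> k")
    case True
    then show ?thesis using that n Max_ge[of "{i \<in> {1..k}. \<not> p dvd coeff h i}" i] unfolding n_def by fastforce
  next
    case False
    then show ?thesis using deg by (simp add: coeff_eq_0)
  qed
  define g where "g = poly_cutoff (Suc n) h"
  have gc: "coeff g i = (if i \<le> n then coeff h i else 0)" for i by (simp add: g_def coeff_poly_cutoff less_Suc_eq_le)
  have gdeg: "degree g \<le> n" by (rule degree_le) (simp add: gc)
  have "[:p:] dvd h - g" using nmax by (auto simp: const_poly_dvd_iff gc)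
  then obtain r where r: "h - g = [:p:] * r" by (auto elim: dvdE)
  have hg: "csum (poly h) p = csum (poly g) p"
  proof (rule csum_cong)
    fix t
    have "poly h t - poly g t = p * poly r t" using arg_cong[OF r, of "\<lambda>q. poly q t"] by simp
    then show "[poly h t = poly g t] (mod p)" by (simp add: cong_iff_dvd_diff)
  qed
  have p0: "p > 0" "p \<ge> 2" using p(1) by (auto simp: prime_gt_0_int prime_ge_2_int)
  have pr: "real_of_int p \<ge> 2" using p0 by simp
  show ?thesis
  proof (cases "n = 1")
    case True
    then have g1: "poly g t = coeff g 0 + t * coeff g 1" for t
      using poly_eq_sum_coeffs[of g 1 t] gdeg by (simp add: mult.commute)
    have "csum (poly g) p = csum (\<lambda>t. coeff g 0 + t * coeff g 1) p"
      by (rule csum_cong) (simp only: g1 cong_refl)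
    also have "\<dots> = 0"
      unfolding csum_add_const using ee_orthogonality[OF p0(1), of "coeff g 1"] n True
      by (simp add: csum_def gc)
    finally show ?thesis using hg by simp
  next
    case False
    then have n2: "n \<ge> 2" using n by simp
    let ?P = "real_of_int p"
    define B where "B = norm (csum (poly g) p) ^ (2 * n)"
    have "B * real_of_int (p * (p - 1)) \<le> real n * (?P ^ n * (?P ^ n * real n ^ n))"
      unfolding B_def using p n by (intro mordell_moment n2 gdeg) (auto simp: gc)
    moreover have "B * (?P * ?P) \<le> B * (2 * real_of_int (p * (p - 1)))"
      using pr by (intro mult_left_mono) (auto simp: B_def algebra_simps)
    ultimately have "B * (?P * ?P) \<le> 2 * (real n * (?P ^ n * (?P ^ n * real n ^ n)))" by simp
    also have "\<dots> = 2 * real n ^ Suc n * ?P ^ (2 * n)"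
    proof -
      have "?P ^ (2 * n) = ?P ^ n * ?P ^ n" by (simp only: mult_2 power_add)
      then show ?thesis by (simp only: power_Suc mult_ac)
    qed
    also have "\<dots> = 2 * real n ^ Suc n * ?P ^ (2 * n - 2) * (?P * ?P)"
    proof -
      have "2 * n = (2 * n - 2) + 2" using n2 by simp
      then have "?P ^ (2 * n) = ?P ^ (2 * n - 2) * ?P ^ 2" by (metis power_add)
      then show ?thesis by (simp add: power2_eq_square)
    qed
    finally have B: "B \<le> 2 * real n ^ Suc n * ?P ^ (2 * n - 2)" using pr by simp
    \<comment> \<open>The bound reads \<open>B \<le> K * p^(2*n-2)\<close>. In taking the root of
      order \<open>2 * n\<close> the constant is kept as \<open>K\<close> itself, which is allowed
      as \<open>K \<le> K^(2*n)\<close>.\<close>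
    define K where "K = 2 * real n ^ Suc n"
    have K1: "K \<ge> 1" using n one_le_power[of "real n" "Suc n"] unfolding K_def by linarith
    define y where "y = K * ?P powr (1 - 1 / real n)"
    have "y ^ (2 * n) = K ^ (2 * n) * ?P ^ (2 * n - 2)"
    proof -
      have "(?P powr (1 - 1 / real n)) ^ (2 * n) = ?P powr (real (2 * n) * (1 - 1 / real n))"
        using pr by (subst powr_realpow[symmetric]) (auto simp: powr_powr mult.commute)
      also have "real (2 * n) * (1 - 1 / real n) = real (2 * n - 2)" using n2 by (simp add: field_simps of_nat_diff)
      also have "?P powr real (2 * n - 2) = ?P ^ (2 * n - 2)" using pr by (intro powr_realpow) auto
      finally show ?thesis by (simp add: y_def power_mult_distrib)
    qed
    moreover have "K * ?P ^ (2 * n - 2) \<le> K ^ (2 * n) * ?P ^ (2 * n - 2)"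
      using K1 n pr self_le_power[of K "2 * n"] by (intro mult_right_mono) auto
    ultimately have "norm (csum (poly g) p) ^ (2 * n) \<le> y ^ (2 * n)" using B by (simp add: B_def K_def)
    then have "norm (csum (poly g) p) \<le> y"
      using power_mono_iff[of "norm (csum (poly g) p)" y "2 * n"] n K1 by (simp add: y_def)
    then have "norm (csum (poly h) p) / p \<le> y / p" unfolding hg using p0 by (intro divide_right_mono) auto
    also have "y / p = K * ?P powr (- (1 / real n))" 
      using powr_add[of ?P 1 "- (1 / real n)"] pr by (simp add: y_def)
    also have "\<dots> \<le> 2 * real k ^ Suc k * ?P powr (- (1 / real k))"
    proof (rule mult_mono)
      have "real n ^ Suc n \<le> real k ^ Suc n" using n by (intro power_mono) auto
      also have "\<dots> \<le> real k ^ Suc k" using n by (intro power_increasing) auto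
      finally show "K \<le> 2 * real k ^ Suc k" by (simp add: K_def)
      show "?P powr (- (1 / real n)) \<le> ?P powr (- (1 / real k))"
        using pr n by (intro powr_mono) (auto simp: field_simps)
    qed auto
    finally show ?thesis .
  qed
qed

text \<open>Stationary phase: a shift by \<open>q = p ^ (e - 1)\<close> changes the phase by
  \<open>h'(x) / p\<close> modulo 1, because \<open>e \<ge> 2\<close> makes \<open>q^2\<close>
  divisible by \<open>p ^ e\<close>. Only the at most \<open>k\<close> classes on which
  \<open>p\<close> divides \<open>h'\<close> survive, and these are estimated trivially.\<close>

lemma csum_bound_prime_power:
  fixes h :: "int poly" and p :: int
  assumes p: "prime p" and e: "e \<ge> 2" and deg: "degree h \<le> k" and nz: "\<not> [:p:] dvd pderiv h"
  shows "norm (csum (poly h) (p ^ e)) \<le> real k * real_of_int p ^ (e - 1)"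
proof -
  have p0: "p > 0" using p by (simp add: prime_gt_0_int)
  define F where "F = (\<lambda>x. ee (of_int (poly h x) / of_int (p ^ e)))"
  define q where "q = p ^ (e - 1)"
  have pq: "p ^ e = p * q" using e by (simp add: q_def flip: power_Suc)
  have per: "F x = F y" if "[x = y] (mod p ^ e)" for x y
    unfolding F_def using that by (intro ee_cong_mod poly_cong_int)
  define A where "A = (\<lambda>x0. \<Sum>x\<in>{0..<p ^ e}. if [x = x0] (mod p) then F x else 0)"
  have zero: "A x0 = 0" if x0: "\<not> p dvd poly (pderiv h) x0" for x0
    unfolding A_def
  proof (rule class_sum_zero[where c = q])
    show "p dvd q" using e by (simp add: q_def)
    show "ee (of_int (poly (pderiv h) x0) / of_int p) \<noteq> 1" using x0 p0 by (simp add: ee_eq_1_iff)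
    fix x assume x: "[x = x0] (mod p)"
    obtain d where d: "poly h (x + q) = poly h x + q * poly (pderiv h) x + q\<^sup>2 * d"
      using poly_taylor2 by blast
    obtain w where w: "poly (pderiv h) x = poly (pderiv h) x0 + p * w"
      using poly_cong_int[OF x, of "pderiv h"] by (metis cong_iff_lin cong_sym)
    have "p ^ e dvd q\<^sup>2" using e unfolding q_def power_mult[symmetric] by (intro le_imp_power_dvd) auto
    then obtain v where v: "q\<^sup>2 = p ^ e * v" by (auto elim: dvdE)
    have "poly h (x + q) = poly h x + q * poly (pderiv h) x0 + p ^ e * (w + v * d)"
      unfolding d w v by (simp add: pq algebra_simps)
    then have "[poly h (x + q) = poly h x + q * poly (pderiv h) x0] (mod p ^ e)"
      by (simp add: cong_iff_dvd_diff)
    then have "F (x + q) = ee (of_int (poly h x + q * poly (pderiv h) x0) / of_int (p ^ e))"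
      unfolding F_def by (rule ee_cong_mod)
    also have "\<dots> = F x * ee (of_int (poly (pderiv h) x0) / of_int p)"
      unfolding F_def ee_add[symmetric] pq using p0 by (simp add: q_def add_divide_distrib)
    finally show "F (x + q) = ee (of_int (poly (pderiv h) x0) / of_int p) * F x" by (simp add: mult.commute)
  qed (use p0 e per in auto)
  have bound: "norm (A x0) \<le> real_of_int q" if x0: "x0 \<in> {0..<p}" for x0
  proof -
    let ?i = "\<lambda>x. if [x = x0] (mod p) then (1::complex) else 0"
    have "norm (A x0) \<le> (\<Sum>x\<in>{0..<p ^ e}. if [x = x0] (mod p) then 1 else 0)"
      unfolding A_def by (intro order_trans[OF norm_sum] sum_mono) (auto simp: F_def)
    also have "\<dots> = Re (\<Sum>x\<in>{0..<p * q}. ?i x)" by (simp add: pq if_distrib[of Re] cong: if_cong)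
    also have "(\<Sum>x\<in>{0..<p * q}. ?i x) = of_int q * (\<Sum>x\<in>{0..<p}. ?i x)"
      by (rule sum_multiple_period) (use p0 in \<open>auto simp: q_def cong_def\<close>)
    also have "(\<Sum>x\<in>{0..<p}. ?i x) = (\<Sum>x\<in>{0..<p}. if x = x0 then 1 else 0)"
      using x0 by (intro sum.cong refl) (auto simp: cong_def)
    also have "\<dots> = 1" using x0 by simp
    finally show ?thesis by simp
  qed
  have "csum (poly h) (p ^ e) = (\<Sum>x0\<in>{0..<p}. A x0)"
    unfolding csum_def A_def F_def by (rule sum_residue_classes[OF p0])
  also have "\<dots> = (\<Sum>x0\<in>{x0 \<in> {0..<p}. p dvd poly (pderiv h) x0}. A x0)"
    by (intro sum.mono_neutral_right) (auto simp: zero)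
  also have "norm \<dots> \<le> (\<Sum>x0\<in>{x0 \<in> {0..<p}. p dvd poly (pderiv h) x0}. real_of_int q)"
    by (intro order_trans[OF norm_sum] sum_mono bound) auto
  also have "\<dots> = real (card {x0 \<in> {0..<p}. p dvd poly (pderiv h) x0}) * real_of_int q" by simp
  also have "\<dots> \<le> real k * real_of_int q"
  proof (intro mult_right_mono of_nat_mono)
    have "card {x0 \<in> {0..<p}. p dvd poly (pderiv h) x0} \<le> degree (pderiv h)"
      by (rule card_roots_mod_prime[OF p nz])
    also have "\<dots> \<le> k" using deg by (simp add: degree_pderiv)
    finally show "card {x0 \<in> {0..<p}. p dvd poly (pderiv h) x0} \<le> k" .
  qed (use p0 in \<open>simp add: q_def\<close>)
  finally show ?thesis by (simp add: q_def)
qed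

section \<open>Local factors and dilations\<close>

locale odd_form =
  fixes g g1 :: "int poly" and v k :: nat and \<sigma> :: int
  assumes g_eq: "g = monom \<sigma> v + monom 1 (Suc v) * g1"
    and sigma: "\<bar>\<sigma>\<bar> = 1" and v: "v \<ge> 1"
    and deg: "degree g = k" and k: "k \<ge> 3" and lead: "coeff g k > 0"
    and odd: "\<And>x. poly g (- x) = - poly g x"
begin

text \<open>Taking the real part loses nothing: by oddness the sum equals its own conjugate, see
  \<open>csum_eq_S\<close>.\<close>

definition S :: "int \<Rightarrow> int \<Rightarrow> int \<Rightarrow> real" where
  "S d a q = Re (csum (\<lambda>x. a * poly g (d * x)) q) / of_int q"

lemma csum_eq_S:
  assumes "q > 0"
  shows "csum (\<lambda>x. a * poly g (d * x)) q = of_real (of_int q * S d a q)"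
proof -
  let ?F = "\<lambda>x. ee (of_int (a * poly g (d * x)) / of_int q)"
  have "cnj (csum (\<lambda>x. a * poly g (d * x)) q) = (\<Sum>x\<in>{0..<q}. ?F (- 1 * x + 0))"
    by (simp add: csum_def odd ee_minus)
  also have "\<dots> = csum (\<lambda>x. a * poly g (d * x)) q"
    unfolding csum_def
    by (rule sum_mod_reindex[of q "-1" ?F 0]) (use assms in \<open>auto intro!: ee_cong_mod cong_mult poly_cong_int simp del: of_int_mult\<close>)
  finally have "Im (csum (\<lambda>x. a * poly g (d * x)) q) = 0"
    by (simp add: complex_eq_iff)
  then show ?thesis using assms by (simp add: S_def complex_eq_iff)
qed

lemma abs_S_le_1:
  assumes "q > 0"
  shows "\<bar>S d a q\<bar> \<le> 1"
proof -
  have "norm (csum (\<lambda>x. a * poly g (d * x)) q) \<le> of_int q"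
    unfolding csum_def by (rule order_trans[OF norm_sum]) (use assms in simp)
  then have "\<bar>Re (csum (\<lambda>x. a * poly g (d * x)) q)\<bar> \<le> of_int q"
    using abs_Re_le_cmod order_trans by blast
  then show ?thesis using assms by (simp add: S_def)
qed

lemma S_eq_1:
  assumes "q > 0" "\<And>x. q dvd a * poly g (d * x)"
  shows "S d a q = 1"
proof -
  have "csum (\<lambda>x. a * poly g (d * x)) q = (\<Sum>x\<in>{0..<q}. 1)"
    unfolding csum_def by (intro sum.cong refl) (use assms in \<open>simp only: ee_eq_1_iff\<close>)
  then show ?thesis using assms(1) by (simp add: S_def)
qed

lemma S_modulus_1: "S d a 1 = 1"
  by (rule S_eq_1) auto

lemma S_mult_coprime:
  assumes "q > 0" "coprime c q"
  shows "S (d * c) a q = S d a q"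
proof -
  let ?F = "\<lambda>x. ee (of_int (a * poly g (d * x)) / of_int q)"
  have "(\<Sum>x\<in>{0..<q}. ?F (c * x + 0)) = (\<Sum>x\<in>{0..<q}. ?F x)"
    by (rule sum_mod_reindex) (use assms in \<open>auto intro!: ee_cong_mod cong_mult poly_cong_int simp del: of_int_mult\<close>)
  then show ?thesis by (simp add: S_def csum_def mult.assoc)
qed

lemma S_multiplicative:
  assumes q: "q > 0" "r > 0" "coprime q r" and a: "a = a1 * r + a2 * q"
  shows "S d a (q * r) = S d a1 q * S d a2 r"
proof -
  let ?F = "\<lambda>x. ee (of_int (a1 * poly g (d * x)) / of_int q)" and ?G = "\<lambda>x. ee (of_int (a2 * poly g (d * x)) / of_int r)"
  have "ee (of_int (a * poly g (d * x)) / of_int (q * r)) = ?F x * ?G x" for x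
    unfolding ee_add[symmetric] a using q by (simp add: field_simps)
  then have "csum (\<lambda>x. a * poly g (d * x)) (q * r) = (\<Sum>x\<in>{0..<q * r}. ?F x * ?G x)"
    by (simp only: csum_def)
  also have "\<dots> = (\<Sum>x\<in>{0..<q}. ?F x) * (\<Sum>x\<in>{0..<r}. ?G x)"
    by (rule sum_crt[OF q]) (intro ee_cong_mod cong_mult poly_cong_int cong_refl; simp)+
  also have "\<dots> = csum (\<lambda>x. a1 * poly g (d * x)) q * csum (\<lambda>x. a2 * poly g (d * x)) r"
    by (simp only: csum_def)
  finally have "complex_of_real (of_int (q * r) * S d a (q * r)) = complex_of_real ((of_int q * S d a1 q) * (of_int r * S d a2 r))"
    using q by (simp add: csum_eq_S)
  then have "of_int (q * r) * S d a (q * r) = (of_int q * S d a1 q) * (of_int r * S d a2 r)"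
    by (simp only: of_real_eq_iff)
  then show ?thesis using q by simp
qed

text \<open>\<open>g(c x) = c^v hs(c)(x)\<close>, and the coefficient of \<open>x^v\<close> in \<open>hs c\<close> is a unit: no prime divides all its coefficients.\<close>

definition hs :: "int \<Rightarrow> int poly" where
  "hs c = monom \<sigma> v + smult c (monom 1 (Suc v) * pcompose g1 [:0, c:])"

lemma poly_g_scale: "poly g (c * x) = c ^ v * poly (hs c) x"
  by (simp add: g_eq hs_def poly_monom poly_pcompose power_mult_distrib algebra_simps)

lemma coeff_hs_v: "coeff (hs c) v = \<sigma>"
  by (simp add: hs_def coeff_monom_mult)

lemma degree_hs:
  assumes "c \<noteq> 0"
  shows "degree (hs c) \<le> k"
proof -
  have "pcompose g [:0, c:] = smult (c ^ v) (hs c)"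
    by (rule poly_ext) (simp add: poly_pcompose poly_g_scale[symmetric] mult.commute)
  then have "degree (hs c) = degree (pcompose g [:0, c:])" using assms by simp
  also have "\<dots> \<le> degree g * degree [:0, c:]" by (rule degree_pcompose_le)
  finally show ?thesis using deg assms by simp
qed

lemma v_le_k: "v \<le> k"
proof -
  have "coeff g v = \<sigma>" by (simp add: g_eq coeff_monom_mult)
  then show ?thesis using sigma deg le_degree[of g v] by auto
qed

text \<open>This is what a dilation buys: \<open>p ^ (s * v)\<close> divides every value
  \<open>g (p ^ s * x)\<close>, so all terms of the sum equal 1.\<close>

lemma S_prime_power_trivial:
  assumes "prime p" "r \<le> s * v"
  shows "S (p ^ s) a (p ^ r) = 1"
proof (rule S_eq_1)
  show "p ^ r > 0" using assms(1) by (simp add: prime_gt_0_int)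
  fix x
  have "p ^ r dvd p ^ (s * v)" using assms(2) by (rule le_imp_power_dvd)
  then show "p ^ r dvd a * poly g (p ^ s * x)" by (simp add: poly_g_scale power_mult)
qed

text \<open>Cancelling the common factor \<open>p ^ (s * v)\<close> lowers the modulus; the sum then
  runs through \<open>p ^ (s * v)\<close> full periods, which the normalisation removes.\<close>

lemma S_prime_power_reduce:
  assumes p: "prime p" and r: "s * v < r"
  shows "S (p ^ s) a (p ^ r) = Re (csum (poly (smult a (hs (p ^ s)))) (p ^ (r - s * v))) / of_int (p ^ (r - s * v))"
proof -
  have p0: "p > 0" using p by (simp add: prime_gt_0_int)
  define q where "q = p ^ (r - s * v)"
  define m where "m = p ^ (s * v)"
  have qm: "p ^ r = q * m" "q > 0" "m > 0" using p0 r by (auto simp: q_def m_def simp flip: power_add)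
  have "ee (of_int (a * poly g (p ^ s * x)) / of_int (p ^ r)) = ee (of_int (poly (smult a (hs (p ^ s))) x) / of_int q)" for x
    using qm p0 by (simp add: poly_g_scale m_def power_mult)
  then have "csum (\<lambda>x. a * poly g (p ^ s * x)) (p ^ r) = (\<Sum>x\<in>{0..<q * m}. ee (of_int (poly (smult a (hs (p ^ s))) x) / of_int q))"
    by (simp only: csum_def qm(1))
  also have "\<dots> = of_int m * csum (poly (smult a (hs (p ^ s)))) q"
    unfolding csum_def by (rule sum_multiple_period) (use qm in \<open>auto intro!: ee_cong_mod poly_cong_int simp del: poly_smult\<close>)
  finally show ?thesis using qm by (simp add: S_def q_def[symmetric])
qed

definition Cm :: real where "Cm = 2 * real k ^ Suc k"

lemma Cm_ge: "Cm \<ge> real k" "Cm \<ge> 1"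
proof -
  have "real k * 1 \<le> real k * real k ^ k" using k by (intro mult_left_mono one_le_power) auto
  also have "\<dots> \<le> Cm" by (simp add: Cm_def)
  finally show "Cm \<ge> real k" by simp
  then show "Cm \<ge> 1" using k by linarith
qed

text \<open>The coefficient of \<open>x ^ (v - 1)\<close> in the derivative is
  \<open>a * v * \<sigma>\<close>, a unit because \<open>v \<le> k < p\<close>; so stationary phase
  applies whatever the other coefficients are.\<close>

lemma S_bound_power:
  assumes p: "prime p" "int k < p" and r: "s * v + 2 \<le> r" and a: "coprime a p"
  shows "\<bar>S (p ^ s) a (p ^ r)\<bar> \<le> real k / of_int p"
proof -
  have p0: "p > 0" using p by (simp add: prime_gt_0_int)
  define e where "e = r - s * v"
  have e: "e \<ge> 2" using r by (simp add: e_def)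
  have ndvd: "\<not> p dvd a" using a p(1) by (metis coprime_absorb_right not_prime_unit)
  have "\<not> p dvd int v" using p v v_le_k by (intro zdvd_not_zless) auto
  moreover have "\<not> p dvd \<sigma>" using sigma p(1) by (metis dvd_abs_iff not_prime_unit)
  ultimately have "\<not> p dvd coeff (pderiv (smult a (hs (p ^ s)))) (v - 1)"
    using v ndvd p(1) by (simp add: coeff_pderiv coeff_hs_v prime_dvd_mult_iff del: One_nat_def)
  then have "\<not> [:p:] dvd pderiv (smult a (hs (p ^ s)))" unfolding const_poly_dvd_iff by blast
  moreover have "degree (smult a (hs (p ^ s))) \<le> k" using degree_hs[of "p ^ s"] p0 degree_smult_le order_trans by fastforce
  ultimately have "norm (csum (poly (smult a (hs (p ^ s)))) (p ^ e)) \<le> real k * real_of_int p ^ (e - 1)"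
    using p(1) e by (intro csum_bound_prime_power)
  then have "\<bar>Re (csum (poly (smult a (hs (p ^ s)))) (p ^ e))\<bar> \<le> real k * real_of_int p ^ (e - 1)"
    using abs_Re_le_cmod order_trans by blast
  then have "\<bar>S (p ^ s) a (p ^ r)\<bar> \<le> real k * real_of_int p ^ (e - 1) / of_int (p ^ e)"
    using r p0 S_prime_power_reduce[OF p(1), of s r a] by (simp add: e_def[symmetric] divide_right_mono)
  also have "of_int (p ^ e) = real_of_int p * real_of_int p ^ (e - 1)" using e by (simp flip: power_Suc)
  finally show ?thesis using p0 by simp
qed

lemma S_bound:
  assumes p: "prime p" "int k < p" and r: "s * v < r" and a: "coprime a p"
  shows "\<bar>S (p ^ s) a (p ^ r)\<bar> \<le> Cm * real_of_int p powr (- (1 / real k))"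
proof (cases "s * v + 2 \<le> r")
  case True
  have p1: "real_of_int p \<ge> 1" using p by simp
  have "\<bar>S (p ^ s) a (p ^ r)\<bar> \<le> real k / of_int p" by (rule S_bound_power[OF p True a])
  also have "\<dots> = real k * real_of_int p powr - 1" using p1 by (simp add: powr_minus divide_inverse)
  also have "\<dots> \<le> Cm * real_of_int p powr (- (1 / real k))"
    using p1 Cm_ge k by (intro mult_mono powr_mono) auto
  finally show ?thesis .
next
  case False
  then have e1: "r - s * v = 1" using r by simp
  have p0: "p > 0" using p by (simp add: prime_gt_0_int)
  have ndvd: "\<not> p dvd a" using a p(1) by (metis coprime_absorb_right not_prime_unit)
  moreover have "\<not> p dvd \<sigma>" using sigma p(1) by (metis dvd_abs_iff not_prime_unit)
  ultimately have "\<not> p dvd coeff (smult a (hs (p ^ s))) v" using p(1) by (simp add: coeff_hs_v prime_dvd_mult_iff)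
  then have nz: "\<exists>i\<in>{1..k}. \<not> p dvd coeff (smult a (hs (p ^ s))) i" using v v_le_k by (intro bexI[of _ v]) auto
  have "degree (smult a (hs (p ^ s))) \<le> k" using degree_hs[of "p ^ s"] p0 degree_smult_le order_trans by fastforce
  from csum_bound_prime[OF p this nz]
  have "norm (csum (poly (smult a (hs (p ^ s)))) p) / p \<le> Cm * real_of_int p powr (- (1 / real k))" by (simp only: Cm_def)
  moreover have "\<bar>Re (csum (poly (smult a (hs (p ^ s)))) p)\<bar> / p \<le> norm (csum (poly (smult a (hs (p ^ s)))) p) / p"
    using abs_Re_le_cmod p0 by (intro divide_right_mono) auto
  ultimately show ?thesis using S_prime_power_reduce[OF p(1) r, of a] e1 p0 by simp
qed

text \<open>The shift by \<open>p^(e-1-t)\<close> multiplies the terms in a fixed residue class of units by a constant other than 1,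
  so only the multiples of \<open>p\<close> contribute.\<close>

lemma S_recursion:
  assumes p: "prime p" and a: "coprime a p" and s: "s \<ge> v" and r: "s * v + (2 * v + 2) \<le> r"
  shows "S (p ^ s) a (p ^ r) = S (p ^ Suc s) a (p ^ r) / of_int p"
proof -
  have p0: "p > 0" "p \<ge> 2" using p by (auto simp: prime_gt_0_int prime_ge_2_int)
  have ndvd: "\<not> p dvd a" using a p by (metis coprime_absorb_right not_prime_unit)
  \<comment> \<open>For small \<open>p\<close> the exponent \<open>v\<close> may be divisible by
    \<open>p\<close>, so on units the derivative of the lowest term is a unit times
    \<open>p ^ t\<close>. The shift \<open>c = p ^ (e - 1 - t)\<close> compensates for this:
    \<open>s > t\<close> disposes of the higher terms of the derivative and
    \<open>e \<ge> 2 * t + 2\<close> of the quadratic remainder.\<close>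
  define t where "t = multiplicity p (int v)"
  obtain v' where v': "int v = p ^ t * v'" "\<not> p dvd v'"
    using v p multiplicity_decompose'[of "int v" p] not_prime_unit unfolding t_def by (metis of_nat_eq_0_iff not_one_le_zero)
  have "p ^ t \<le> int v" using v v'(1) by (intro zdvd_imp_le) auto
  moreover have "(2::int) ^ t \<le> p ^ t" using p0 by (intro power_mono) auto
  moreover have "int t < 2 ^ t" using of_nat_less_two_power[of t] by simp
  ultimately have tv: "t < v" by linarith
  define e where "e = r - s * v"
  have e: "r = s * v + e" "e \<ge> 2 * t + 2" using r tv by (auto simp: e_def)
  define c where "c = p ^ (e - 1 - t)"
  define F where "F = (\<lambda>x. ee (of_int (a * poly g (p ^ s * x)) / of_int (p ^ r)))"
  have per: "F x = F y" if "[x = y] (mod p ^ r)" for x y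
    unfolding F_def using that by (intro ee_cong_mod cong_mult poly_cong_int cong_refl)
  have zero: "(\<Sum>x\<in>{0..<p ^ r}. if [x = x0] (mod p) then F x else 0) = 0" if x0: "\<not> p dvd x0" for x0
  proof (rule class_sum_zero[where c = c])
    let ?w = "a * v' * \<sigma> * x0 ^ (v - 1)"
    have "\<not> p dvd \<sigma>" using sigma p by (metis dvd_abs_iff not_prime_unit)
    moreover have "\<not> p dvd x0 ^ (v - 1)" using x0 p prime_dvd_power by blast
    ultimately have "\<not> p dvd ?w" using ndvd v'(2) p by (simp add: prime_dvd_mult_iff)
    then show "ee (of_int ?w / of_int p) \<noteq> 1" using p0 by (simp only: ee_eq_1_iff not_False_eq_True)
    show "p dvd c" unfolding c_def using e by (intro dvd_power) auto
    show "p dvd p ^ r" using e by (intro dvd_power) auto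
    fix x assume x: "[x = x0] (mod p)"
    define R where "R = monom 1 (Suc v) * pcompose g1 [:0, p ^ s:]"
    have "pderiv (hs (p ^ s)) = monom (int v * \<sigma>) (v - 1) + smult (p ^ s) (pderiv R)"
      by (simp add: hs_def R_def pderiv_add pderiv_monom pderiv_smult mult.commute)
    then have h': "poly (pderiv (hs (p ^ s))) x = int v * \<sigma> * x ^ (v - 1) + p ^ s * poly (pderiv R) x"
      by (simp add: poly_monom)
    obtain z where z: "x ^ (v - 1) = x0 ^ (v - 1) + p * z"
      using cong_pow[OF x, of "v - 1"] by (metis cong_iff_lin cong_sym)
    have "p ^ s = p ^ (t + 1) * p ^ (s - t - 1)"
      unfolding power_add[symmetric] using s tv by (intro arg_cong[of _ _ "power p"]) linarith
    then have h2: "poly (pderiv (hs (p ^ s))) x = p ^ t * (v' * \<sigma> * x0 ^ (v - 1)) + p ^ (t + 1) * (v' * \<sigma> * z + p ^ (s - t - 1) * poly (pderiv R) x)"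
      unfolding h' z v'(1) by (simp add: algebra_simps)
    obtain d where d: "poly (hs (p ^ s)) (x + c) = poly (hs (p ^ s)) x + c * poly (pderiv (hs (p ^ s))) x + c\<^sup>2 * d"
      using poly_taylor2 by blast
    let ?u = "v' * \<sigma> * x0 ^ (v - 1)" and ?y = "v' * \<sigma> * z + p ^ (s - t - 1) * poly (pderiv R) x"
    have e1: "p ^ (s * v) * (c * p ^ t) = p ^ (r - 1)" 
      unfolding c_def power_add[symmetric] using e by (intro arg_cong[of _ _ "power p"]) linarith
    have e2: "p ^ (s * v) * (c * p ^ (t + 1)) = p ^ r"
      unfolding c_def power_add[symmetric] using e by (intro arg_cong[of _ _ "power p"]) linarith
    have "p ^ r dvd p ^ (s * v) * c\<^sup>2"
      unfolding c_def power_mult[symmetric] power_add[symmetric] using e by (intro le_imp_power_dvd) linarith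
    then obtain y where y: "p ^ (s * v) * c\<^sup>2 = p ^ r * y" by (auto elim: dvdE)
    have gs: "poly g (p ^ s * w) = p ^ (s * v) * poly (hs (p ^ s)) w" for w
      by (simp only: poly_g_scale power_mult)
    have "poly g (p ^ s * (x + c)) = p ^ (s * v) * poly (hs (p ^ s)) (x + c)"
      by (rule gs)
    also have "\<dots> = p ^ (s * v) * poly (hs (p ^ s)) x + (p ^ (s * v) * (c * p ^ t)) * ?u + (p ^ (s * v) * (c * p ^ (t + 1))) * ?y + (p ^ (s * v) * c\<^sup>2) * d"
      unfolding d h2 by (simp add: algebra_simps)
    also have "\<dots> = poly g (p ^ s * x) + p ^ (r - 1) * ?u + p ^ r * (?y + y * d)"
      unfolding e1 e2 y gs by (simp add: algebra_simps)
    finally have "a * poly g (p ^ s * (x + c)) = a * poly g (p ^ s * x) + p ^ (r - 1) * ?w + p ^ r * (a * (?y + y * d))"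
      by (simp add: algebra_simps)
    then have "[a * poly g (p ^ s * (x + c)) = a * poly g (p ^ s * x) + p ^ (r - 1) * ?w] (mod p ^ r)"
      by (simp add: cong_iff_dvd_diff)
    then have "F (x + c) = ee (of_int (a * poly g (p ^ s * x) + p ^ (r - 1) * ?w) / of_int (p ^ r))"
      unfolding F_def by (rule ee_cong_mod)
    also have "\<dots> = F x * ee (of_int ?w / of_int p)"
    proof -
      have "p ^ r = p * p ^ (r - 1)" using e by (simp flip: power_Suc)
      then have "real_of_int (p ^ (r - 1) * ?w) / of_int (p ^ r) = of_int ?w / of_int p" using p0 by simp
      then show ?thesis unfolding F_def ee_add[symmetric] by (simp only: of_int_add add_divide_distrib)
    qed
    finally show "F (x + c) = ee (of_int ?w / of_int p) * F x" by (simp only: mult.commute)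
  qed (use p0 per in auto)
  have "csum (\<lambda>x. a * poly g (p ^ s * x)) (p ^ r) = (\<Sum>x0\<in>{0..<p}. \<Sum>x\<in>{0..<p ^ r}. if [x = x0] (mod p) then F x else 0)"
    unfolding csum_def F_def by (rule sum_residue_classes[OF p0(1)])
  also have "\<dots> = (\<Sum>x0\<in>{0}. \<Sum>x\<in>{0..<p ^ r}. if [x = x0] (mod p) then F x else 0)"
  proof (rule sum.mono_neutral_right)
    show "\<forall>x0\<in>{0..<p} - {0}. (\<Sum>x\<in>{0..<p ^ r}. if [x = x0] (mod p) then F x else 0) = 0"
    proof
      fix x0 assume "x0 \<in> {0..<p} - {0}"
      then have "\<not> p dvd x0" by (intro zdvd_not_zless) auto
      then show "(\<Sum>x\<in>{0..<p ^ r}. if [x = x0] (mod p) then F x else 0) = 0" by (rule zero)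
    qed
  qed (use p0 in auto)
  also have "\<dots> = (\<Sum>x\<in>{0..<p ^ r} \<inter> {x. p dvd x}. F x)"
    by (simp add: sum.If_cases cong_0_iff)
  also have "\<dots> = (\<Sum>y\<in>{0..<p ^ (r - 1)}. F (p * y))"
  proof (rule sum.reindex_bij_witness[of _ "\<lambda>y. p * y" "\<lambda>x. x div p"])
    have pr: "p ^ r = p * p ^ (r - 1)" using e by (simp flip: power_Suc)
    fix x assume "x \<in> {0..<p ^ r} \<inter> {x. p dvd x}"
    then obtain y where "x = p * y" "0 \<le> p * y" "p * y < p * p ^ (r - 1)" by (auto simp: pr elim!: dvdE)
    then show "x div p \<in> {0..<p ^ (r - 1)}" "p * (x div p) = x" "F (p * (x div p)) = F x"
      using p0 by (auto simp: zero_le_mult_iff)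
  next
    have pr: "p ^ r = p * p ^ (r - 1)" using e by (simp flip: power_Suc)
    fix y assume "y \<in> {0..<p ^ (r - 1)}"
    then show "p * y \<in> {0..<p ^ r} \<inter> {x. p dvd x}" "p * y div p = y" using p0 by (auto simp: pr)
  qed
  finally have A: "csum (\<lambda>x. a * poly g (p ^ s * x)) (p ^ r) = (\<Sum>y\<in>{0..<p ^ (r - 1)}. F (p * y))" .
  \<comment> \<open>The surviving terms \<open>F (p * y)\<close> have period
    \<open>p ^ (r - 1)\<close> in \<open>y\<close>, and the sum for \<open>Suc s\<close> runs over
    them \<open>p\<close> times.\<close>
  have pr: "p ^ r = p ^ (r - 1) * p" using e by (simp flip: power_Suc2)
  have "csum (\<lambda>x. a * poly g (p ^ Suc s * x)) (p ^ r) = (\<Sum>y\<in>{0..<p ^ (r - 1) * p}. F (p * y))"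
    unfolding csum_def F_def pr[symmetric] by (simp add: mult_ac)
  also have "\<dots> = of_int p * (\<Sum>y\<in>{0..<p ^ (r - 1)}. F (p * y))"
  proof (rule sum_multiple_period)
    fix x y assume "[x = y] (mod p ^ (r - 1))"
    then have "p * p ^ (r - 1) dvd p * (x - y)" by (simp only: mult_dvd_mono cong_iff_dvd_diff dvd_refl)
    then have "[p * x = p * y] (mod p ^ r)" by (simp add: cong_iff_dvd_diff pr algebra_simps)
    then show "F (p * x) = F (p * y)" by (rule per)
  qed (use p0 in auto)
  finally have "csum (\<lambda>x. a * poly g (p ^ Suc s * x)) (p ^ r) = of_int p * csum (\<lambda>x. a * poly g (p ^ s * x)) (p ^ r)"
    unfolding A .
  then show ?thesis unfolding S_def using p0 by simp
qed

end

section \<open>Means over the exponent at a single prime\<close>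

context odd_form begin

text \<open>The weights \<open>\<omega> s\<close> are the probabilities of the exponents \<open>s < R\<close> of \<open>p\<close> in the dilation.\<close>

definition local_ok :: "int \<Rightarrow> nat \<Rightarrow> (nat \<Rightarrow> real) \<Rightarrow> real \<Rightarrow> bool" where
  "local_ok p R \<omega> \<epsilon> \<longleftrightarrow> (\<forall>s<R. \<omega> s \<ge> 0) \<and> (\<Sum>s<R. \<omega> s) = 1 \<and>
     (\<forall>r\<ge>1. \<forall>a. coprime a p \<longrightarrow> - \<epsilon> \<le> (\<Sum>s<R. \<omega> s * S (p ^ s) a (p ^ r)))"

lemma local_ok_mono: "local_ok p R \<omega> \<epsilon> \<Longrightarrow> \<epsilon> \<le> \<epsilon>' \<Longrightarrow> local_ok p R \<omega> \<epsilon>'"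
  unfolding local_ok_def by force

lemma local_ok_large:
  assumes p: "prime p" "int k < p"
  shows "local_ok p 1 (\<lambda>_. 1) (Cm * real_of_int p powr (- (1 / real k)))"
proof -
  have "\<bar>S (p ^ 0) a (p ^ r)\<bar> \<le> Cm * real_of_int p powr (- (1 / real k))" if "r \<ge> 1" "coprime a p" for r a
    using that by (intro S_bound p) auto
  then show ?thesis by (fastforce simp: local_ok_def abs_le_iff)
qed

text \<open>The weight \<open>y\<close> is the local bound itself. If \<open>r \<le> v\<close>, the
  dilated factor is 1 and \<open>(1 - y) * (- y) + y = y^2\<close> is non-negative. If
  \<open>r > v\<close>, then \<open>r \<ge> 2\<close>: the undilated factor is at most
  \<open>k / p\<close>, hence at most \<open>k * p^(-2/k)\<close>, and the dilated one is at most
  \<open>y\<close> and carries the weight \<open>y\<close>.\<close>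

lemma local_ok_medium:
  assumes p: "prime p" "int k < p"
  defines "y \<equiv> Cm * real_of_int p powr (- (1 / real k))"
  assumes y1: "y \<le> 1"
  shows "local_ok p 2 (\<lambda>s. if s = 0 then 1 - y else y) ((real k + Cm\<^sup>2) * real_of_int p powr (- (2 / real k)))"
proof -
  have p1: "real_of_int p \<ge> 1" using p by simp
  have y0: "y \<ge> 0" using Cm_ge by (simp add: y_def)
  have "- ((real k + Cm\<^sup>2) * real_of_int p powr (- (2 / real k))) \<le> (1 - y) * S 1 a (p ^ r) + y * S p a (p ^ r)"
    if r: "r \<ge> 1" and a: "coprime a p" for r a
  proof -
    have S0: "\<bar>S 1 a (p ^ r)\<bar> \<le> y" using S_bound[OF p, of 0 r a] r a by (simp add: y_def)
    show ?thesis
    proof (cases "r \<le> v")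
      case True
      then have X: "S p a (p ^ r) = 1" using S_prime_power_trivial[OF p(1), of r 1 a] by simp
      have "(1 - y) * (- y) \<le> (1 - y) * S 1 a (p ^ r)" using S0 y1 by (intro mult_left_mono) auto
      moreover have "(1 - y) * (- y) + y \<ge> 0" using y0 by (simp add: algebra_simps)
      moreover have "(real k + Cm\<^sup>2) * real_of_int p powr (- (2 / real k)) \<ge> 0" using Cm_ge by simp
      ultimately show ?thesis unfolding X mult_1_right by linarith
    next
      case False
      then have r2: "r \<ge> 2" using v by simp
      have "\<bar>S 1 a (p ^ r)\<bar> \<le> real k / p" using S_bound_power[OF p, of 0 r a] r2 a by simp
      also have "\<dots> = real k * real_of_int p powr - 1" using p1 by (simp add: powr_minus divide_inverse)
      also have "\<dots> \<le> real k * real_of_int p powr (- (2 / real k))"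
        using p1 k by (intro mult_left_mono powr_mono) auto
      finally have 1: "\<bar>S 1 a (p ^ r)\<bar> \<le> real k * real_of_int p powr (- (2 / real k))" .
      have S1: "\<bar>S p a (p ^ r)\<bar> \<le> y" using S_bound[OF p, of 1 r a] False a by (simp add: y_def)
      have yy: "y * y = Cm\<^sup>2 * real_of_int p powr (- (2 / real k))"
        using p1 by (simp add: y_def power2_eq_square powr_add[symmetric])
      have "(1 - y) * \<bar>S 1 a (p ^ r)\<bar> \<le> 1 * \<bar>S 1 a (p ^ r)\<bar>" using y0 by (intro mult_right_mono) auto
      moreover have "y * \<bar>S p a (p ^ r)\<bar> \<le> y * y" using S1 y0 by (intro mult_left_mono) auto
      moreover have "\<bar>(1 - y) * S 1 a (p ^ r)\<bar> = (1 - y) * \<bar>S 1 a (p ^ r)\<bar>" "\<bar>y * S p a (p ^ r)\<bar> = y * \<bar>S p a (p ^ r)\<bar>"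
        using y0 y1 by (simp_all add: abs_mult)
      ultimately show ?thesis using 1 yy by (simp add: algebra_simps)
    qed
  qed
  then show ?thesis using y0 y1 by (auto simp: local_ok_def numeral_2_eq_2)
qed

text \<open>Negative values are confined to three ranges: the \<open>s\<close> below
  \<open>v\<close>; the \<open>s\<close> with \<open>s * v + E \<le> r\<close>, where the recursion
  at least doubles the size at each step, so the sizes add up to at most 1; and the at most
  \<open>E\<close> values with \<open>s * v\<close> in \<open>[r - E, r)\<close>. Beyond these the
  factor is 1. The total is \<open>v + 1 + E = 3 * v + 3\<close>.\<close>

lemma local_ok_small:
  assumes p: "prime p" and R: "R \<ge> 1"
  shows "local_ok p R (\<lambda>_. 1 / real R) ((3 * real v + 3) / real R)"
proof -
  define E where "E = 2 * v + 2"
  have main: "- (3 * real v + 3) \<le> (\<Sum>s<R. S (p ^ s) a (p ^ r))" if r: "r \<ge> 1" and a: "coprime a p" for r a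
  proof -
    define A where "A = (\<lambda>s. S (p ^ s) a (p ^ r))"
    have p0: "real_of_int p \<ge> 2" using prime_ge_2_int[OF p] by simp
    have A1: "\<bar>A s\<bar> \<le> 1" for s using p by (simp add: A_def abs_S_le_1 prime_gt_0_int)
    \<comment> \<open>\<open>b2\<close> is a difference so that its sum telescopes; doubling gives
      \<open>\<bar>A s\<bar> \<le> \<bar>A (Suc s)\<bar> - \<bar>A s\<bar>\<close>.\<close>
    define b1 b2 b3 where "b1 = (\<lambda>s. if s < v then 1 else (0::real))"
      and "b2 = (\<lambda>s. if v \<le> s \<and> s * v + E \<le> r then \<bar>A (Suc s)\<bar> - \<bar>A s\<bar> else 0)"
      and "b3 = (\<lambda>s. if r - E \<le> s * v \<and> s * v < r then 1 else (0::real))"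
    have pt: "- (b1 s + b2 s + b3 s) \<le> A s" for s
    proof -
      have b13: "b1 s \<ge> 0" "b3 s \<ge> 0" by (auto simp: b1_def b3_def)
      consider "s < v" | "v \<le> s" "s * v + E \<le> r" | "r \<le> s * v" | "v \<le> s" "r - E \<le> s * v" "s * v < r" by linarith
      then show ?thesis
      proof cases
        case 1
        then have "b1 s = 1" "b2 s = 0" by (auto simp: b1_def b2_def)
        then show ?thesis using b13 A1[of s] by (auto simp: abs_le_iff)
      next
        case 2
        have "A s = A (Suc s) / of_int p" unfolding A_def by (rule S_recursion[OF p a]) (use 2 in \<open>auto simp: E_def\<close>)
        then have "A s * of_int p = A (Suc s)" using p0 by simp
        then have "\<bar>A s\<bar> * real_of_int p = \<bar>A (Suc s)\<bar>" using p0 abs_mult[of "A s" "of_int p"] by simp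
        moreover have "\<bar>A s\<bar> * 2 \<le> \<bar>A s\<bar> * real_of_int p" using p0 by (intro mult_left_mono) auto
        ultimately have "\<bar>A s\<bar> \<le> b2 s" using 2 by (simp add: b2_def)
        then show ?thesis using b13 by linarith
      next
        case 3
        then have "A s = 1" unfolding A_def by (rule S_prime_power_trivial[OF p])
        moreover have "b2 s = 0" using 3 by (simp add: b2_def E_def)
        ultimately show ?thesis using b13 by linarith
      next
        case 4
        then have "b3 s = 1" "b2 s \<ge> 0 \<or> b2 s = \<bar>A (Suc s)\<bar> - \<bar>A s\<bar>" by (auto simp: b3_def b2_def)
        moreover have "b2 s = 0 \<or> s * v + E \<le> r" by (simp add: b2_def)
        moreover have "\<bar>A s\<bar> \<le> b2 s" if "s * v + E \<le> r"
        proof -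
          have "A s = A (Suc s) / of_int p" unfolding A_def by (rule S_recursion[OF p a]) (use 4 that in \<open>auto simp: E_def\<close>)
          then have "A s * of_int p = A (Suc s)" using p0 by simp
          then have "\<bar>A s\<bar> * real_of_int p = \<bar>A (Suc s)\<bar>" using p0 abs_mult[of "A s" "of_int p"] by simp
          moreover have "\<bar>A s\<bar> * 2 \<le> \<bar>A s\<bar> * real_of_int p" using p0 by (intro mult_left_mono) auto
          ultimately show ?thesis using that 4 by (simp add: b2_def)
        qed
        ultimately show ?thesis using b13 A1[of s] by fastforce
      qed
    qed
    have "(\<Sum>s<R. b1 s) = (\<Sum>s\<in>{..<R} \<inter> {..<v}. 1)" by (simp add: b1_def sum.If_cases lessThan_def)
    also have "\<dots> \<le> real v" using card_mono[of "{..<v}" "{..<R} \<inter> {..<v}"] by simp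
    finally have s1: "(\<Sum>s<R. b1 s) \<le> real v" .
    \<comment> \<open>The middle clause is the telescoped sum while the range lasts; afterwards only
      the bound 1 is kept.\<close>
    have "(\<Sum>s<m. b2 s) \<le> 1 \<and> (v \<le> m \<longrightarrow> m * v + E \<le> r \<longrightarrow> (\<Sum>s<m. b2 s) \<le> \<bar>A m\<bar>) \<and> (m \<le> v \<longrightarrow> (\<Sum>s<m. b2 s) = 0)" for m
    proof (induction m)
      case 0
      then show ?case by simp
    next
      case (Suc m)
      consider "m < v" | "v \<le> m" "m * v + E \<le> r" | "v \<le> m" "\<not> m * v + E \<le> r" by linarith
      then show ?case
      proof cases
        case 1
        then have "b2 m = 0" by (simp add: b2_def)
        then show ?thesis using Suc 1 by auto
      next
        case 2
        then have "b2 m = \<bar>A (Suc m)\<bar> - \<bar>A m\<bar>" by (simp add: b2_def)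
        then show ?thesis using Suc 2 A1[of "Suc m"] by auto
      next
        case 3
        then have "b2 m = 0" by (simp add: b2_def)
        then show ?thesis using Suc 3 by auto
      qed
    qed
    then have s2: "(\<Sum>s<R. b2 s) \<le> 1" by blast
    have "(\<Sum>s<R. b3 s) = real (card ({..<R} \<inter> {s. r - E \<le> s * v \<and> s * v < r}))"
      by (simp add: b3_def sum.If_cases)
    also have "card ({..<R} \<inter> {s. r - E \<le> s * v \<and> s * v < r}) \<le> card {r - E..<r}"
      by (rule card_inj_on_le[of "\<lambda>s. s * v"]) (use v in \<open>auto simp: inj_on_def\<close>)
    also have "\<dots> \<le> E" by simp
    finally have s3: "(\<Sum>s<R. b3 s) \<le> real E" by simp
    have "- (real v + 1 + real E) \<le> (\<Sum>s<R. - (b1 s + b2 s + b3 s))"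
      using s1 s2 s3 by (simp only: sum.distrib sum_negf)
    also have "\<dots> \<le> (\<Sum>s<R. A s)" by (intro sum_mono pt)
    finally show ?thesis by (simp add: E_def A_def)
  qed
  have "- ((3 * real v + 3) / real R) \<le> (\<Sum>s<R. 1 / real R * S (p ^ s) a (p ^ r))" if "r \<ge> 1" "coprime a p" for r a
  proof -
    have "(\<Sum>s<R. 1 / real R * S (p ^ s) a (p ^ r)) = (\<Sum>s<R. S (p ^ s) a (p ^ r)) / real R"
      by (simp add: sum_divide_distrib)
    moreover have "- (3 * real v + 3) / real R \<le> (\<Sum>s<R. S (p ^ s) a (p ^ r)) / real R"
      using main[OF that] by (intro divide_right_mono) auto
    ultimately show ?thesis by (simp only: minus_divide_left)
  qed
  then show ?thesis using R by (simp add: local_ok_def)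
qed

section \<open>Independent exponents at all primes\<close>

text \<open>Induction over the primes, with one weighted family serving all \<open>q\<close> and
  \<open>a\<close> at once. The clause on prime divisors of \<open>d\<close> keeps earlier dilations
  coprime to the new prime, so that the factor at \<open>p\<close> sees only \<open>p ^ s\<close>
  and the other factor only \<open>d\<close>; the mean over pairs is then a product of two
  means.\<close>

lemma product_dilations:
  assumes fin: "finite P" and P: "\<forall>p\<in>P. prime p \<and> R p \<ge> 1 \<and> local_ok p (R p) (\<omega> p) \<epsilon>" and eps: "\<epsilon> \<ge> 0"
  shows "\<exists>D w. finite D \<and> (\<forall>d\<in>D. 1 \<le> d \<and> d \<le> (\<Prod>p\<in>P. p ^ (R p - 1)) \<and> w d \<ge> 0 \<and> (\<forall>p. prime p \<longrightarrow> p dvd d \<longrightarrow> p \<in> P)) \<and>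
    (\<Sum>d\<in>D. w d) = (1::real) \<and>
    (\<forall>q\<ge>1. (\<forall>p. prime p \<longrightarrow> p dvd q \<longrightarrow> p \<in> P) \<longrightarrow> (\<forall>a. coprime a q \<longrightarrow> - \<epsilon> \<le> (\<Sum>d\<in>D. w d * S d a q)))"
    (is "\<exists>D w. ?G P D w")
  using fin P
proof (induction P rule: finite_induct)
  case empty
  show ?case
  proof (rule exI[of _ "{1}"], rule exI[of _ "\<lambda>_. 1"], intro conjI allI impI ballI)
    fix q a :: int assume "q \<ge> 1" "\<forall>p. prime p \<longrightarrow> p dvd q \<longrightarrow> p \<in> {}"
    moreover have "\<exists>p. p dvd q \<and> prime p" if "q \<noteq> 1"
      using that \<open>q \<ge> 1\<close> by (intro prime_divisor_exists) auto
    ultimately have "q = 1" by blast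
    then show "- \<epsilon> \<le> (\<Sum>d\<in>{1}. 1 * S d a q)" using eps by (simp add: S_modulus_1)
  qed (auto dest: not_prime_unit)
next
  case (insert p P)
  have "\<exists>D w. ?G P D w"
    by (rule insert.IH) (use insert.prems in blast)
  then obtain D w where H: "finite D"
    "\<forall>d\<in>D. 1 \<le> d \<and> d \<le> (\<Prod>p\<in>P. p ^ (R p - 1)) \<and> w d \<ge> 0 \<and> (\<forall>p. prime p \<longrightarrow> p dvd d \<longrightarrow> p \<in> P)"
    "(\<Sum>d\<in>D. w d) = (1::real)"
    "\<forall>q\<ge>1. (\<forall>p. prime p \<longrightarrow> p dvd q \<longrightarrow> p \<in> P) \<longrightarrow> (\<forall>a. coprime a q \<longrightarrow> - \<epsilon> \<le> (\<Sum>d\<in>D. w d * S d a q))"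
    by (elim exE conjE) (rule that)
  have D: "finite D"
    "\<And>d. d \<in> D \<Longrightarrow> 1 \<le> d \<and> d \<le> (\<Prod>p\<in>P. p ^ (R p - 1)) \<and> w d \<ge> 0 \<and> (\<forall>p. prime p \<longrightarrow> p dvd d \<longrightarrow> p \<in> P)"
    "(\<Sum>d\<in>D. w d) = (1::real)"
    "\<And>q a. q \<ge> 1 \<Longrightarrow> (\<forall>p. prime p \<longrightarrow> p dvd q \<longrightarrow> p \<in> P) \<Longrightarrow> coprime a q \<Longrightarrow> - \<epsilon> \<le> (\<Sum>d\<in>D. w d * S d a q)"
    using H by blast+
  have p: "prime p" "R p \<ge> 1" and lok: "local_ok p (R p) (\<omega> p) \<epsilon>" using insert.prems by auto
  have p0: "p > 0" using p by (simp add: prime_gt_0_int)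
  have pd: "\<not> p dvd d" if "d \<in> D" for d using D(2)[OF that] p insert.hyps(2) by blast
  define f where "f = (\<lambda>(d, s). d * p ^ s)"
  define Z where "Z = D \<times> {..<R p}"
  \<comment> \<open>The multiplicity of \<open>p\<close> recovers \<open>s\<close> from
    \<open>d * p ^ s\<close>, so weights on pairs carry over to integers without collisions.\<close>
  have inj: "inj_on f Z"
  proof (rule inj_onI)
    fix z z' assume z: "z \<in> Z" "z' \<in> Z" "f z = f z'"
    obtain d s d' s' where zz: "z = (d, s)" "z' = (d', s')" by (cases z; cases z')
    have "multiplicity p (d * p ^ s) = s" if "d \<in> D" for d s
      by (rule multiplicity_decomposeI[where x' = d]) (use pd[OF that] p0 in auto)
    then have "s = s'" using z zz unfolding f_def Z_def by (metis (no_types, lifting) SigmaD1 old.prod.case)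
    then show "z = z'" using z zz p0 by (simp add: f_def)
  qed
  define w' where "w' = (\<lambda>m. w (fst (inv_into Z f m)) * \<omega> p (snd (inv_into Z f m)))"
  have w': "w' (f z) = w (fst z) * \<omega> p (snd z)" if "z \<in> Z" for z
    using that inj by (simp add: w'_def)
  have sumf: "(\<Sum>m\<in>f ` Z. w' m * G m) = (\<Sum>d\<in>D. \<Sum>s<R p. w d * \<omega> p s * G (d * p ^ s))" for G :: "int \<Rightarrow> real"
  proof -
    have "(\<Sum>m\<in>f ` Z. w' m * G m) = (\<Sum>z\<in>Z. w (fst z) * \<omega> p (snd z) * G (f z))"
      by (subst sum.reindex[OF inj]) (simp add: w')
    then show ?thesis by (simp add: Z_def sum.cartesian_product f_def case_prod_beta)
  qed
  have \<omega>: "\<And>s. s < R p \<Longrightarrow> \<omega> p s \<ge> 0" "(\<Sum>s<R p. \<omega> p s) = 1" 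
    "\<And>r a. r \<ge> 1 \<Longrightarrow> coprime a p \<Longrightarrow> - \<epsilon> \<le> (\<Sum>s<R p. \<omega> p s * S (p ^ s) a (p ^ r))"
    using lok by (auto simp: local_ok_def)
  show ?case
  proof (rule exI[of _ "f ` Z"], rule exI[of _ w'], intro conjI allI impI ballI)
    show "finite (f ` Z)" using D(1) by (simp add: Z_def)
    show "(\<Sum>m\<in>f ` Z. w' m) = 1"
      using sumf[of "\<lambda>_. 1"] D(3) \<omega>(2) by (simp flip: sum_distrib_left)
  next
    fix m assume "m \<in> f ` Z"
    then obtain d s where m: "m = d * p ^ s" "d \<in> D" "s < R p" "m = f (d, s)" "(d, s) \<in> Z" by (auto simp: f_def Z_def)
    note d = D(2)[OF m(2)]
    have ps: "1 \<le> p ^ s" "p ^ s \<le> p ^ (R p - 1)" using p0 m(3) by (auto intro!: power_increasing)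
    have "1 * 1 \<le> d * p ^ s" using d ps by (intro mult_mono) auto
    then show "1 \<le> m" using m by simp
    have "d * p ^ s \<le> (\<Prod>p\<in>P. p ^ (R p - 1)) * p ^ (R p - 1)" using d ps by (intro mult_mono) auto
    then show "m \<le> (\<Prod>p\<in>insert p P. p ^ (R p - 1))" using insert.hyps m by (simp add: mult.commute)
    show "0 \<le> w' m" using w'[OF m(5)] m d \<omega>(1) by simp
    fix p' assume "prime p'" "p' dvd m"
    then have "p' dvd d \<or> p' dvd p" using m(1) by (auto simp: prime_dvd_mult_iff dest: prime_dvd_power)
    then show "p' \<in> insert p P" using d \<open>prime p'\<close> p(1) primes_dvd_imp_eq by blast
  next
    fix q a :: int assume q: "q \<ge> 1" "\<forall>p'. prime p' \<longrightarrow> p' dvd q \<longrightarrow> p' \<in> insert p P" and a: "coprime a q"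
    define r where "r = multiplicity p q"
    obtain q' where q': "q = p ^ r * q'" "\<not> p dvd q'"
      using multiplicity_decompose'[of q p] q p not_prime_unit unfolding r_def by (metis not_one_le_zero)
    have q'1: "q' \<ge> 1" 
    proof -
      have "0 < p ^ r * q'" using q(1) q'(1) by simp
      then show ?thesis using p0 by (simp add: zero_less_mult_iff)
    qed
    have q'P: "\<forall>p'. prime p' \<longrightarrow> p' dvd q' \<longrightarrow> p' \<in> P" using q q' by auto
    have cop: "coprime (p ^ r) q'" using q'(2) p prime_imp_coprime[of p q'] by simp
    have copd: "coprime d (p ^ r)" if "d \<in> D" for d using pd[OF that] p prime_imp_coprime[of p d] by (simp add: coprime_commute)
    \<comment> \<open>Bezout splits \<open>a / q\<close> into fractions with denominators
      \<open>p ^ r\<close> and \<open>q'\<close>, whose numerators remain coprime to them.\<close>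
    obtain u y where uy: "u * q' + y * p ^ r = 1"
      using bezout_int[of q' "p ^ r"] cop unfolding coprime_iff_gcd_eq_1 gcd.commute[of "p ^ r"] by auto
    define a1 a2 where "a1 = a * u" and "a2 = a * y"
    have a12: "a = a1 * q' + a2 * p ^ r" using arg_cong[OF uy, of "(*) a"] by (simp add: a1_def a2_def algebra_simps)
    have ca1: "coprime a1 (p ^ r)"
    proof (rule coprimeI)
      fix c assume c: "c dvd a1" "c dvd p ^ r"
      then have "c dvd a1 * q' + a2 * p ^ r" "c dvd p ^ r * q'" by auto
      then have "c dvd a" "c dvd q" by (simp_all only: a12[symmetric] q'(1)[symmetric])
      then show "is_unit c" using a coprime_common_divisor by blast
    qed
    have ca2: "coprime a2 q'"
    proof (rule coprimeI)
      fix c assume c: "c dvd a2" "c dvd q'"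
      then have "c dvd a1 * q' + a2 * p ^ r" "c dvd p ^ r * q'" by auto
      then have "c dvd a" "c dvd q" by (simp_all only: a12[symmetric] q'(1)[symmetric])
      then show "is_unit c" using a coprime_common_divisor by blast
    qed
    have S_term: "S (d * p ^ s) a q = S (p ^ s) a1 (p ^ r) * S d a2 q'" if "d \<in> D" for d s
    proof -
      have "S (d * p ^ s) a q = S (d * p ^ s) a1 (p ^ r) * S (d * p ^ s) a2 q'"
        unfolding q'(1) using p0 q'1 cop a12 by (intro S_multiplicative) auto
      also have "S (d * p ^ s) a1 (p ^ r) = S (p ^ s) a1 (p ^ r)"
        using S_mult_coprime[of "p ^ r" d "p ^ s" a1] p0 copd[OF that] by (simp add: mult.commute)
      also have "S (d * p ^ s) a2 q' = S d a2 q'"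
        using q'1 q'(2) p prime_imp_coprime[of p q'] by (intro S_mult_coprime) auto
      finally show ?thesis .
    qed
    define X Y where "X = (\<Sum>s<R p. \<omega> p s * S (p ^ s) a1 (p ^ r))" and "Y = (\<Sum>d\<in>D. w d * S d a2 q')"
    have "(\<Sum>m\<in>f ` Z. w' m * S m a q) = (\<Sum>d\<in>D. \<Sum>s<R p. (w d * S d a2 q') * (\<omega> p s * S (p ^ s) a1 (p ^ r)))"
      unfolding sumf by (intro sum.cong refl) (simp add: S_term)
    also have "\<dots> = Y * X" by (simp add: X_def Y_def sum_product)
    finally have eq: "(\<Sum>m\<in>f ` Z. w' m * S m a q) = Y * X" .
    have Yl: "- \<epsilon> \<le> Y" unfolding Y_def by (rule D(4)[OF q'1 q'P ca2])
    have "Y \<le> (\<Sum>d\<in>D. w d * 1)" unfolding Y_def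
      by (intro sum_mono mult_left_mono) (use D(2) abs_S_le_1[of q' _ a2] q'1 in \<open>auto simp: abs_le_iff\<close>)
    then have Yu: "Y \<le> 1" using D(3) by simp
    have "X \<le> (\<Sum>s<R p. \<omega> p s * 1)" unfolding X_def
      by (intro sum_mono mult_left_mono) (use \<omega>(1) abs_S_le_1[of "p ^ r" _ a1] p0 in \<open>auto simp: abs_le_iff\<close>)
    then have Xu: "X \<le> 1" using \<omega>(2) by simp
    have Xl: "- \<epsilon> \<le> X"
    proof (cases "r = 0")
      case True
      then show ?thesis using eps \<omega>(2) by (simp add: X_def S_modulus_1)
    next
      case False
      then show ?thesis unfolding X_def using ca1 by (intro \<omega>(3)) auto
    qed
    have "- \<epsilon> \<le> Y * X"
    proof (cases "0 \<le> Y * X")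
      case False
      then consider "Y < 0" "X > 0" | "Y > 0" "X < 0" by (auto simp: zero_le_mult_iff not_le)
      then show ?thesis
      proof cases
        case 1
        have "- \<epsilon> * 1 \<le> - \<epsilon> * X" using eps Xu by (intro mult_left_mono_neg) auto
        also have "\<dots> \<le> Y * X" using Yl 1 by (intro mult_right_mono) auto
        finally show ?thesis by simp
      next
        case 2
        have "1 * - \<epsilon> \<le> Y * - \<epsilon>" using eps Yu by (intro mult_right_mono_neg) auto
        also have "\<dots> \<le> Y * X" using Xl 2 by (intro mult_left_mono) auto
        finally show ?thesis by simp
      qed
    qed (use eps in linarith)
    then show "- \<epsilon> \<le> (\<Sum>m\<in>f ` Z. w' m * S m a q)" by (simp only: eq)
  qed
qed

end

section \<open>A Chebyshev bound for the primorial\<close>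

lemma prod_primes_dvd:
  fixes x :: nat
  assumes "finite A" "\<And>p. p \<in> A \<Longrightarrow> prime p \<and> p dvd x"
  shows "\<Prod>A dvd x"
  using assms
proof (induction A rule: finite_induct)
  case (insert p A)
  have "coprime p (\<Prod>A)"
    by (rule prod_coprime_right) (use insert in \<open>auto intro!: primes_coprime\<close>)
  then show ?case using insert by (simp add: divides_mult)
qed simp

text \<open>Two equal central terms in a row of sum \<open>2 * 4 ^ m\<close>.\<close>

lemma choose_odd_le: "(2 * m + 1) choose m \<le> 4 ^ m"
proof -
  have "((2 * m + 1) choose m) + ((2 * m + 1) choose (m + 1)) = (\<Sum>i\<in>{m, m + 1}. (2 * m + 1) choose i)" by simp
  also have "\<dots> \<le> (\<Sum>i\<le>2 * m + 1. (2 * m + 1) choose i)" by (intro sum_mono2) auto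
  also have "\<dots> = 2 * 4 ^ m" by (simp only: choose_row_sum) (simp add: power_mult)
  finally show ?thesis using binomial_symmetric[of m "2 * m + 1"] by simp
qed

text \<open>Erdos' argument: the primes in \<open>(m + 1, 2 * m + 1]\<close> divide
  \<open>(2 * m + 1) choose m\<close>, which is at most \<open>4 ^ m\<close>, and the smaller ones
  are covered by the bound at \<open>m + 1\<close>. An even \<open>n > 2\<close> adds no
  prime.\<close>

lemma primorial_le: "\<Prod>{p::nat. prime p \<and> p \<le> n} \<le> 4 ^ n"
proof (induction n rule: less_induct)
  case (less n)
  show ?case
  proof (cases "n \<le> 2")
    case True
    then consider "n < 2" | "n = 2" by linarith
    then show ?thesis
    proof cases
      case 1
      then have "{p::nat. prime p \<and> p \<le> n} = {}" by (auto dest: prime_ge_2_nat)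
      then show ?thesis by (simp only: prod.empty) simp
    next
      case 2
      have "{p::nat. prime p \<and> p \<le> 2} = {2}" by (auto dest: prime_ge_2_nat)
      then show ?thesis using 2 by simp
    qed
  next
    case False
    show ?thesis
    proof (cases "even n")
      case True
      have "\<not> prime n" using True False prime_odd_nat[of n] by auto
      have "{p::nat. prime p \<and> p \<le> n} = {p. prime p \<and> p \<le> n - 1}"
      proof (rule Collect_cong)
        show "prime p \<and> p \<le> n \<longleftrightarrow> prime p \<and> p \<le> n - 1" for p
          using \<open>\<not> prime n\<close> by (cases "p = n") auto
      qed
      then have "\<Prod>{p::nat. prime p \<and> p \<le> n} \<le> 4 ^ (n - 1)" using less[of "n - 1"] False by simp
      also have "\<dots> \<le> 4 ^ n" by (intro power_increasing) auto
      finally show ?thesis .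
    next
      case odd: False
      then obtain m where m: "n = 2 * m + 1" by (auto elim: oddE)
      have m1: "m \<ge> 1" using m False by simp
      let ?A = "{p::nat. prime p \<and> p \<le> m + 1}" and ?B = "{p::nat. prime p \<and> m + 1 < p \<and> p \<le> 2 * m + 1}"
      have fin: "finite ?A" "finite ?B" by (rule finite_subset[of _ "{..2 * m + 1}"], use m1 in auto)+
      have "{p::nat. prime p \<and> p \<le> n} = ?A \<union> ?B" using m by auto
      then have "\<Prod>{p::nat. prime p \<and> p \<le> n} = \<Prod>?A * \<Prod>?B"
        using fin by (simp add: prod.union_disjoint disjoint_iff)
      also have "\<dots> \<le> 4 ^ (m + 1) * 4 ^ m"
      proof (rule mult_mono)
        show "\<Prod>?A \<le> 4 ^ (m + 1)" using less[of "m + 1"] m m1 by simp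
        have "\<Prod>?B dvd (2 * m + 1) choose m"
        proof (rule prod_primes_dvd[OF fin(2)])
          fix p assume p: "p \<in> ?B"
          then have "p dvd fact (2 * m + 1)" by (simp add: prime_dvd_fact_iff del: fact_Suc)
          also have "fact (2 * m + 1) = fact m * fact (m + 1) * ((2 * m + 1) choose m)"
          proof -
            have "2 * m + 1 - m = m + 1" by simp
            then show ?thesis using binomial_fact_lemma[of m "2 * m + 1"] by simp
          qed
          finally show "prime p \<and> p dvd (2 * m + 1) choose m"
            using p by (auto simp: prime_dvd_mult_iff prime_dvd_fact_iff simp del: fact_Suc)
        qed
        then have "\<Prod>?B \<le> (2 * m + 1) choose m" by (intro dvd_imp_le) auto
        also have "\<dots> \<le> 4 ^ m" by (rule choose_odd_le)
        finally show "\<Prod>?B \<le> 4 ^ m" .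
      qed auto
      also have "\<dots> = 4 ^ n" by (simp add: m mult_2 flip: power_add)
      finally show ?thesis .
    qed
  qed
qed

lemma primorial_int_le: "(\<Prod>p\<in>{p::int. prime p \<and> p \<le> int n}. real_of_int p) \<le> 4 ^ n"
proof -
  have "(\<Prod>p\<in>{p::int. prime p \<and> p \<le> int n}. real_of_int p) = (\<Prod>p\<in>{p::nat. prime p \<and> p \<le> n}. real p)"
    by (rule prod.reindex_bij_witness[of _ int nat]) (auto simp: prime_gt_0_int prime_ge_0_int)
  also have "\<dots> = real (\<Prod>{p::nat. prime p \<and> p \<le> n})" by simp
  also have "\<dots> \<le> real (4 ^ n)" by (rule of_nat_mono[OF primorial_le])
  finally show ?thesis by simp
qed

section \<open>Choice of the exponents and size of the dilations\<close>

context odd_form begin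

text \<open>The constants for the large, medium and small primes in this order, with
  \<open>k\<close> in place of \<open>v\<close>.\<close>

definition C1 :: real where "C1 = Cm + real k + Cm\<^sup>2 + 3 * real k + 3"

text \<open>\<open>Y\<close> only selects the primes considered, and those above \<open>Q\<close>
  get exponent 0; so the bound for \<open>d\<close> depends on \<open>Q\<close> alone. This matters
  because \<open>Y\<close> is later chosen in terms of the size of \<open>d\<close>. The lower bound
  for \<open>Q\<close> makes every \<open>p\<close> with \<open>p^2 > Q\<close> exceed
  \<open>k\<close> and satisfy \<open>Cm * p^(-1/k) \<le> 1\<close>.\<close>

lemma good_dilations:
  fixes Q :: nat and Y :: int
  assumes Q: "real Q \<ge> Cm ^ (2 * k) + real k ^ 2"
  shows "\<exists>D w. finite D \<and> (\<forall>d\<in>D. 1 \<le> d \<and> real_of_int d \<le> exp (14 * real Q) \<and> w d \<ge> 0) \<and> (\<Sum>d\<in>D. w d) = (1::real) \<and>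
    (\<forall>q\<ge>1. q \<le> Y \<longrightarrow> (\<forall>a. coprime a q \<longrightarrow> - (C1 * real Q powr (- (1 / real k))) \<le> (\<Sum>d\<in>D. w d * S d a q)))"
proof -
  have Cmk: "Cm ^ (2 * k) \<ge> 1" using Cm_ge by (intro one_le_power) auto
  have k9: "real k ^ 2 \<ge> 3 ^ 2" using k by (intro power_mono) auto
  have Q1: "real Q \<ge> 1" using Q Cmk k9 by simp
  \<comment> \<open>A mean over \<open>R0\<close> exponents errs by \<open>(3 * v + 3) / R0\<close>,
    so about \<open>Q^(1/k)\<close> of them reach the target \<open>\<epsilon>\<close>.\<close>
  define R0 where "R0 = nat \<lceil>real Q powr (1 / real k)\<rceil>"
  have Qk1: "real Q powr (1 / real k) \<ge> 1" using Q1 by (intro ge_one_powr_ge_zero) auto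
  have R0: "real R0 \<ge> real Q powr (1 / real k)" "real R0 \<le> 2 * real Q powr (1 / real k)" "R0 \<ge> 1"
    using Qk1 unfolding R0_def by linarith+
  define R where "R = (\<lambda>p::int. if p\<^sup>2 \<le> int Q then R0 else if p \<le> int Q then 2 else 1)"
  define \<omega> where "\<omega> = (\<lambda>(p::int) (s::nat). if p\<^sup>2 \<le> int Q then 1 / real R0 else if p \<le> int Q then
     (if s = 0 then 1 - Cm * real_of_int p powr (- (1 / real k)) else Cm * real_of_int p powr (- (1 / real k))) else 1)"
  define \<epsilon> where "\<epsilon> = C1 * real Q powr (- (1 / real k))"
  define P where "P = {p::int. prime p \<and> p \<le> Y}"
  have finP: "finite P" by (rule finite_subset[of _ "{0..Y}"]) (auto simp: P_def prime_ge_0_int)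
  have C1: "C1 \<ge> Cm" "C1 \<ge> real k + Cm\<^sup>2" "C1 \<ge> 3 * real k + 3" "C1 \<ge> 0" using Cm_ge by (auto simp: C1_def)
  have ok: "prime p \<and> R p \<ge> 1 \<and> local_ok p (R p) (\<omega> p) \<epsilon>" if "p \<in> P" for p
  proof -
    have p: "prime p" using that by (simp add: P_def)
    have p1: "real_of_int p \<ge> 1" using prime_gt_0_int[OF p] by simp
    consider "p\<^sup>2 \<le> int Q" | "p\<^sup>2 > int Q" "p \<le> int Q" | "p\<^sup>2 > int Q" "p > int Q" by linarith
    then show ?thesis
    proof cases
      case 1
      have "(3 * real v + 3) / real R0 \<le> (3 * real k + 3) / real Q powr (1 / real k)"
        using R0 Qk1 v_le_k Q1 by (intro frac_le) auto
      also have "\<dots> = (3 * real k + 3) * real Q powr (- (1 / real k))" by (simp add: powr_minus divide_inverse)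
      also have "\<dots> \<le> \<epsilon>" unfolding \<epsilon>_def using C1 by (intro mult_right_mono) auto
      finally have "local_ok p R0 (\<lambda>_. 1 / real R0) \<epsilon>" by (rule local_ok_mono[OF local_ok_small[OF p R0(3)]])
      then show ?thesis using 1 p R0(3) by (simp add: R_def \<omega>_def)
    next
      case 2
      have "real Q \<le> real_of_int (p\<^sup>2)" using 2(1) by linarith
      then have p2: "real_of_int p ^ 2 \<ge> real Q" by simp
      have "real k ^ 2 < real_of_int p ^ 2" using p2 Q Cmk by linarith
      then have "real k < real_of_int p" by (rule power2_less_imp_less) (use p1 in simp)
      then have kp: "int k < p" by linarith
      have "Cm ^ (2 * k) \<le> Cm ^ (2 * k) + real k ^ 2" by simp
      also have "\<dots> \<le> real_of_int p ^ 2" by (rule order_trans[OF Q p2])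
      finally have "(Cm ^ k) ^ 2 \<le> real_of_int p ^ 2" unfolding power_even_eq .
      then have Cp: "Cm ^ k \<le> real_of_int p" by (rule power2_le_imp_le) (use p1 in simp)
      have "Cm ^ k = Cm powr real k" using Cm_ge by (subst powr_realpow) auto
      then have "(Cm ^ k) powr (1 / real k) = Cm powr (real k * (1 / real k))" by (simp only: powr_powr)
      also have "real k * (1 / real k) = 1" using k by simp
      finally have "Cm = (Cm ^ k) powr (1 / real k)" using Cm_ge by simp
      also have "\<dots> \<le> real_of_int p powr (1 / real k)" using Cp Cm_ge by (intro powr_mono2) auto
      finally have y1: "Cm * real_of_int p powr (- (1 / real k)) \<le> 1"
        using p1 by (simp add: powr_minus field_simps)
      \<comment> \<open>Here \<open>p^2 > Q\<close> turns the squared local bound of the medium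
        primes into \<open>Q^(-1/k)\<close>.\<close>
      have "real_of_int p powr (- (2 / real k)) = (real_of_int p ^ 2) powr (- (1 / real k))"
      proof -
        have "real_of_int p ^ 2 = real_of_int p powr 2" using p1 by simp
        then show ?thesis by (simp only: powr_powr) simp
      qed
      also have "\<dots> \<le> real Q powr (- (1 / real k))" using p2 Q1 by (intro powr_mono2') auto
      finally have "(real k + Cm\<^sup>2) * real_of_int p powr (- (2 / real k)) \<le> \<epsilon>"
        unfolding \<epsilon>_def using C1 by (intro mult_mono) auto
      then have "local_ok p 2 (\<lambda>s. if s = 0 then 1 - Cm * real_of_int p powr (- (1 / real k)) else Cm * real_of_int p powr (- (1 / real k))) \<epsilon>"
        using local_ok_mono[OF local_ok_medium[OF p kp y1]] by blast
      then show ?thesis using 2 p by (simp add: R_def \<omega>_def)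
    next
      case 3
      have "real k \<le> real k ^ 2" using k by (simp add: power2_eq_square)
      then have "real k < real_of_int p" using 3 Q Cmk by linarith
      then have kp: "int k < p" by linarith
      have "Cm * real_of_int p powr (- (1 / real k)) \<le> \<epsilon>"
        unfolding \<epsilon>_def using C1 Cm_ge 3 Q1 by (intro mult_mono powr_mono2') auto
      then have "local_ok p 1 (\<lambda>_. 1) \<epsilon>" by (rule local_ok_mono[OF local_ok_large[OF p kp]])
      then show ?thesis using 3 p by (simp add: R_def \<omega>_def)
    qed
  qed
  have ok': "\<forall>p\<in>P. prime p \<and> R p \<ge> 1 \<and> local_ok p (R p) (\<omega> p) \<epsilon>" using ok by blast
  have eps0: "\<epsilon> \<ge> 0" using C1 by (simp add: \<epsilon>_def)
  obtain D w where D: "finite D"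
    "\<forall>d\<in>D. 1 \<le> d \<and> d \<le> (\<Prod>p\<in>P. p ^ (R p - 1)) \<and> w d \<ge> 0 \<and> (\<forall>p. prime p \<longrightarrow> p dvd d \<longrightarrow> p \<in> P)"
    "(\<Sum>d\<in>D. w d) = (1::real)"
    "\<forall>q\<ge>1. (\<forall>p. prime p \<longrightarrow> p dvd q \<longrightarrow> p \<in> P) \<longrightarrow> (\<forall>a. coprime a q \<longrightarrow> - \<epsilon> \<le> (\<Sum>d\<in>D. w d * S d a q))"
    using product_dilations[OF finP ok' eps0] by (elim exE conjE) (rule that)
  have bound: "real_of_int (\<Prod>p\<in>P. p ^ (R p - 1)) \<le> exp (14 * real Q)"
  proof -
    let ?PQ = "{p::int. prime p \<and> p \<le> int Q}" and ?PS = "{p::int. prime p \<and> p\<^sup>2 \<le> int Q}"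
    have finQ: "finite ?PQ" by (rule finite_subset[of _ "{0..int Q}"]) (auto simp: prime_ge_0_int)
    have le_sq: "p \<le> p\<^sup>2" if "prime p" for p :: int
      using prime_gt_0_int[OF that] by (simp add: power2_eq_square)
    have SQ: "?PS \<subseteq> ?PQ" using le_sq order_trans by blast
    have finS: "finite ?PS" using SQ finQ by (rule finite_subset)
    have "?PS \<subseteq> {1..\<lfloor>sqrt (real Q)\<rfloor>}"
    proof
      fix p assume "p \<in> ?PS"
      then have "prime p" "real_of_int (p\<^sup>2) \<le> real Q" by (simp, simp only: mem_Collect_eq, linarith)
      then have "prime p" "real_of_int p ^ 2 \<le> real Q" by simp_all
      then show "p \<in> {1..\<lfloor>sqrt (real Q)\<rfloor>}"
        using prime_gt_0_int[of p] by (auto simp: le_floor_iff intro: real_le_rsqrt)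
    qed
    then have "card ?PS \<le> card {1..\<lfloor>sqrt (real Q)\<rfloor>}" by (intro card_mono) auto
    then have "card ?PS \<le> nat \<lfloor>sqrt (real Q)\<rfloor>" by simp
    then have "real (card ?PS) \<le> real (nat \<lfloor>sqrt (real Q)\<rfloor>)" by (rule of_nat_mono)
    also have "\<dots> \<le> sqrt (real Q)" by (rule of_nat_floor) simp
    finally have cS: "real (card ?PS) \<le> sqrt (real Q)" .
    have term_le: "real_of_int (p ^ (R p - 1)) \<le> (if p \<in> ?PQ then real_of_int p else 1) * (if p \<in> ?PS then real Q ^ R0 else 1)"
      if p: "p \<in> P" for p
    proof -
      have pp: "prime p" using p by (simp add: P_def)
      have p1: "real_of_int p \<ge> 1" using prime_gt_0_int[OF pp] by simp
      show ?thesis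
      proof (cases "p\<^sup>2 \<le> int Q")
        case True
        then have pQ: "p \<le> int Q" using le_sq[OF pp] by linarith
        then have pQ': "real_of_int p \<le> real Q" by linarith
        have "real_of_int (p ^ (R p - 1)) = real_of_int p ^ (R0 - 1)" using True by (simp add: R_def)
        also have "\<dots> \<le> real_of_int p ^ R0" using p1 by (intro power_increasing) auto
        also have "\<dots> \<le> 1 * real Q ^ R0" using pQ' p1 by (auto intro!: power_mono)
        also have "\<dots> \<le> real_of_int p * real Q ^ R0" using p1 by (intro mult_right_mono) auto
        finally show ?thesis using True pQ pp by simp
      next
        case False
        then show ?thesis using pp p1 by (simp add: R_def)
      qed
    qed
    have "real_of_int (\<Prod>p\<in>P. p ^ (R p - 1)) \<le> (\<Prod>p\<in>P. (if p \<in> ?PQ then real_of_int p else 1) * (if p \<in> ?PS then real Q ^ R0 else 1))"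
      unfolding of_int_prod using term_le by (intro prod_mono) (auto simp: P_def prime_ge_0_int)
    also have "\<dots> = (\<Prod>p\<in>P \<inter> ?PQ. real_of_int p) * (\<Prod>p\<in>P \<inter> ?PS. real Q ^ R0)"
      using finP by (simp only: prod.distrib prod.inter_restrict)
    also have "\<dots> \<le> (\<Prod>p\<in>?PQ. real_of_int p) * (\<Prod>p\<in>?PS. real Q ^ R0)"
    proof (intro mult_mono prod_mono2)
      show "1 \<le> real_of_int b" if "b \<in> ?PQ - P \<inter> ?PQ" for b using that prime_gt_0_int[of b] by auto
      show "0 \<le> real_of_int b" if "b \<in> P \<inter> ?PQ" for b using that prime_ge_0_int[of b] by auto
    qed (use finQ finS Q1 prime_ge_0_int in \<open>auto intro!: prod_nonneg one_le_power\<close>)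
    also have "\<dots> = (\<Prod>p\<in>?PQ. real_of_int p) * real Q ^ (R0 * card ?PS)" by (simp add: power_mult)
    also have "\<dots> \<le> 4 ^ Q * exp (12 * real Q)"
    proof (intro mult_mono primorial_int_le)
      \<comment> \<open>The exponents balance as 1/3 + 1/2 + 1/6 = 1: number of exponents
        \<open>Q^(1/k)\<close> with \<open>1/k \<le> 1/3\<close>, number of primes
        \<open>Q^(1/2)\<close>, and \<open>ln Q \<le> 6 * Q^(1/6)\<close>. The 12 obtained here and
        the 2 from \<open>4 ^ Q \<le> exp (2 * Q)\<close> make the 14.\<close>
      have e1: "real (R0 * card ?PS) \<le> 2 * real Q powr (1 / real k) * real Q powr (1 / 2)"
        using R0 cS Q1 by (simp only: of_nat_mult) (intro mult_mono; simp add: powr_half_sqrt)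
      have e2: "ln (real Q) \<le> 6 * real Q powr (1 / 6)" using ln_powr_bound[of "real Q" "1 / 6"] Q1 by simp
      have e3: "real Q powr (1 / real k) \<le> real Q powr (1 / 3)" using Q1 k by (intro powr_mono) (auto simp: field_simps)
      have "real (R0 * card ?PS) * ln (real Q) \<le> (2 * real Q powr (1 / real k) * real Q powr (1 / 2)) * (6 * real Q powr (1 / 6))"
        using e1 e2 Q1 by (intro mult_mono) auto
      also have "\<dots> \<le> (2 * real Q powr (1 / 3) * real Q powr (1 / 2)) * (6 * real Q powr (1 / 6))"
        using e3 by (intro mult_right_mono mult_left_mono) auto
      also have "\<dots> = 12 * (real Q powr (1 / 3) * real Q powr (1 / 2) * real Q powr (1 / 6))" by simp
      also have "real Q powr (1 / 3) * real Q powr (1 / 2) * real Q powr (1 / 6) = real Q"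
        unfolding powr_add[symmetric] using Q1 by simp
      finally have "real (R0 * card ?PS) * ln (real Q) \<le> 12 * real Q" .
      moreover have "exp (real n * ln (real Q)) = real Q ^ n" for n using Q1 by (simp add: exp_of_nat_mult)
      ultimately show "real Q ^ (R0 * card ?PS) \<le> exp (12 * real Q)" by (metis exp_le_cancel_iff)
    qed (use Q1 in auto)
    also have "(4::real) ^ Q \<le> exp (2 * real Q)"
    proof -
      have "(4::real) \<le> exp 2" using exp_ge_add_one_self[of "1::real"] exp_add[of "1::real" 1] mult_mono[of 2 "exp 1" 2 "exp (1::real)"] by simp
      then have "(4::real) ^ Q \<le> exp 2 ^ Q" by (intro power_mono) auto
      then show ?thesis by (simp add: exp_of_nat_mult[symmetric] mult.commute)
    qed
    finally show ?thesis by (simp add: exp_add[symmetric])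
  qed
  show ?thesis
  proof (rule exI[of _ D], rule exI[of _ w], intro conjI ballI allI impI)
    fix d assume d: "d \<in> D"
    then have "d \<le> (\<Prod>p\<in>P. p ^ (R p - 1))" using D(2) by blast
    then have "real_of_int d \<le> real_of_int (\<Prod>p\<in>P. p ^ (R p - 1))" by (simp only: of_int_le_iff)
    then show "real_of_int d \<le> exp (14 * real Q)" using bound by linarith
    show "1 \<le> d" "0 \<le> w d" using D(2) d by auto
  next
    fix q a :: int assume q: "q \<ge> 1" "q \<le> Y" and a: "coprime a q"
    have "p \<in> P" if "prime p" "p dvd q" for p
      using zdvd_imp_le[OF that(2)] q that by (auto simp: P_def)
    then have "- \<epsilon> \<le> (\<Sum>d\<in>D. w d * S d a q)" using D(4) q(1) a by blast
    then show "- (C1 * real Q powr (- (1 / real k))) \<le> (\<Sum>d\<in>D. w d * S d a q)" by (simp only: \<epsilon>_def)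
  qed (use D in auto)
qed

end

section \<open>Smoothly weighted sums\<close>

lemma norm_ee_minus_one_le: "norm (ee t - 1) \<le> 8 * \<bar>t\<bar>"
proof -
  have "(norm (ee t - 1))\<^sup>2 = (cos (2*pi*t) - 1)\<^sup>2 + (sin (2*pi*t))\<^sup>2"
    by (simp add: ee_def cmod_power2)
  also have "\<dots> = 2 - 2 * cos (2 * (pi * t))"
    using sin_cos_squared_add[of "2*pi*t"] by (simp add: power2_eq_square algebra_simps)
  also have "\<dots> = (2 * sin (pi * t))\<^sup>2"
    by (simp add: cos_double_sin[of "pi * t"] power2_eq_square)
  also have "\<dots> \<le> (8 * \<bar>t\<bar>)\<^sup>2"
  proof (rule power2_le_iff_abs_le[THEN iffD2])
    have "\<bar>sin (pi * t)\<bar> \<le> \<bar>pi * t\<bar>" by (rule abs_sin_x_le_abs_x)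
    also have "\<dots> \<le> 4 * \<bar>t\<bar>" using pi_less_4 by (simp add: abs_mult mult_right_mono)
    finally show "\<bar>2 * sin (pi * t)\<bar> \<le> 8 * \<bar>t\<bar>" by simp
  qed simp
  finally show ?thesis by (rule power2_le_imp_le) simp
qed

lemma summation_by_parts:
  fixes F c :: "nat \<Rightarrow> complex"
  assumes "m \<le> n"
  shows "(\<Sum>j=m..n. F j * c j) = F n * (\<Sum>j=m..n. c j) - (\<Sum>j=m..<n. (F (Suc j) - F j) * (\<Sum>i=m..j. c i))"
  using assms
proof (induction n rule: dec_induct)
  case base
  then show ?case by simp
next
  case (step n)
  then show ?case by (simp add: sum.atLeastLessThan_Suc algebra_simps)
qed

lemma norm_summation_by_parts:
  fixes F c :: "nat \<Rightarrow> complex"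
  assumes mn: "m \<le> n" and A: "\<And>i. m \<le> i \<Longrightarrow> i \<le> n \<Longrightarrow> norm (\<Sum>j=m..i. c j) \<le> A"
    and F: "norm (F n) \<le> M" and dF: "\<And>j. m \<le> j \<Longrightarrow> j < n \<Longrightarrow> norm (F (Suc j) - F j) \<le> \<delta>"
    and pos: "A \<ge> 0" "\<delta> \<ge> 0"
  shows "norm (\<Sum>j=m..n. F j * c j) \<le> A * (M + real n * \<delta>)"
proof -
  have "norm (\<Sum>j=m..n. F j * c j) \<le> norm (F n * (\<Sum>j=m..n. c j)) + norm (\<Sum>j=m..<n. (F (Suc j) - F j) * (\<Sum>i=m..j. c i))"
    unfolding summation_by_parts[OF mn] by (rule norm_triangle_ineq4)
  also have "norm (F n * (\<Sum>j=m..n. c j)) \<le> M * A"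
    unfolding norm_mult using F A[OF mn] pos order_trans[OF norm_ge_zero F] by (intro mult_mono) auto
  also have "norm (\<Sum>j=m..<n. (F (Suc j) - F j) * (\<Sum>i=m..j. c i)) \<le> (\<Sum>j=m..<n. \<delta> * A)"
    using dF A pos by (intro sum_norm_le) (auto simp: norm_mult intro!: mult_mono)
  also have "\<dots> \<le> real n * (\<delta> * A)" using pos by (simp add: mult_right_mono)
  finally show ?thesis by (simp add: algebra_simps)
qed

text \<open>Full periods cancel by the vanishing mean, leaving fewer than \<open>q\<close>
  terms.\<close>

lemma norm_periodic_sum_le:
  fixes c :: "int \<Rightarrow> complex" and q :: int
  assumes q: "q > 0" and per: "\<And>x y. [x = y] (mod q) \<Longrightarrow> c x = c y" and z: "(\<Sum>x\<in>{0..<q}. c x) = 0"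
    and b: "\<And>x. norm (c x) \<le> B"
  shows "norm (\<Sum>i<l. c (a + int i)) \<le> B * of_int q"
proof (induction l arbitrary: a rule: less_induct)
  case (less l)
  have B: "B \<ge> 0" using order_trans[OF norm_ge_zero b[of 0]] .
  show ?case
  proof (cases "int l < q")
    case True
    have "norm (\<Sum>i<l. c (a + int i)) \<le> (\<Sum>i<l. B)" by (intro sum_norm_le b)
    also have "\<dots> \<le> B * of_int q" using True B by (simp add: mult.commute mult_left_mono)
    finally show ?thesis .
  next
    case False
    define r where "r = nat q"
    have r: "int r = q" "r \<le> l" "r > 0" using False q by (auto simp: r_def)
    have "(\<Sum>i<l. c (a + int i)) = (\<Sum>i<r. c (a + int i)) + (\<Sum>i=r..<l. c (a + int i))"
      using r(2) by (metis atLeast0LessThan sum.atLeastLessThan_concat zero_le)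
    also have "(\<Sum>i=r..<l. c (a + int i)) = (\<Sum>i<l - r. c (a + int r + int i))"
      by (rule sum.reindex_bij_witness[of _ "\<lambda>i. i + r" "\<lambda>i. i - r"]) (auto simp: of_nat_diff algebra_simps)
    also have "(\<Sum>i<r. c (a + int i)) = (\<Sum>x\<in>{0..<q}. c (1 * x + a))"
      by (rule sum.reindex_bij_witness[of _ nat int]) (auto simp: r_def algebra_simps)
    also have "\<dots> = 0" using sum_mod_reindex[where F = c and q = q and u = 1 and c = a] q per z by simp
    finally have "(\<Sum>i<l. c (a + int i)) = (\<Sum>i<l - r. c (a + int r + int i))" by simp
    then show ?thesis using less[of "l - r" "a + int r"] r by simp
  qed
qed

text \<open>\<open>fejer N \<beta>\<close> is the integral of \<open>(1 - t/N) cos (2 \<pi> \<beta> t)\<close> over \<open>[0, N]\<close>.\<close>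

definition fejer :: "real \<Rightarrow> real \<Rightarrow> real" where
  "fejer N \<beta> = (if \<beta> = 0 then N / 2 else (1 - cos (2 * pi * \<beta> * N)) / (N * (2 * pi * \<beta>)\<^sup>2))"

text \<open>With an antiderivative at hand, the mean value theorem suffices for comparing sums with
  the integral. \<open>H\<close> comes from integration by parts.\<close>

lemma fejer_antiderivative:
  assumes "N > 0"
  shows "\<exists>H. (\<forall>t. (H has_real_derivative (1 - t / N) * cos (2 * pi * \<beta> * t)) (at t)) \<and> H N - H 0 = fejer N \<beta>"
proof (cases "\<beta> = 0")
  case True
  show ?thesis
    by (rule exI[of _ "\<lambda>t. t - t\<^sup>2 / (2 * N)"])
       (use assms True in \<open>auto intro!: derivative_eq_intros simp: fejer_def power2_eq_square field_simps\<close>)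
next
  case False
  define w where "w = 2 * pi * \<beta>"
  have w: "w \<noteq> 0" using False by (simp add: w_def)
  define H where "H = (\<lambda>t. (1 - t / N) * (sin (w * t) / w) - cos (w * t) / (N * w\<^sup>2))"
  have "(H has_real_derivative ((1 - t / N) * (cos (w * t)))) (at t)" for t
    unfolding H_def using w assms
    by (auto intro!: derivative_eq_intros simp: power2_eq_square field_simps)
  moreover have "H N - H 0 = fejer N \<beta>"
    using assms False by (simp add: H_def fejer_def w_def diff_divide_distrib)
  ultimately show ?thesis unfolding w_def by blast
qed

lemma fejer_bounds:
  assumes "N > 0"
  shows "0 \<le> fejer N \<beta>" "fejer N \<beta> \<le> N"
proof -
  show "0 \<le> fejer N \<beta>" using assms by (simp add: fejer_def)
  obtain H where H: "\<And>t. (H has_real_derivative (1 - t / N) * cos (2 * pi * \<beta> * t)) (at t)" "H N - H 0 = fejer N \<beta>"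
    using fejer_antiderivative[OF assms] by blast
  obtain z where z: "0 < z" "z < N" "H N - H 0 = (N - 0) * ((1 - z / N) * cos (2 * pi * \<beta> * z))"
    using MVT2[OF assms, of H "\<lambda>t. (1 - t / N) * cos (2 * pi * \<beta> * t)"] H(1) by blast
  have "(1 - z / N) * cos (2 * pi * \<beta> * z) \<le> 1 * 1"
  proof -
    have "0 \<le> 1 - z / N" "1 - z / N \<le> 1" using z assms by (auto simp: field_simps)
    note zN = this
    have "(1 - z / N) * cos (2 * pi * \<beta> * z) \<le> (1 - z / N) * 1" using zN by (intro mult_left_mono) auto
    also have "\<dots> \<le> 1 * 1" using zN by simp
    finally show ?thesis .
  qed
  then have "N * ((1 - z / N) * cos (2 * pi * \<beta> * z)) \<le> N * 1" using assms by (intro mult_left_mono) auto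
  then show "fejer N \<beta> \<le> N" using z H(2) by simp
qed

text \<open>The increments of \<open>u\<close> turn the sum into a Riemann sum in the variable \<open>u\<close>, whose limit is the same for all sequences.\<close>

definition incr_weight :: "(nat \<Rightarrow> real) \<Rightarrow> real \<Rightarrow> nat \<Rightarrow> real" where
  "incr_weight u N j = (u (Suc j) - u j) * (1 - u j / N)"

text \<open>Models the sequence \<open>g (d * j)\<close> up to height \<open>N\<close>, with the
  dependence on \<open>g\<close> in the single constant \<open>L\<close>, so that errors are uniform
  in \<open>d\<close>. First and second differences have the sizes \<open>N / n\<close> and
  \<open>N / n^2\<close> expected of a polynomial; \<open>L \<le> n\<close> keeps the last step
  inside \<open>[0, 2 * N]\<close>.\<close>

locale weighted_seq =
  fixes u :: "nat \<Rightarrow> real" and m n :: nat and N L :: real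
  assumes mn: "m \<ge> 1" "m \<le> n" and L: "L \<ge> 1" and N: "N > 0" and nL: "L \<le> real n"
    and um: "0 \<le> u m" and mono: "\<And>j. m \<le> j \<Longrightarrow> j \<le> n \<Longrightarrow> u j \<le> u (Suc j)"
    and un: "u n \<le> N" "N \<le> u (Suc n)"
    and D1: "\<And>j. m \<le> j \<Longrightarrow> j \<le> n \<Longrightarrow> u (Suc j) - u j \<le> L * N / real n"
    and D2: "\<And>j. m \<le> j \<Longrightarrow> j < n \<Longrightarrow> \<bar>u (Suc (Suc j)) - 2 * u (Suc j) + u j\<bar> \<le> L * N / (real n)\<^sup>2"
begin

abbreviation wt :: "nat \<Rightarrow> real" where
  "wt \<equiv> incr_weight u N"

lemma n_pos: "real n \<ge> 1" using mn by simp

lemma u_range: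
  assumes "m \<le> j" "j \<le> n"
  shows "0 \<le> u j" "u j \<le> N"
proof -
  have inc: "u i \<le> u j" if "m \<le> i" "i \<le> j" "j \<le> n" for i j
    using that(2,3)
  proof (induction j rule: dec_induct)
    case (step k)
    then show ?case using mono[of k] that(1) by simp
  qed simp
  show "0 \<le> u j" using inc[of m j] assms um by simp
  show "u j \<le> N" using inc[of j n] assms un by simp
qed

lemma wt_bounds:
  assumes "m \<le> j" "j \<le> n"
  shows "0 \<le> wt j" "wt j \<le> L * N / real n"
proof -
  have 1: "0 \<le> 1 - u j / N" "1 - u j / N \<le> 1" using u_range[OF assms] N by (auto simp: field_simps)
  show "0 \<le> wt j" unfolding incr_weight_def using mono[OF assms] 1 by simp
  have "wt j \<le> (u (Suc j) - u j) * 1" unfolding incr_weight_def using mono[OF assms] 1 by (intro mult_left_mono) auto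
  then show "wt j \<le> L * N / real n" using D1[OF assms] by simp
qed

text \<open>The weight changes through the second differences of \<open>u\<close> and through the
  drop of \<open>1 - u / N\<close>; the phase moves by \<open>\<beta>\<close> times one
  step.\<close>

lemma phase_diff:
  assumes j: "m \<le> j" "j < n"
  shows "norm (of_real (wt (Suc j)) * ee (\<beta> * u (Suc j)) - of_real (wt j) * ee (\<beta> * u j)) \<le>
         10 * L\<^sup>2 * (1 + \<bar>\<beta>\<bar> * N) * N / (real n)\<^sup>2"
proof -
  let ?d = "\<lambda>j. u (Suc j) - u j"
  have d: "0 \<le> ?d j" "?d j \<le> L * N / real n" using mono D1 j by auto
  have r: "0 \<le> 1 - u (Suc j) / N" "1 - u (Suc j) / N \<le> 1" using u_range[of "Suc j"] j N by (auto simp: field_simps)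
  have "wt (Suc j) - wt j = (?d (Suc j) - ?d j) * (1 - u (Suc j) / N) - ?d j * (?d j / N)"
    using N by (simp add: incr_weight_def field_simps)
  also have "\<bar>\<dots>\<bar> \<le> \<bar>?d (Suc j) - ?d j\<bar> * \<bar>1 - u (Suc j) / N\<bar> + \<bar>?d j\<bar> * (\<bar>?d j\<bar> / N)"
    using N abs_triangle_ineq4[of "(?d (Suc j) - ?d j) * (1 - u (Suc j) / N)" "?d j * (?d j / N)"] by (simp add: abs_mult)
  also have "\<dots> \<le> L * N / (real n)\<^sup>2 * 1 + (L * N / real n) * ((L * N / real n) / N)"
    using D2[OF j] d r N L by (intro add_mono mult_mono divide_right_mono) (auto simp: algebra_simps)
  also have "\<dots> = (L + L\<^sup>2) * (N / (real n)\<^sup>2)" using N by (simp add: power2_eq_square add_divide_distrib distrib_right)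
  finally have w: "\<bar>wt (Suc j) - wt j\<bar> \<le> (L + L\<^sup>2) * (N / (real n)\<^sup>2)" .
  have "norm (ee (\<beta> * u (Suc j)) - ee (\<beta> * u j)) = norm (ee (\<beta> * u j) * (ee (\<beta> * ?d j) - 1))"
    by (simp add: algebra_simps flip: ee_add)
  also have "\<dots> \<le> 8 * \<bar>\<beta> * ?d j\<bar>" unfolding norm_mult norm_ee mult_1 by (rule norm_ee_minus_one_le)
  also have "\<dots> \<le> 8 * (\<bar>\<beta>\<bar> * (L * N / real n))" using d unfolding abs_mult by (intro mult_left_mono) auto
  finally have e: "norm (ee (\<beta> * u (Suc j)) - ee (\<beta> * u j)) \<le> 8 * (\<bar>\<beta>\<bar> * (L * N / real n))" .
  have "of_real (wt (Suc j)) * ee (\<beta> * u (Suc j)) - of_real (wt j) * ee (\<beta> * u j) =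
      of_real (wt (Suc j) - wt j) * ee (\<beta> * u (Suc j)) + of_real (wt j) * (ee (\<beta> * u (Suc j)) - ee (\<beta> * u j))"
    by (simp add: algebra_simps)
  also have "norm \<dots> \<le> \<bar>wt (Suc j) - wt j\<bar> + wt j * norm (ee (\<beta> * u (Suc j)) - ee (\<beta> * u j))"
    using wt_bounds[of j] j by (intro order_trans[OF norm_triangle_ineq]) (simp add: norm_mult del: of_real_diff)
  also have "\<dots> \<le> (L + L\<^sup>2) * (N / (real n)\<^sup>2) + (L * N / real n) * (8 * (\<bar>\<beta>\<bar> * (L * N / real n)))"
    using w e wt_bounds[of j] j by (intro add_mono mult_mono) auto
  also have "(L * N / real n) * (8 * (\<bar>\<beta>\<bar> * (L * N / real n))) = (8 * L\<^sup>2 * (\<bar>\<beta>\<bar> * N)) * (N / (real n)\<^sup>2)"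
    by (simp add: power2_eq_square)
  also have "(L + L\<^sup>2) * (N / (real n)\<^sup>2) + (8 * L\<^sup>2 * (\<bar>\<beta>\<bar> * N)) * (N / (real n)\<^sup>2) = ((L + L\<^sup>2) + 8 * L\<^sup>2 * (\<bar>\<beta>\<bar> * N)) * (N / (real n)\<^sup>2)"
    by (simp only: distrib_right)
  also have "\<dots> \<le> (10 * L\<^sup>2 * (1 + \<bar>\<beta>\<bar> * N)) * (N / (real n)\<^sup>2)"
  proof (rule mult_right_mono)
    have "L \<le> L\<^sup>2" using L by (simp add: power2_eq_square)
    moreover have "0 \<le> L\<^sup>2 * (\<bar>\<beta>\<bar> * N)" using N by simp
    moreover have "10 * L\<^sup>2 * (1 + \<bar>\<beta>\<bar> * N) = 10 * L\<^sup>2 + 10 * (L\<^sup>2 * (\<bar>\<beta>\<bar> * N))" by (simp add: algebra_simps)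
    ultimately show "(L + L\<^sup>2) + 8 * L\<^sup>2 * (\<bar>\<beta>\<bar> * N) \<le> 10 * L\<^sup>2 * (1 + \<bar>\<beta>\<bar> * N)"
      using L mult.assoc[of 8 "L\<^sup>2" "\<bar>\<beta>\<bar> * N"] by linarith
  qed (use N in simp)
  finally show ?thesis by simp
qed

text \<open>Partial summation carries bounds for the plain sums of \<open>c\<close> over to the
  smooth weights. On major arcs \<open>c\<close> will be a periodic factor with mean 0; on minor
  arcs \<open>\<beta> = 0\<close> and \<open>c\<close> is the exponential itself.\<close>

lemma weighted_sum_bound:
  fixes c :: "nat \<Rightarrow> complex"
  assumes A: "\<And>i. m \<le> i \<Longrightarrow> i \<le> n \<Longrightarrow> norm (\<Sum>j=m..i. c j) \<le> A"
  shows "norm (\<Sum>j=m..n. of_real (wt j) * ee (\<beta> * u j) * c j) \<le> 11 * L\<^sup>2 * A * (1 + \<bar>\<beta>\<bar> * N) * N / real n"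
proof -
  have A0: "A \<ge> 0" using order_trans[OF norm_ge_zero A[of n]] mn by simp
  have LL: "L \<le> L\<^sup>2" using L by (simp add: power2_eq_square)
  have bN: "\<bar>\<beta>\<bar> * N \<ge> 0" using N by simp
  have "norm (\<Sum>j=m..n. (of_real (wt j) * ee (\<beta> * u j)) * c j) \<le> A * (L * N / real n + real n * (10 * L\<^sup>2 * (1 + \<bar>\<beta>\<bar> * N) * N / (real n)\<^sup>2))"
    by (rule norm_summation_by_parts[OF mn(2) A])
       (use wt_bounds[of n] mn phase_diff A0 N bN in \<open>auto simp: norm_mult\<close>)
  moreover have "L * N / real n + real n * (10 * L\<^sup>2 * (1 + \<bar>\<beta>\<bar> * N) * N / (real n)\<^sup>2) \<le> 11 * L\<^sup>2 * (1 + \<bar>\<beta>\<bar> * N) * N / real n"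
  proof -
    have "L\<^sup>2 * 1 \<le> L\<^sup>2 * (1 + \<bar>\<beta>\<bar> * N)" using bN by (intro mult_left_mono) auto
    then have "L + 10 * L\<^sup>2 * (1 + \<bar>\<beta>\<bar> * N) \<le> 11 * L\<^sup>2 * (1 + \<bar>\<beta>\<bar> * N)" using LL by linarith
    then have "(L + 10 * L\<^sup>2 * (1 + \<bar>\<beta>\<bar> * N)) * (N / real n) \<le> (11 * L\<^sup>2 * (1 + \<bar>\<beta>\<bar> * N)) * (N / real n)"
      using N by (intro mult_right_mono) auto
    moreover have "real n * (X / (real n)\<^sup>2) = X / real n" for X using n_pos by (simp add: power2_eq_square)
    ultimately show ?thesis by (simp add: distrib_right add_divide_distrib)
  qed
  ultimately have "norm (\<Sum>j=m..n. (of_real (wt j) * ee (\<beta> * u j)) * c j) \<le> A * (11 * L\<^sup>2 * (1 + \<bar>\<beta>\<bar> * N) * N / real n)"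
    using mult_left_mono[OF _ A0] order_trans by blast
  then show ?thesis by (simp only: mult_ac times_divide_eq_right times_divide_eq_left)
qed

text \<open>Each term is compared with the increment of the antiderivative over
  \<open>[u j, u (Suc j)]\<close>: the integrand varies by at most \<open>K\<close> on one step, and
  the steps add up to at most \<open>2 * N\<close>. The end pieces \<open>[0, u m]\<close> and
  \<open>[N, u (Suc n)]\<close> are estimated by their lengths.\<close>

lemma weighted_sum_fejer:
  "\<bar>Re (\<Sum>j=m..n. of_real (wt j) * ee (\<beta> * u j)) - fejer N \<beta>\<bar> \<le> 20 * L * (1 + \<bar>\<beta>\<bar> * N) * N / real n + u m"
proof -
  define w where "w = 2 * pi * \<beta>"
  define h where "h = (\<lambda>t. (1 - t / N) * cos (w * t))"
  obtain H where H: "\<And>t. (H has_real_derivative h t) (at t)" "H N - H 0 = fejer N \<beta>"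
    using fejer_antiderivative[OF N] unfolding h_def w_def by blast
  have dh: "(h has_real_derivative (- (1 / N) * cos (w * t) - (1 - t / N) * w * sin (w * t))) (at t)" for t
    unfolding h_def using N by (auto intro!: derivative_eq_intros simp: field_simps)
  have top: "u (Suc n) \<le> 2 * N"
  proof -
    have "L * N / real n \<le> N" using nL n_pos N by (simp add: field_simps)
    then show ?thesis using D1[of n] mn un by simp
  qed
  have h1: "\<bar>h t\<bar> \<le> 1" if "0 \<le> t" "t \<le> 2 * N" for t
  proof -
    have "\<bar>1 - t / N\<bar> \<le> 1" using that N by (auto simp: abs_le_iff field_simps)
    then have "\<bar>1 - t / N\<bar> * \<bar>cos (w * t)\<bar> \<le> 1 * 1" by (intro mult_mono) auto
    then show ?thesis by (simp add: h_def abs_mult)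
  qed
  have hd: "\<bar>h t - h s\<bar> \<le> (1 / N + \<bar>w\<bar>) * (t - s)" if "0 \<le> s" "s \<le> t" "t \<le> 2 * N" for s t
  proof (cases "s = t")
    case False
    then have "s < t" using that by simp
    then obtain z where z: "s < z" "z < t" "h t - h s = (t - s) * (- (1 / N) * cos (w * z) - (1 - z / N) * w * sin (w * z))"
      using MVT2[of s t h "\<lambda>t. - (1 / N) * cos (w * t) - (1 - t / N) * w * sin (w * t)"] dh by blast
    have "\<bar>1 - z / N\<bar> \<le> 1" using that z N by (auto simp: abs_le_iff field_simps)
    then have "\<bar>1 - z / N\<bar> * \<bar>w\<bar> * \<bar>sin (w * z)\<bar> \<le> 1 * \<bar>w\<bar> * 1" by (intro mult_mono) auto
    moreover have "\<bar>1 / N\<bar> * \<bar>cos (w * z)\<bar> \<le> 1 / N * 1" using N by (intro mult_mono) auto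
    ultimately have "\<bar>- (1 / N) * cos (w * z) - (1 - z / N) * w * sin (w * z)\<bar> \<le> 1 / N + \<bar>w\<bar>"
      using abs_triangle_ineq4[of "- (1 / N) * cos (w * z)" "(1 - z / N) * w * sin (w * z)"] by (simp add: abs_mult)
    then have "\<bar>t - s\<bar> * \<bar>- (1 / N) * cos (w * z) - (1 - z / N) * w * sin (w * z)\<bar> \<le> (t - s) * (1 / N + \<bar>w\<bar>)"
      using \<open>s < t\<close> by (intro mult_mono) auto
    then show ?thesis unfolding z(3) abs_mult by (simp only: mult.commute)
  qed simp
  have Hd: "\<bar>H t - H s\<bar> \<le> t - s" if "0 \<le> s" "s \<le> t" "t \<le> 2 * N" for s t
  proof (cases "s = t")
    case False
    then have "s < t" using that by simp
    then obtain z where z: "s < z" "z < t" "H t - H s = (t - s) * h z" using MVT2[of s t H h] H(1) by blast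
    have "\<bar>t - s\<bar> * \<bar>h z\<bar> \<le> (t - s) * 1" using z that h1[of z] \<open>s < t\<close> by (intro mult_mono) auto
    then show ?thesis unfolding z(3) abs_mult by simp
  qed simp
  let ?d = "\<lambda>j. u (Suc j) - u j"
  define K where "K = (1 / N + \<bar>w\<bar>) * (L * N / real n)"
  have K0: "K \<ge> 0" using N L by (simp add: K_def)
  have pt: "\<bar>?d j * h (u j) - (H (u (Suc j)) - H (u j))\<bar> \<le> K * ?d j" if j: "m \<le> j" "j \<le> n" for j
  proof (cases "u j = u (Suc j)")
    case False
    have Sj: "u (Suc j) \<le> 2 * N" using top u_range[of "Suc j"] j N by (cases "j = n") auto
    have uj: "0 \<le> u j" "u j < u (Suc j)" using mono[OF j] False u_range[OF j] by auto
    then obtain z where z: "u j < z" "z < u (Suc j)" "H (u (Suc j)) - H (u j) = ?d j * h z"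
      using MVT2[of "u j" "u (Suc j)" H h] H(1) by blast
    have "\<bar>h z - h (u j)\<bar> \<le> (1 / N + \<bar>w\<bar>) * (z - u j)" using hd uj z Sj by simp
    also have "\<dots> \<le> K" unfolding K_def using z D1[OF j] N by (intro mult_left_mono) auto
    finally have "\<bar>?d j\<bar> * \<bar>h (u j) - h z\<bar> \<le> ?d j * K" using uj by (intro mult_mono) auto
    moreover have "?d j * h (u j) - (H (u (Suc j)) - H (u j)) = ?d j * (h (u j) - h z)" unfolding z(3) by (simp add: algebra_simps)
    ultimately show ?thesis by (simp only: abs_mult mult.commute)
  qed simp
  have tel: "(\<Sum>j=m..n. f (Suc j) - f j) = f (Suc n) - f m" for f :: "nat \<Rightarrow> real"
    using mn by (simp add: sum_Suc_diff)
  have "Re (\<Sum>j=m..n. of_real (wt j) * ee (\<beta> * u j)) = (\<Sum>j=m..n. ?d j * h (u j))"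
    by (simp add: Re_ee incr_weight_def h_def w_def mult_ac)
  also have "\<dots> - (H (u (Suc n)) - H (u m)) = (\<Sum>j=m..n. ?d j * h (u j) - (H (u (Suc j)) - H (u j)))"
    using tel[of "\<lambda>j. H (u j)"] by (simp add: sum_subtractf)
  also have "\<bar>\<dots>\<bar> \<le> (\<Sum>j=m..n. K * ?d j)"
    by (rule order_trans[OF sum_abs]) (intro sum_mono pt; simp)
  also have "\<dots> = K * (u (Suc n) - u m)" using tel[of u] by (simp flip: sum_distrib_left)
  also have "\<dots> \<le> K * (2 * N)" using top um K0 by (intro mult_left_mono) auto
  finally have 1: "\<bar>Re (\<Sum>j=m..n. of_real (wt j) * ee (\<beta> * u j)) - (H (u (Suc n)) - H (u m))\<bar> \<le> K * (2 * N)" .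
  have 2: "\<bar>H (u (Suc n)) - H N\<bar> \<le> L * N / real n" using Hd[of N "u (Suc n)"] top un N D1[of n] mn by simp
  have 3: "\<bar>H (u m) - H 0\<bar> \<le> u m" using Hd[of 0 "u m"] um u_range[of m] mn N by simp
  have "\<bar>w\<bar> \<le> 8 * \<bar>\<beta>\<bar>" using pi_less_4 by (simp add: w_def abs_mult mult_right_mono)
  then have "K * (2 * N) \<le> (1 / N + 8 * \<bar>\<beta>\<bar>) * (L * N / real n) * (2 * N)"
    unfolding K_def using N L by (intro mult_right_mono) auto
  also have "\<dots> = ((1 / N + 8 * \<bar>\<beta>\<bar>) * (2 * N)) * (L * N / real n)" by (simp only: mult_ac)
  also have "(1 / N + 8 * \<bar>\<beta>\<bar>) * (2 * N) = 2 + 16 * (\<bar>\<beta>\<bar> * N)" using N by (simp add: distrib_right)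
  finally have "K * (2 * N) \<le> (2 + 16 * (\<bar>\<beta>\<bar> * N)) * (L * N / real n)" .
  moreover have three: "(3 + z) * r = (2 + z) * r + r" for z r :: real by (simp add: algebra_simps)
  ultimately have "K * (2 * N) + L * N / real n \<le> (3 + 16 * (\<bar>\<beta>\<bar> * N)) * (L * N / real n)"
    unfolding three by (intro add_right_mono)
  also have "\<dots> \<le> (20 * (1 + \<bar>\<beta>\<bar> * N)) * (L * N / real n)" using N L by (intro mult_right_mono) auto
  finally have "K * (2 * N) + L * N / real n \<le> 20 * L * (1 + \<bar>\<beta>\<bar> * N) * N / real n" by (simp add: mult_ac)
  then show ?thesis using 1 2 3 H(2) by linarith
qed

end

section \<open>Major and minor arcs\<close>

lemma poly_map_of_int: "poly (map_poly real_of_int p) (of_int x) = of_int (poly p x)"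
  by (induction p) (simp_all add: map_poly_pCons)

lemma poly_growth:
  fixes p :: "real poly"
  assumes "degree p \<le> n"
  shows "\<exists>B\<ge>0. \<forall>y\<ge>1. \<bar>poly p y\<bar> \<le> B * y ^ n"
proof (intro exI conjI allI impI)
  show "0 \<le> (\<Sum>i\<le>degree p. \<bar>coeff p i\<bar>)" by (simp add: sum_nonneg)
  fix y :: real assume y: "1 \<le> y"
  have "\<bar>poly p y\<bar> \<le> (\<Sum>i\<le>degree p. \<bar>coeff p i * y ^ i\<bar>)" unfolding poly_altdef by (rule sum_abs)
  also have "\<dots> \<le> (\<Sum>i\<le>degree p. \<bar>coeff p i\<bar> * y ^ n)"
    using y assms by (intro sum_mono) (auto simp: abs_mult intro!: mult_left_mono power_increasing)
  finally show "\<bar>poly p y\<bar> \<le> (\<Sum>i\<le>degree p. \<bar>coeff p i\<bar>) * y ^ n" by (simp add: sum_distrib_right)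
qed

context odd_form begin

definition G :: "real poly" where "G = map_poly real_of_int g"

lemma poly_G: "poly G (of_int x) = of_int (poly g x)"
  by (simp add: G_def poly_map_of_int)

lemma coeff_G: "coeff G i = of_int (coeff g i)"
  by (simp add: G_def coeff_map_poly)

lemma degree_G: "degree G = k"
  using deg by (simp add: G_def degree_map_poly)

text \<open>The mean value theorem, applied once and twice; the intermediate points stay below
  \<open>3 * y\<close>, hence the powers of 3. The explicit dependence on the step \<open>h\<close>
  is what makes the estimates uniform in the dilation.\<close>

lemma difference_bounds:
  "\<exists>B\<ge>1. \<forall>y\<ge>1. \<forall>h\<ge>0. h \<le> y \<longrightarrow> \<bar>poly G (y + h) - poly G y\<bar> \<le> B * (h * y ^ (k - 1)) \<and>
     \<bar>poly G (y + 2 * h) - 2 * poly G (y + h) + poly G y\<bar> \<le> B * (h\<^sup>2 * y ^ (k - 2)) \<and> \<bar>poly G y\<bar> \<le> B * y ^ k"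
proof -
  have dG: "degree (pderiv G) \<le> k - 1" "degree (pderiv (pderiv G)) \<le> k - 2"
    by (simp_all add: degree_pderiv degree_G)
  obtain B0 where B0: "B0 \<ge> 0" "\<And>y. y \<ge> 1 \<Longrightarrow> \<bar>poly G y\<bar> \<le> B0 * y ^ k"
    using poly_growth[of G k] degree_G by auto
  obtain B1 where B1: "B1 \<ge> 0" "\<And>y. y \<ge> 1 \<Longrightarrow> \<bar>poly (pderiv G) y\<bar> \<le> B1 * y ^ (k - 1)"
    using poly_growth[OF dG(1)] by auto
  obtain B2 where B2: "B2 \<ge> 0" "\<And>y. y \<ge> 1 \<Longrightarrow> \<bar>poly (pderiv (pderiv G)) y\<bar> \<le> B2 * y ^ (k - 2)"
    using poly_growth[OF dG(2)] by auto
  define B where "B = 1 + B0 + B1 * 3 ^ (k - 1) + B2 * 3 ^ (k - 2)"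
  have p1: "0 \<le> B1 * 3 ^ (k - 1)" "0 \<le> B2 * 3 ^ (k - 2)" using B1 B2 by auto
  have BB: "B \<ge> 1" "B1 * 3 ^ (k - 1) \<le> B" "B2 * 3 ^ (k - 2) \<le> B" "B0 \<le> B" using B0 p1 by (auto simp: B_def)
  have "\<bar>poly G (y + h) - poly G y\<bar> \<le> B * (h * y ^ (k - 1)) \<and>
     \<bar>poly G (y + 2 * h) - 2 * poly G (y + h) + poly G y\<bar> \<le> B * (h\<^sup>2 * y ^ (k - 2)) \<and> \<bar>poly G y\<bar> \<le> B * y ^ k"
    if y: "y \<ge> 1" and h: "h \<ge> 0" "h \<le> y" for y h
  proof (cases "h = 0")
    case True
    have "\<bar>poly G y\<bar> \<le> B * y ^ k" using y by (intro order_trans[OF B0(2)[OF y] mult_right_mono[OF BB(4)]]) auto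
    then show ?thesis using True by simp
  next
    case False
    then have hp: "h > 0" using h by simp
    have "\<bar>poly G y\<bar> \<le> B * y ^ k" using y by (intro order_trans[OF B0(2)[OF y] mult_right_mono[OF BB(4)]]) auto
    moreover have "\<bar>poly G (y + h) - poly G y\<bar> \<le> B * (h * y ^ (k - 1))"
    proof -
      obtain z where z: "y < z" "z < y + h" "poly G (y + h) - poly G y = (y + h - y) * poly (pderiv G) z"
        using poly_MVT[of y "y + h" G] hp by auto
      have "\<bar>poly (pderiv G) z\<bar> \<le> B1 * z ^ (k - 1)" using B1(2) y z by simp
      also have "\<dots> \<le> B1 * (3 * y) ^ (k - 1)" using z y h B1 by (intro mult_left_mono power_mono) auto
      also have "\<dots> = (B1 * 3 ^ (k - 1)) * y ^ (k - 1)" by (simp add: power_mult_distrib)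
      also have "\<dots> \<le> B * y ^ (k - 1)" using BB y by (intro mult_right_mono) auto
      finally have "h * \<bar>poly (pderiv G) z\<bar> \<le> h * (B * y ^ (k - 1))" using hp by (intro mult_left_mono) auto
      then show ?thesis unfolding z(3) using hp by (simp add: abs_mult mult_ac)
    qed
    moreover have "\<bar>poly G (y + 2 * h) - 2 * poly G (y + h) + poly G y\<bar> \<le> B * (h\<^sup>2 * y ^ (k - 2))"
    proof -
      define K where "K = pcompose G [:h, 1:] - G"
      have K: "poly K t = poly G (t + h) - poly G t" for t by (simp add: K_def poly_pcompose add.commute)
      have "pderiv K = pcompose (pderiv G) [:h, 1:] - pderiv G"
        by (simp add: K_def pderiv_diff pderiv_pcompose pderiv_pCons)
      then have dK: "poly (pderiv K) t = poly (pderiv G) (t + h) - poly (pderiv G) t" for t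
        by (simp add: poly_pcompose add.commute)
      obtain z where z: "y < z" "z < y + h" "poly K (y + h) - poly K y = (y + h - y) * poly (pderiv K) z"
        using poly_MVT[of y "y + h" K] hp by auto
      obtain z' where z': "z < z'" "z' < z + h" "poly (pderiv G) (z + h) - poly (pderiv G) z = (z + h - z) * poly (pderiv (pderiv G)) z'"
        using poly_MVT[of z "z + h" "pderiv G"] hp by auto
      have "\<bar>poly (pderiv (pderiv G)) z'\<bar> \<le> B2 * z' ^ (k - 2)" using B2(2) y z z' by simp
      also have "\<dots> \<le> B2 * (3 * y) ^ (k - 2)" using z z' y h B2 by (intro mult_left_mono power_mono) auto
      also have "\<dots> = (B2 * 3 ^ (k - 2)) * y ^ (k - 2)" by (simp add: power_mult_distrib)
      also have "\<dots> \<le> B * y ^ (k - 2)" using BB y by (intro mult_right_mono) auto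
      finally have b: "h\<^sup>2 * \<bar>poly (pderiv (pderiv G)) z'\<bar> \<le> h\<^sup>2 * (B * y ^ (k - 2))" by (intro mult_left_mono) auto
      have "poly G (y + 2 * h) - 2 * poly G (y + h) + poly G y = poly K (y + h) - poly K y"
      proof -
        have "y + 2 * h = (y + h) + h" by simp
        then show ?thesis by (simp only: K)
      qed
      also have "\<dots> = h\<^sup>2 * poly (pderiv (pderiv G)) z'" unfolding z(3) dK z'(3) by (simp add: power2_eq_square)
      finally show ?thesis using b by (simp add: abs_mult mult_ac)
    qed
    ultimately show ?thesis by blast
  qed
  then show ?thesis using BB(1) by blast
qed

text \<open>The leading coefficient is a positive integer, so subtracting half of
  \<open>y ^ k\<close> still leaves a positive one.\<close>

lemma eventually_increasing:
  "\<exists>X0::nat. X0 \<ge> 1 \<and> (\<forall>y\<ge>real X0. poly (pderiv G) y > 0 \<and> y ^ k / 2 \<le> poly G y)"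
proof -
  have ck: "coeff G k \<ge> 1" using lead by (simp add: coeff_G)
  define P where "P = G - monom (1 / 2) k"
  have cP: "coeff P k > 0" using ck by (simp add: P_def)
  have "degree P \<le> k" unfolding P_def by (intro degree_diff_le) (auto simp: degree_G degree_monom_le)
  then have "degree P = k" using cP le_degree[of P k] by force
  then have lP: "lead_coeff P > 0" using cP by simp
  obtain n1 where n1: "\<forall>x\<ge>n1. lead_coeff P \<le> poly P x" using poly_pinfty_gt_lc[OF lP] by blast
  have "lead_coeff (pderiv G) > 0" using ck k by (simp add: degree_pderiv degree_G coeff_pderiv)
  from poly_pinfty_gt_lc[OF this] this obtain n2 where n2: "\<forall>x\<ge>n2. 0 < poly (pderiv G) x" by (meson order_less_le_trans)
  obtain X0 :: nat where X0: "max (max n1 n2) 1 \<le> real X0" using real_arch_simple by blast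
  show ?thesis
  proof (intro exI[of _ X0] conjI allI impI)
    show "1 \<le> X0" using X0 by simp
    fix y assume y: "real X0 \<le> y"
    show "0 < poly (pderiv G) y" using n2 y X0 by simp
    have "lead_coeff P \<le> poly P y" using n1 y X0 by simp
    then have "0 \<le> poly P y" using lP by linarith
    then show "y ^ k / 2 \<le> poly G y" by (simp add: P_def poly_monom)
  qed
qed

definition dil_seq :: "int \<Rightarrow> nat \<Rightarrow> real" where
  "dil_seq d j = of_int (poly g (d * int j))"

text \<open>The constants do not depend on \<open>d\<close>: as \<open>d * j \<ge> j\<close>, the
  thresholds and growth bounds of \<open>G\<close> apply at the argument \<open>d * j\<close> with
  step \<open>d\<close>.\<close>

lemma dilation_sequences:
  "\<exists>L X0 c. L \<ge> 1 \<and> X0 \<ge> 1 \<and> c \<ge> 1 \<and> (\<forall>d\<ge>1. \<forall>j\<ge>X0. 0 < dil_seq d j) \<and>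
     (\<forall>d\<ge>1. dil_seq d X0 \<le> c * of_int d ^ k \<and> (\<forall>N. c * of_int d ^ k \<le> N \<longrightarrow>
        (\<exists>n. weighted_seq (dil_seq d) X0 n N L \<and> N \<le> c * (of_int d * real n) ^ k)))"
proof -
  obtain B where B: "B \<ge> 1" and Bd: "\<And>y h. y \<ge> 1 \<Longrightarrow> h \<ge> 0 \<Longrightarrow> h \<le> y \<Longrightarrow>
     \<bar>poly G (y + h) - poly G y\<bar> \<le> B * (h * y ^ (k - 1)) \<and>
     \<bar>poly G (y + 2 * h) - 2 * poly G (y + h) + poly G y\<bar> \<le> B * (h\<^sup>2 * y ^ (k - 2)) \<and> \<bar>poly G y\<bar> \<le> B * y ^ k"
    using difference_bounds by blast
  obtain X0 :: nat where X0: "X0 \<ge> 1" and inc: "\<And>y. y \<ge> real X0 \<Longrightarrow> poly (pderiv G) y > 0"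
     and low: "\<And>y. y \<ge> real X0 \<Longrightarrow> y ^ k / 2 \<le> poly G y" using eventually_increasing by blast
  define L where "L = 2 * B"
  \<comment> \<open>For the last index \<open>n\<close> one has
    \<open>N \<le> B * (2 * d * n)^k\<close>, so \<open>N \<ge> c * d^k\<close> forces
    \<open>n \<ge> L + X0\<close>.\<close>
  define c where "c = B * 2 ^ k * (L + real X0) ^ k"
  have L: "L \<ge> 2" using B by (simp add: L_def)
  have LX: "(L + real X0) ^ k \<ge> 1" using L by (intro one_le_power) auto
  have B2: "B * 2 ^ k \<ge> 1" using B mult_mono[of 1 B 1 "2 ^ k"] by (simp add: one_le_power)
  have c1: "c \<ge> 1" using mult_mono[OF B2 LX] B2 by (simp add: c_def)
  have u: "dil_seq d j = poly G (of_int d * real j)" for d j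
    using poly_G[of "d * int j"] by (simp add: dil_seq_def)
  have arg: "of_int d * real j \<ge> real j" if "d \<ge> 1" for d :: int and j :: nat
    using that mult_right_mono[of 1 "real_of_int d" "real j"] by simp
  have low': "(of_int d * real j) ^ k / 2 \<le> dil_seq d j" if "d \<ge> 1" "j \<ge> X0" for d j
    unfolding u using low[of "of_int d * real j"] arg[OF that(1), of j] that(2) by simp
  have pos: "0 < dil_seq d j" if "d \<ge> 1" "j \<ge> X0" for d j
  proof -
    have "0 < of_int d * real j" using that X0 by (intro mult_pos_pos) auto
    then have "0 < (of_int d * real j) ^ k / 2" by simp
    then show ?thesis using low'[OF that] by linarith
  qed
  have mono: "dil_seq d j \<le> dil_seq d (Suc j)" if "d \<ge> 1" "j \<ge> X0" for d j
  proof -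
    have lt: "of_int d * real j < of_int d * real (Suc j)" using that by simp
    obtain z where z: "of_int d * real j < z" "poly G (of_int d * real (Suc j)) - poly G (of_int d * real j) =
      (of_int d * real (Suc j) - of_int d * real j) * poly (pderiv G) z" using poly_MVT[OF lt, of G] by blast
    have "poly (pderiv G) z > 0" using inc[of z] arg[OF that(1), of j] that z by simp
    then have "0 \<le> (of_int d * real (Suc j) - of_int d * real j) * poly (pderiv G) z" using lt by simp
    then show ?thesis unfolding u using z(2) by linarith
  qed
  have up: "dil_seq d j \<le> B * (of_int d * real j) ^ k" if "d \<ge> 1" "j \<ge> 1" for d j
    unfolding u using Bd[of "of_int d * real j" 0] arg[OF that(1), of j] that by (simp add: abs_le_iff)
  have first: "dil_seq d X0 \<le> c * of_int d ^ k" if "d \<ge> 1" for d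
  proof -
    have "dil_seq d X0 \<le> B * 1 * real X0 ^ k * of_int d ^ k" using up[OF that X0] by (simp add: power_mult_distrib mult_ac)
    also have "\<dots> \<le> c * of_int d ^ k"
      unfolding c_def using B L that by (intro mult_right_mono mult_mono power_mono) (auto simp: one_le_power)
    finally show ?thesis .
  qed
  have "\<exists>n. weighted_seq (dil_seq d) X0 n N L \<and> N \<le> c * (of_int d * real n) ^ k"
    if d: "d \<ge> 1" and N: "c * of_int d ^ k \<le> N" for d N
  proof -
    have d1: "real_of_int d ^ k \<ge> 1" using d by (intro one_le_power) auto
    have N1: "N \<ge> 1" using N mult_mono[OF c1 d1] c1 by simp
    define P where "P = (\<lambda>j. X0 \<le> j \<and> N < dil_seq d (Suc j))"
    have "\<exists>j. P j"
    proof -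
      obtain j0 :: nat where j0: "2 * N < real j0" using reals_Archimedean2 by blast
      define j where "j = max j0 X0"
      have j: "2 * N < real (Suc j)" "X0 \<le> j" using j0 by (auto simp: j_def)
      have "real (Suc j) \<le> (of_int d * real (Suc j)) ^ 1" using arg[OF d, of "Suc j"] by simp
      also have "\<dots> \<le> (of_int d * real (Suc j)) ^ k"
      proof (rule power_increasing)
        have "1 \<le> real (Suc j)" by simp
        then show "1 \<le> of_int d * real (Suc j)" using arg[OF d, of "Suc j"] by linarith
      qed (use k in simp)
      finally show ?thesis using low'[OF d, of "Suc j"] j unfolding P_def by (intro exI[of _ j]) auto
    qed
    define n where "n = (LEAST j. P j)"
    have Pn: "P n" unfolding n_def using \<open>\<exists>j. P j\<close> by (rule LeastI_ex)
    then have n: "X0 \<le> n" "N < dil_seq d (Suc n)" by (auto simp: P_def)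
    have un: "dil_seq d n \<le> N"
    proof (cases "n = X0")
      case True
      then show ?thesis using first[OF d] N by simp
    next
      case False
      then have "n - 1 < n" "X0 \<le> n - 1" "Suc (n - 1) = n" using n X0 by auto
      moreover from this have "\<not> P (n - 1)" using not_less_Least n_def by metis
      ultimately show ?thesis by (simp add: P_def)
    qed
    have n1: "real n \<ge> 1" using n X0 by simp
    define Y where "Y = of_int d * real n"
    have Yn: "Y \<ge> 1" unfolding Y_def using arg[OF d, of n] n1 by linarith
    have YN: "Y ^ k \<le> 2 * N" using low'[OF d n(1)] un by (simp add: Y_def)
    have NY: "N \<le> B * 2 ^ k * Y ^ k"
    proof -
      have "N \<le> B * (of_int d * real (Suc n)) ^ k" using n(2) up[OF d, of "Suc n"] by simp
      also have "\<dots> \<le> B * (2 * Y) ^ k"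
        unfolding Y_def using B d n1 by (intro mult_left_mono power_mono) (auto simp: algebra_simps)
      finally show ?thesis by (simp add: power_mult_distrib)
    qed
    have "B * 2 ^ k * ((L + real X0) ^ k * of_int d ^ k) \<le> B * 2 ^ k * Y ^ k" using N NY by (simp add: c_def mult_ac)
    moreover have "0 < B * 2 ^ k" using B2 by linarith
    ultimately have "(L + real X0) ^ k * of_int d ^ k \<le> Y ^ k" using mult_le_cancel_left_pos by blast
    then have pw: "((L + real X0) * of_int d) ^ k \<le> Y ^ k" by (simp only: power_mult_distrib)
    have "(L + real X0) * of_int d \<le> Y"
    proof (rule ccontr)
      assume "\<not> ?thesis"
      then have "Y ^ k < ((L + real X0) * of_int d) ^ k" using Yn k by (intro power_strict_mono) auto
      then show False using pw by linarith
    qed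
    then have "of_int d * (L + real X0) \<le> of_int d * real n" unfolding Y_def by (simp only: mult.commute)
    moreover have "0 < real_of_int d" using d by simp
    ultimately have "L + real X0 \<le> real n" using mult_le_cancel_left_pos by blast
    then have Ln: "L \<le> real n" by simp
    have kk: "Y ^ k = Y ^ (k - 1) * Y" "Y ^ k = Y ^ (k - 2) * Y\<^sup>2"
    proof -
      have "k = (k - 1) + 1" "k = (k - 2) + 2" using k by auto
      then show "Y ^ k = Y ^ (k - 1) * Y" "Y ^ k = Y ^ (k - 2) * Y\<^sup>2" by (metis power_add power_one_right)+
    qed
    \<comment> \<open>With step \<open>d\<close> and arguments up to \<open>Y = d * n\<close>, the
      differences of order 1 and 2 are at most \<open>B\<close> times \<open>Y^k / n\<close> and
      \<open>Y^k / n^2\<close>, where \<open>Y^k \<le> 2 * N\<close>.\<close>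
    have step: "of_int d * Y ^ (k - 1) * real n = Y ^ k" "(of_int d)\<^sup>2 * Y ^ (k - 2) * (real n)\<^sup>2 = Y ^ k"
    proof -
      show "of_int d * Y ^ (k - 1) * real n = Y ^ k" unfolding kk(1) by (simp add: Y_def)
      show "(of_int d)\<^sup>2 * Y ^ (k - 2) * (real n)\<^sup>2 = Y ^ k" unfolding kk(2) by (simp add: Y_def power_mult_distrib)
    qed
    have step': "of_int d * Y ^ (k - 1) = Y ^ k / real n" "(of_int d)\<^sup>2 * Y ^ (k - 2) = Y ^ k / (real n)\<^sup>2"
      using step n1 by (simp_all add: eq_divide_eq)
    have "weighted_seq (dil_seq d) X0 n N L"
    proof
      show "1 \<le> X0" "X0 \<le> n" "1 \<le> L" "0 < N" "L \<le> real n" using X0 n L N1 Ln by auto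
      show "0 \<le> dil_seq d X0" using pos[OF d, of X0] by simp
      show "dil_seq d n \<le> N" "N \<le> dil_seq d (Suc n)" using un n by auto
      fix j assume j: "X0 \<le> j"
      show "dil_seq d j \<le> dil_seq d (Suc j)" by (rule mono[OF d j])
      have j1: "real j \<ge> 1" using j X0 by simp
      have yj: "of_int d * real j \<ge> 1" "of_int d * real j \<ge> of_int d"
        using arg[OF d, of j] j1 mult_left_mono[OF j1, of "of_int d"] d by linarith+
      have Suc1: "of_int d * real (Suc j) = of_int d * real j + of_int d" "of_int d * real (Suc (Suc j)) = of_int d * real j + 2 * of_int d"
        by (simp_all add: algebra_simps)
      have bd: "\<bar>dil_seq d (Suc j) - dil_seq d j\<bar> \<le> B * (of_int d * (of_int d * real j) ^ (k - 1))"
         "\<bar>dil_seq d (Suc (Suc j)) - 2 * dil_seq d (Suc j) + dil_seq d j\<bar> \<le> B * ((of_int d)\<^sup>2 * (of_int d * real j) ^ (k - 2))"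
        unfolding u Suc1 using Bd[of "of_int d * real j" "of_int d"] yj d by auto
      have jY: "of_int d * real j \<le> Y" if "j \<le> n" using that d by (simp add: Y_def)
      show "dil_seq d (Suc j) - dil_seq d j \<le> L * N / real n" if jn: "j \<le> n"
      proof -
        have "dil_seq d (Suc j) - dil_seq d j \<le> B * (of_int d * Y ^ (k - 1))"
          using bd(1) jY[OF jn] yj d B by (intro order_trans[OF abs_ge_self order_trans[OF bd(1)]] mult_left_mono power_mono) auto
        also have "\<dots> = B * Y ^ k / real n" by (simp only: step' times_divide_eq_right)
        also have "\<dots> \<le> B * (2 * N) / real n" using YN B by (intro divide_right_mono mult_left_mono) auto
        finally show ?thesis by (simp add: L_def mult_ac)
      qed
      show "\<bar>dil_seq d (Suc (Suc j)) - 2 * dil_seq d (Suc j) + dil_seq d j\<bar> \<le> L * N / (real n)\<^sup>2" if jn: "j < n"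
      proof -
        have "\<bar>dil_seq d (Suc (Suc j)) - 2 * dil_seq d (Suc j) + dil_seq d j\<bar> \<le> B * ((of_int d)\<^sup>2 * Y ^ (k - 2))"
          using jY jn yj d B by (intro order_trans[OF bd(2)] mult_left_mono power_mono) auto
        also have "\<dots> = B * Y ^ k / (real n)\<^sup>2" by (simp only: step' times_divide_eq_right)
        also have "\<dots> \<le> B * (2 * N) / (real n)\<^sup>2" using YN B by (intro divide_right_mono mult_left_mono) auto
        finally show ?thesis by (simp add: L_def mult_ac)
      qed
    qed
    moreover have "N \<le> c * (of_int d * real n) ^ k"
    proof -
      have "B * 2 ^ k * 1 * Y ^ k \<le> c * Y ^ k" unfolding c_def using B LX Yn by (intro mult_right_mono mult_left_mono) auto
      then show ?thesis using NY by (simp add: Y_def)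
    qed
    ultimately show ?thesis by blast
  qed
  then show ?thesis using L X0 c1 pos first
    by (intro exI[of _ L] exI[of _ X0] exI[of _ c]) auto
qed

text \<open>Modulo \<open>q\<close> the values \<open>g (d * j)\<close> are periodic in
  \<open>j\<close>. The exponential minus its mean \<open>S d a q\<close> sums to 0 over a period
  and has norm at most 2, so its partial sums are at most \<open>2 * q\<close>.\<close>

lemma major_arc:
  assumes ws: "weighted_seq (dil_seq d) m n N L" and q: "q \<ge> 1" and x: "x = of_int a / of_int q + \<beta>"
  shows "norm ((\<Sum>j=m..n. of_real (incr_weight (dil_seq d) N j) * ee (x * dil_seq d j)) -
     of_real (S d a q) * (\<Sum>j=m..n. of_real (incr_weight (dil_seq d) N j) * ee (\<beta> * dil_seq d j)))
     \<le> 11 * L\<^sup>2 * (2 * of_int q) * (1 + \<bar>\<beta>\<bar> * N) * N / real n"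
proof -
  interpret weighted_seq "dil_seq d" m n N L by (rule ws)
  define c where "c = (\<lambda>x. ee (of_int (a * poly g (d * x)) / of_int q) - of_real (S d a q))"
  have eq: "ee (x * dil_seq d j) = ee (\<beta> * dil_seq d j) * ee (of_int (a * poly g (d * int j)) / of_int q)" for j
    unfolding ee_add[symmetric] x dil_seq_def by (simp add: algebra_simps)
  have "(\<Sum>j=m..n. of_real (incr_weight (dil_seq d) N j) * ee (x * dil_seq d j)) -
     of_real (S d a q) * (\<Sum>j=m..n. of_real (incr_weight (dil_seq d) N j) * ee (\<beta> * dil_seq d j)) =
     (\<Sum>j=m..n. of_real (incr_weight (dil_seq d) N j) * ee (\<beta> * dil_seq d j) * c (int j))"
    by (simp add: sum_distrib_left eq c_def right_diff_distrib mult_ac flip: sum_subtractf)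
  also have "norm \<dots> \<le> 11 * L\<^sup>2 * (2 * of_int q) * (1 + \<bar>\<beta>\<bar> * N) * N / real n"
  proof (rule weighted_sum_bound)
    fix i assume i: "m \<le> i"
    have "(\<Sum>j=m..i. c (int j)) = (\<Sum>t<Suc i - m. c (int m + int t))"
      by (rule sum.reindex_bij_witness[of _ "\<lambda>t. m + t" "\<lambda>j. j - m"]) (auto simp: of_nat_diff)
    also have "norm \<dots> \<le> 2 * of_int q"
    proof (rule norm_periodic_sum_le)
      show "(\<Sum>x\<in>{0..<q}. c x) = 0"
        using csum_eq_S[of q a d] q by (simp add: c_def sum_subtractf csum_def)
      show "norm (c x) \<le> 2" for x
      proof -
        have "norm (c x) \<le> 1 + \<bar>S d a q\<bar>" unfolding c_def by (rule order_trans[OF norm_triangle_ineq4]) simp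
        then show ?thesis using abs_S_le_1[of q d a] q by simp
      qed
      show "c x = c y" if "[x = y] (mod q)" for x y
        unfolding c_def using that by (intro arg_cong2[of _ _ _ _ "(-)"] ee_cong_mod cong_mult poly_cong_int cong_refl refl)
    qed (use q in simp)
    finally show "norm (\<Sum>j=m..i. c (int j)) \<le> 2 * of_int q" .
  qed
  finally show ?thesis .
qed

text \<open>Either every initial sum is at most \<open>n / Z\<close>, and partial summation carries
  this to the weights, or Weyl's inequality turns one large initial sum into a rational
  approximation. \<open>Y\<close> is free above its lower bounds, so that a single value can serve
  all dilations.\<close>

lemma minor_arc:
  "\<exists>C::nat. C \<ge> 1 \<and> (\<forall>d m n N L c x Z Y. weighted_seq (dil_seq d) m n N L \<longrightarrow> d \<ge> 1 \<longrightarrow> N \<le> c * (of_int d * real n) ^ k \<longrightarrow> Z \<ge> 1 \<longrightarrow>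
     real C * Z ^ C * of_int (coeff g k * d ^ k) \<le> Y \<longrightarrow> real C * Z ^ C * c \<le> Y \<longrightarrow>
     norm (\<Sum>j=m..n. of_real (incr_weight (dil_seq d) N j) * ee (x * dil_seq d j)) \<le> 11 * L\<^sup>2 * N / Z \<or>
     (\<exists>a q::int. 1 \<le> q \<and> of_int q \<le> Y \<and> coprime a q \<and> \<bar>x - of_int a / of_int q\<bar> * N \<le> Y))"
proof -
  have k1: "Suc (k - 1) = k" using k by simp
  obtain C :: nat where C: "C \<ge> 1" and W: "\<And>\<theta> \<phi> X l Z m. pphase k \<theta> \<phi> \<Longrightarrow> l \<le> X \<Longrightarrow> X \<ge> 1 \<Longrightarrow> Z \<ge> 1 \<Longrightarrow>
     real X \<le> Z * norm (\<Sum>i<l. ee (\<phi> (m + int i))) \<Longrightarrow>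
     (\<exists>q::nat. q \<ge> 1 \<and> real q \<le> real C * Z ^ C \<and>
        (\<exists>a::int. \<bar>real q * \<theta> - of_int a\<bar> * real X ^ k \<le> real C * Z ^ C))"
    using weyl[of "k - 1"] unfolding k1 by blast
  show ?thesis
  proof (rule exI[of _ C], intro conjI allI impI, rule C)
    fix d m n N L c x Z Y
    assume ws: "weighted_seq (dil_seq d) m n N L" and d: "d \<ge> 1" and Nc: "N \<le> c * (of_int d * real n) ^ k" and Z: "Z \<ge> 1"
      and Y1: "real C * Z ^ C * of_int (coeff g k * d ^ k) \<le> Y" and Y2: "real C * Z ^ C * c \<le> Y"
    interpret weighted_seq "dil_seq d" m n N L by (rule ws)
    define K where "K = real C * Z ^ C"
    have K: "K \<ge> 0" using Z by (simp add: K_def)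
    show "norm (\<Sum>j=m..n. of_real (incr_weight (dil_seq d) N j) * ee (x * dil_seq d j)) \<le> 11 * L\<^sup>2 * N / Z \<or>
     (\<exists>a q::int. 1 \<le> q \<and> of_int q \<le> Y \<and> coprime a q \<and> \<bar>x - of_int a / of_int q\<bar> * N \<le> Y)"
    proof (cases "\<forall>i\<in>{m..n}. norm (\<Sum>j=m..i. ee (x * dil_seq d j)) \<le> real n / Z")
      case True
      have "norm (\<Sum>j=m..n. of_real (incr_weight (dil_seq d) N j) * ee (0 * dil_seq d j) * ee (x * dil_seq d j))
          \<le> 11 * L\<^sup>2 * (real n / Z) * (1 + \<bar>0\<bar> * N) * N / real n"
        by (rule weighted_sum_bound) (use True in auto)
      then show ?thesis using n_pos by simp
    next
      case False
      then obtain i where i: "m \<le> i" "i \<le> n" "real n / Z < norm (\<Sum>j=m..i. ee (x * dil_seq d j))" by auto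
      define p where "p = smult x (pcompose G [:0, of_int d:])"
      have px: "poly p (of_int j) = x * of_int (poly g (d * j))" for j
        using poly_G[of "d * j"] by (simp add: p_def poly_pcompose mult.commute)
      have "degree p \<le> k" unfolding p_def
        by (intro order_trans[OF degree_smult_le] order_trans[OF degree_pcompose_le]) (simp add: degree_G)
      then have pp: "pphase k (coeff p k) (\<lambda>j. poly p (of_int j))" by (rule pphase_poly)
      have ck: "coeff p k = x * (of_int d ^ k * of_int (coeff g k))" by (simp add: p_def coeff_pcompose_linear coeff_G)
      have "(\<Sum>j=m..i. ee (x * dil_seq d j)) = (\<Sum>t<Suc i - m. ee (poly p (of_int (int m + int t))))"
        unfolding px dil_seq_def
        by (rule sum.reindex_bij_witness[of _ "\<lambda>t. m + t" "\<lambda>j. j - m"]) (auto simp: of_nat_diff)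
      then have "real n \<le> Z * norm (\<Sum>t<Suc i - m. ee (poly p (of_int (int m + int t))))"
        using i(3) Z by (simp add: field_simps)
      from W[OF pp _ _ Z this] obtain q0 :: nat and a0 :: int where q0: "q0 \<ge> 1" "real q0 \<le> K"
        and a0: "\<bar>real q0 * coeff p k - of_int a0\<bar> * real n ^ k \<le> K"
        using i mn unfolding K_def by force
      \<comment> \<open>Weyl's inequality approximates the leading coefficient
        \<open>x * coeff g k * d ^ k\<close>; clearing it puts \<open>d ^ k\<close> into the
        denominator for \<open>x\<close>, hence the size demanded of \<open>Y\<close>.\<close>
      define q1 where "q1 = int q0 * (coeff g k * d ^ k)"
      have dk: "d ^ k \<ge> 1" using d by (simp add: one_le_power)
      have gk: "coeff g k * d ^ k \<ge> d ^ k" using lead dk mult_right_mono[of 1 "coeff g k" "d ^ k"] by simp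
      have q1: "q1 \<ge> d ^ k"
        unfolding q1_def using q0(1) gk dk mult_mono[of 1 "int q0" "d ^ k" "coeff g k * d ^ k"] by simp
      have q1Y: "of_int q1 \<le> Y"
      proof -
        have "of_int q1 = real q0 * of_int (coeff g k * d ^ k)" by (simp add: q1_def)
        also have "\<dots> \<le> K * of_int (coeff g k * d ^ k)" using q0(2) gk dk by (intro mult_right_mono) (auto simp del: of_int_mult)
        finally show ?thesis using Y1 by (simp add: K_def)
      qed
      have "\<bar>of_int q1 * x - of_int a0\<bar> * real n ^ k \<le> K" using a0 unfolding ck by (simp add: q1_def mult_ac)
      moreover have "\<bar>of_int q1 * x - of_int a0\<bar> = of_int q1 * \<bar>x - of_int a0 / of_int q1\<bar>"
      proof -
        have "of_int q1 * x - of_int a0 = of_int q1 * (x - of_int a0 / of_int q1)" using q1 dk by (simp add: field_simps)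
        then show ?thesis using q1 dk by (simp add: abs_mult)
      qed
      ultimately have 1: "of_int q1 * \<bar>x - of_int a0 / of_int q1\<bar> * real n ^ k \<le> K" by simp
      have c0: "c \<ge> 0"
      proof (rule ccontr)
        assume "\<not> c \<ge> 0"
        then have "c * (of_int d * real n) ^ k \<le> 0" using d by (intro mult_nonpos_nonneg) auto
        then show False using Nc N by simp
      qed
      \<comment> \<open>The factor \<open>d ^ k\<close> in the bound for \<open>N\<close> is paid
        for by the same factor in \<open>q1\<close>, so the distance bound does not deteriorate with
        \<open>d\<close>.\<close>
      have "\<bar>x - of_int a0 / of_int q1\<bar> * N \<le> \<bar>x - of_int a0 / of_int q1\<bar> * (c * (of_int d * real n) ^ k)"
        using Nc by (intro mult_left_mono) auto
      also have "\<dots> = c * (of_int (d ^ k) * \<bar>x - of_int a0 / of_int q1\<bar> * real n ^ k)" by (simp add: power_mult_distrib mult_ac)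
      also have "\<dots> \<le> c * (of_int q1 * \<bar>x - of_int a0 / of_int q1\<bar> * real n ^ k)"
        using q1 c0 by (intro mult_left_mono mult_right_mono) (simp_all del: of_int_power)
      also have "\<dots> \<le> c * K" using 1 c0 by (intro mult_left_mono) auto
      also have "\<dots> \<le> Y" using Y2 by (simp add: K_def mult.commute)
      finally have 2: "\<bar>x - of_int a0 / of_int q1\<bar> * N \<le> Y" .
      define h where "h = gcd a0 q1"
      have q1p: "q1 > 0" using q1 dk by linarith
      have h: "h > 0" "h dvd a0" "h dvd q1" using q1p by (auto simp: h_def)
      define a q where "a = a0 div h" and "q = q1 div h"
      have aq: "a0 = a * h" "q1 = q * h" using h by (auto simp: a_def q_def)
      have cop: "coprime a q" using div_gcd_coprime[of a0 q1] q1p by (auto simp: a_def q_def h_def)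
      have qp: "q \<ge> 1" using q1p h(1) aq(2) by (simp add: zero_less_mult_iff)
      have "q * 1 \<le> q * h" using qp h(1) by (intro mult_left_mono) auto
      then have "q \<le> q1" by (simp add: aq(2))
      then have "of_int q \<le> Y" using q1Y by linarith
      moreover have "real_of_int a0 / of_int q1 = of_int a / of_int q" using h(1) by (simp add: aq)
      ultimately show ?thesis using 2 cop qp by auto
    qed
  qed
qed

end

section \<open>The cosine polynomial\<close>

context odd_form begin

text \<open>The parameters are bounded by constants times fixed powers of \<open>exp Q\<close>: the
  dilations, hence the height \<open>Y\<close> of the fractions, hence the length \<open>n0\<close>
  that makes the approximation errors on major arcs of relative order
  \<open>1 / Z = Q^(-1/k)\<close>. The lower bound for \<open>N\<close> guarantees this length for
  every dilation. The sum is indexed by pairs, so equal values may still occur.\<close>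

lemma kernel:
  "\<exists>K \<kappa> C0 Q0. K > 0 \<and> \<kappa> > 0 \<and> C0 \<ge> 0 \<and> (\<forall>(Q::nat) N. Q0 \<le> real Q \<longrightarrow> 1 \<le> Q \<longrightarrow> K * exp (\<kappa> * real Q) \<le> N \<longrightarrow>
     (\<exists>(I :: (int \<times> nat) set) c val. finite I \<and>
        (\<forall>i\<in>I. c i \<ge> 0 \<and> (\<exists>j\<ge>1. val i = poly g j) \<and> 0 < val i \<and> of_int (val i) \<le> N) \<and> N / 4 \<le> (\<Sum>i\<in>I. c i) \<and>
        (\<forall>x. - (C0 * N * real Q powr (- (1 / real k))) \<le> (\<Sum>i\<in>I. c i * cos (2 * pi * of_int (val i) * x)))))"
proof -
  obtain L X0 c where L: "L \<ge> 1" and X0: "X0 \<ge> 1" and c: "c \<ge> (1::real)"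
    and pos: "\<And>d j. d \<ge> 1 \<Longrightarrow> j \<ge> X0 \<Longrightarrow> 0 < dil_seq d j"
    and first: "\<And>d. d \<ge> 1 \<Longrightarrow> dil_seq d X0 \<le> c * of_int d ^ k"
    and exn: "\<And>d N. d \<ge> 1 \<Longrightarrow> c * of_int d ^ k \<le> N \<Longrightarrow> \<exists>n. weighted_seq (dil_seq d) X0 n N L \<and> N \<le> c * (of_int d * real n) ^ k"
    using dilation_sequences by blast
  obtain Cw :: nat where Cw: "Cw \<ge> 1" and minor: "\<And>d m n N L c x Z Y. weighted_seq (dil_seq d) m n N L \<Longrightarrow> d \<ge> 1 \<Longrightarrow> N \<le> c * (of_int d * real n) ^ k \<Longrightarrow> Z \<ge> 1 \<Longrightarrow>
     real Cw * Z ^ Cw * of_int (coeff g k * d ^ k) \<le> Y \<Longrightarrow> real Cw * Z ^ Cw * c \<le> Y \<Longrightarrow>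
     norm (\<Sum>j=m..n. of_real (incr_weight (dil_seq d) N j) * ee (x * dil_seq d j)) \<le> 11 * L\<^sup>2 * N / Z \<or>
     (\<exists>a q::int. 1 \<le> q \<and> of_int q \<le> Y \<and> coprime a q \<and> \<bar>x - of_int a / of_int q\<bar> * N \<le> Y)"
    using minor_arc by blast
  define bk where "bk = real_of_int (coeff g k)"
  have bk: "bk \<ge> 1" using lead by (simp add: bk_def)
  define W1 where "W1 = real Cw * (bk + c)"
  \<comment> \<open>\<open>1 + Y\<close> is at most a constant times
    \<open>exp (\<kappa>0 * Q)\<close>: \<open>Cw\<close> stems from \<open>Z ^ Cw\<close> and
    \<open>14 * k\<close> from the dilations to the power \<open>k\<close>. In
    \<open>\<kappa>\<close> the first summand again stands for the dilations and the second for
    \<open>n0 ^ k\<close>, as \<open>n0\<close> has order \<open>(1 + Y)^2 * Z\<close>.\<close>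
  define \<kappa>0 where "\<kappa>0 = real Cw + 14 * real k"
  define K where "K = c * (42 * L\<^sup>2 * (1 + W1)\<^sup>2) ^ k"
  define \<kappa> where "\<kappa> = 14 * real k + real k * (2 * \<kappa>0 + 1)"
  \<comment> \<open>\<open>C1\<close> is the loss in the mean of \<open>S\<close>, the 2 covers the
    errors on major arcs, and \<open>11 * L^2\<close> the minor arcs.\<close>
  define C0 where "C0 = C1 + 2 + 11 * L\<^sup>2"
  \<comment> \<open>The summand \<open>8 ^ k\<close> gives \<open>Z \<ge> 8\<close>, so that two
    errors \<open>N / Z\<close> leave \<open>N / 4\<close> of the main term \<open>N / 2\<close> at
    \<open>x = 0\<close>.\<close>
  define Q0 where "Q0 = Cm ^ (2 * k) + real k ^ 2 + 8 ^ k"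
  have W1: "W1 \<ge> 0" using c bk by (simp add: W1_def)
  have C1: "C1 \<ge> 0" using Cm_ge by (simp add: C1_def)
  have \<kappa>0: "\<kappa>0 \<ge> 0" by (simp add: \<kappa>0_def)
  have L2: "L\<^sup>2 \<ge> 1" "L \<le> L\<^sup>2" using one_le_power[OF L, of 2] self_le_power[OF L, of 2] by simp_all
  have main: "\<exists>(I :: (int \<times> nat) set) cf val. finite I \<and>
        (\<forall>i\<in>I. cf i \<ge> 0 \<and> (\<exists>j\<ge>1. val i = poly g j) \<and> 0 < val i \<and> of_int (val i) \<le> N) \<and> N / 4 \<le> (\<Sum>i\<in>I. cf i) \<and>
        (\<forall>x. - (C0 * N * real Q powr (- (1 / real k))) \<le> (\<Sum>i\<in>I. cf i * cos (2 * pi * of_int (val i) * x)))"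
    if Q: "Q0 \<le> real Q" "1 \<le> Q" and N: "K * exp (\<kappa> * real Q) \<le> N" for Q :: nat and N
  proof -
    define Z where "Z = real Q powr (1 / real k)"
    have Z8: "Z \<ge> 8"
    proof -
      have "Cm ^ (2 * k) \<ge> 0" using Cm_ge by (intro zero_le_power) auto
      then have "8 ^ k \<le> real Q" using Q(1) unfolding Q0_def by (smt (verit) zero_le_power2)
      then have "(8 ^ k) powr (1 / real k) \<le> Z" unfolding Z_def by (intro powr_mono2) auto
      moreover have "((8::real) ^ k) powr (1 / real k) = 8"
      proof -
        have "(8::real) ^ k = 8 powr real k" by (subst powr_realpow) auto
        then have "((8::real) ^ k) powr (1 / real k) = 8 powr (real k * (1 / real k))" by (simp only: powr_powr)
        also have "real k * (1 / real k) = 1" using k by simp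
        finally show ?thesis by simp
      qed
      ultimately show ?thesis by simp
    qed
    then have Z1: "Z \<ge> 1" by simp
    have Zinv: "real Q powr (- (1 / real k)) = 1 / Z" by (simp add: Z_def powr_minus divide_inverse)
    have ZQ: "Z \<le> exp (real Q)"
    proof -
      have "Z \<le> real Q powr 1" unfolding Z_def using Q k by (intro powr_mono) auto
      also have "\<dots> \<le> exp (real Q)" 
      proof -
        have "real Q powr 1 = real Q" by simp
        then show ?thesis using exp_ge_add_one_self[of "real Q"] by linarith
      qed
      finally show ?thesis .
    qed
    define Dm where "Dm = exp (14 * real Q)"
    have Dm: "Dm \<ge> 1" "Dm ^ k \<ge> 1" by (simp_all add: Dm_def one_le_power)
    have Dmk: "Dm ^ k = exp (14 * real k * real Q)" by (simp add: Dm_def mult_ac flip: exp_of_nat_mult)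
    define Y where "Y = real Cw * Z ^ Cw * (bk * Dm ^ k + c)"
    have ZC: "Z ^ Cw \<ge> 1" using Z1 by (rule one_le_power)
    have Y0: "Y \<ge> 1"
    proof -
      have "0 \<le> bk * Dm ^ k" using bk Dm by simp
      then have "1 \<le> bk * Dm ^ k + c" using c by linarith
      then have "1 * 1 * 1 \<le> real Cw * Z ^ Cw * (bk * Dm ^ k + c)"
        using Cw ZC c bk Dm by (intro mult_mono) auto
      then show ?thesis by (simp add: Y_def)
    qed
    have Yle: "1 + Y \<le> (1 + W1) * exp (\<kappa>0 * real Q)"
    proof -
      have "Z ^ Cw \<le> exp (real Q) ^ Cw" using ZQ Z1 by (intro power_mono) auto
      also have "\<dots> = exp (real Cw * real Q)" by (simp flip: exp_of_nat_mult)
      finally have z: "Z ^ Cw \<le> exp (real Cw * real Q)" .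
      have "bk * Dm ^ k + c \<le> (bk + c) * Dm ^ k" using c Dm mult_left_mono[of 1 "Dm ^ k" c] by (simp add: algebra_simps)
      then have "Y \<le> real Cw * exp (real Cw * real Q) * ((bk + c) * Dm ^ k)"
        unfolding Y_def using z bk c Dm ZC by (intro mult_mono) auto
      also have "\<dots> = W1 * exp (\<kappa>0 * real Q)"
        by (simp add: W1_def \<kappa>0_def Dmk exp_add algebra_simps)
      finally have "Y \<le> W1 * exp (\<kappa>0 * real Q)" .
      moreover have "1 \<le> exp (\<kappa>0 * real Q)" using \<kappa>0 by simp
      ultimately show ?thesis unfolding distrib_right mult_1 by linarith
    qed
    \<comment> \<open>The relative errors are \<open>22 * L^2 * (1 + Y)^2 / n\<close> from
      \<open>major_arc\<close> and at most \<open>20 * L^2 * (1 + Y)^2 / n\<close> from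
      \<open>weighted_sum_fejer\<close>; for \<open>n \<ge> n0\<close> they add up to at most
      \<open>1 / Z\<close>.\<close>
    define n0 where "n0 = 42 * L\<^sup>2 * (1 + Y)\<^sup>2 * Z"
    have n0Z: "n0 \<ge> Z"
    proof -
      have "(1 + Y)\<^sup>2 \<ge> 1" using Y0 by (intro one_le_power) auto
      then have "1 * 1 \<le> (42 * L\<^sup>2) * (1 + Y)\<^sup>2" using L2 by (intro mult_mono) auto
      then have "1 * Z \<le> (42 * L\<^sup>2) * (1 + Y)\<^sup>2 * Z" using Z1 by (intro mult_right_mono) auto
      then show ?thesis by (simp add: n0_def)
    qed
    have n01: "n0 \<ge> 1" using n0Z Z1 by simp
    have n0k: "n0 \<le> n0 ^ k" using n01 k by (intro self_le_power) auto
    have NB: "c * Dm ^ k * n0 ^ k \<le> N"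
    proof -
      have "(1 + Y)\<^sup>2 \<le> ((1 + W1) * exp (\<kappa>0 * real Q))\<^sup>2" using Yle Y0 by (intro power_mono) auto
      then have "n0 \<le> 42 * L\<^sup>2 * ((1 + W1) * exp (\<kappa>0 * real Q))\<^sup>2 * exp (real Q)"
        unfolding n0_def using ZQ Z1 by (intro mult_mono) auto
      also have "\<dots> = (42 * L\<^sup>2 * (1 + W1)\<^sup>2) * exp ((2 * \<kappa>0 + 1) * real Q)"
      proof -
        have "(exp (\<kappa>0 * real Q))\<^sup>2 * exp (real Q) = exp (\<kappa>0 * real Q + \<kappa>0 * real Q + real Q)"
          by (simp only: power2_eq_square exp_add)
        also have "\<kappa>0 * real Q + \<kappa>0 * real Q + real Q = (2 * \<kappa>0 + 1) * real Q" by (simp add: algebra_simps)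
        finally show ?thesis by (simp only: power_mult_distrib mult.assoc)
      qed
      finally have "n0 ^ k \<le> ((42 * L\<^sup>2 * (1 + W1)\<^sup>2) * exp ((2 * \<kappa>0 + 1) * real Q)) ^ k"
        using n01 by (intro power_mono) auto
      then have "c * Dm ^ k * n0 ^ k \<le> c * Dm ^ k * ((42 * L\<^sup>2 * (1 + W1)\<^sup>2) * exp ((2 * \<kappa>0 + 1) * real Q)) ^ k"
        using c Dm by (intro mult_left_mono) auto
      also have "\<dots> = K * (exp (14 * real k * real Q) * exp ((2 * \<kappa>0 + 1) * real Q) ^ k)"
        by (simp only: Dmk K_def power_mult_distrib mult_ac)
      also have "exp (14 * real k * real Q) * exp ((2 * \<kappa>0 + 1) * real Q) ^ k = exp (\<kappa> * real Q)"
        unfolding exp_of_nat_mult[symmetric] exp_add[symmetric] \<kappa>_def by (simp add: algebra_simps)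
      finally show ?thesis using N by simp
    qed
    have N0: "N \<ge> 1"
    proof -
      have "1 * 1 * 1 \<le> c * Dm ^ k * n0 ^ k" using c Dm n01 n0k by (intro mult_mono) auto
      then show ?thesis using NB by simp
    qed
    have Qc: "real Q \<ge> Cm ^ (2 * k) + real k ^ 2"
    proof -
      have "(8::real) ^ k \<ge> 0" by simp
      then show ?thesis using Q(1) unfolding Q0_def by linarith
    qed
    obtain D w where H: "finite D" "\<forall>d\<in>D. 1 \<le> d \<and> real_of_int d \<le> Dm \<and> w d \<ge> 0" "(\<Sum>d\<in>D. w d) = (1::real)"
      "\<forall>q\<ge>1. q \<le> \<lfloor>Y\<rfloor> \<longrightarrow> (\<forall>a. coprime a q \<longrightarrow> - (C1 * (1 / Z)) \<le> (\<Sum>d\<in>D. w d * S d a q))"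
      using good_dilations[OF Qc, of "\<lfloor>Y\<rfloor>"] unfolding Zinv Dm_def[symmetric] by (elim exE conjE) (rule that)
    note D = H(1) bspec[OF H(2)] H(3) H(4)[rule_format]
    have wsum: "(\<Sum>d\<in>D. w d * r) = r" for r using D(3) by (simp only: sum_distrib_right[symmetric] mult_1)
    have dk: "c * of_int d ^ k \<le> c * Dm ^ k" if "d \<in> D" for d
      using D(2)[OF that] c by (intro mult_left_mono power_mono) auto
    have cDZ: "c * Dm ^ k \<le> N / Z"
    proof -
      have "c * Dm ^ k * Z \<le> c * Dm ^ k * n0 ^ k" using n0Z n0k c Dm by (intro mult_left_mono) auto
      then show ?thesis using NB Z1 by (simp add: pos_le_divide_eq)
    qed
    have "\<exists>n. weighted_seq (dil_seq d) X0 n N L \<and> N \<le> c * (of_int d * real n) ^ k" if d: "d \<in> D" for d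
    proof (rule exn)
      show "1 \<le> d" using D(2)[OF d] by simp
      have "N / Z \<le> N / 1" using N0 Z1 by (intro divide_left_mono) auto
      then show "c * of_int d ^ k \<le> N" using dk[OF d] cDZ by simp
    qed
    then obtain n where n: "\<And>d. d \<in> D \<Longrightarrow> weighted_seq (dil_seq d) X0 (n d) N L \<and> N \<le> c * (of_int d * real (n d)) ^ k" by metis
    have nn0: "n0 \<le> real (n d)" if d: "d \<in> D" for d
    proof (rule ccontr)
      assume "\<not> ?thesis"
      then have "real (n d) ^ k < n0 ^ k" using k by (intro power_strict_mono) auto
      moreover have "c * Dm ^ k > 0" using c Dm by (intro mult_pos_pos) auto
      ultimately have "c * Dm ^ k * real (n d) ^ k < c * Dm ^ k * n0 ^ k" by (intro mult_strict_left_mono) auto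
      moreover have "c * (of_int d * real (n d)) ^ k \<le> c * Dm ^ k * real (n d) ^ k"
        using mult_right_mono[OF dk[OF d], of "real (n d) ^ k"] by (simp add: power_mult_distrib mult_ac)
      ultimately show False using n[OF d] NB by linarith
    qed
    define F where "F = (\<lambda>d x. \<Sum>j=X0..n d. complex_of_real (incr_weight (dil_seq d) N j) * ee (x * dil_seq d j))"
    define T where "T = (\<lambda>x. \<Sum>d\<in>D. w d * Re (F d x))"
    have uX: "dil_seq d X0 \<le> N / Z" if d: "d \<in> D" for d
      using first[of d] D(2)[OF d] dk[OF d] cDZ by linarith
    have fej: "\<bar>Re (F d \<beta>) - fejer N \<beta>\<bar> \<le> 20 * L * (1 + \<bar>\<beta>\<bar> * N) * N / n0 + N / Z" if d: "d \<in> D" for d \<beta>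
    proof -
      interpret weighted_seq "dil_seq d" X0 "n d" N L using n[OF d] by blast
      have "\<bar>Re (F d \<beta>) - fejer N \<beta>\<bar> \<le> 20 * L * (1 + \<bar>\<beta>\<bar> * N) * N / real (n d) + dil_seq d X0"
        unfolding F_def by (rule weighted_sum_fejer)
      also have "\<dots> \<le> 20 * L * (1 + \<bar>\<beta>\<bar> * N) * N / n0 + N / Z"
        using L N0 nn0[OF d] n01 uX[OF d] by (intro add_mono divide_left_mono) auto
      finally show ?thesis .
    qed
    have n0eq: "42 * L\<^sup>2 * (1 + Y)\<^sup>2 * N / n0 = N / Z"
    proof -
      have "42 * L\<^sup>2 * (1 + Y)\<^sup>2 \<noteq> 0" using L Y0 by simp
      then show ?thesis unfolding n0_def by simp
    qed
    have LY: "20 * L * (1 + Y) \<le> 20 * L\<^sup>2 * (1 + Y)\<^sup>2"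
    proof (rule mult_mono)
      show "1 + Y \<le> (1 + Y)\<^sup>2" using Y0 by (intro self_le_power) auto
    qed (use L2 Y0 in auto)
    have lower: "- (C0 * N / Z) \<le> T x" for x
    \<comment> \<open>The dichotomy does not involve \<open>d\<close>: on a major arc one fraction
      \<open>a / q\<close> serves all dilations, so averaging acts on the factors
      \<open>S d a q\<close> alone.\<close>
    proof (cases "\<exists>a q::int. 1 \<le> q \<and> of_int q \<le> Y \<and> coprime a q \<and> \<bar>x - of_int a / of_int q\<bar> * N \<le> Y")
      case True
      then obtain a q :: int where q: "1 \<le> q" "of_int q \<le> Y" "coprime a q" and b: "\<bar>x - of_int a / of_int q\<bar> * N \<le> Y" by blast
      define \<beta> where "\<beta> = x - of_int a / of_int q"
      have x: "x = of_int a / of_int q + \<beta>" by (simp add: \<beta>_def)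
      have bN: "\<bar>\<beta>\<bar> * N \<le> Y" using b by (simp add: \<beta>_def)
      have bN0: "0 \<le> \<bar>\<beta>\<bar> * N" using N0 by simp
      have each: "S d a q * fejer N \<beta> - 2 * (N / Z) \<le> Re (F d x)" if d: "d \<in> D" for d
      proof -
        have "norm (F d x - of_real (S d a q) * F d \<beta>) \<le> 11 * L\<^sup>2 * (2 * of_int q) * (1 + \<bar>\<beta>\<bar> * N) * N / real (n d)"
          unfolding F_def using n[OF d] q(1) x by (intro major_arc) auto
        also have "\<dots> \<le> 11 * L\<^sup>2 * (2 * of_int q) * (1 + \<bar>\<beta>\<bar> * N) * N / n0"
          using q N0 nn0[OF d] n01 by (intro divide_left_mono mult_nonneg_nonneg) auto
        also have "\<dots> \<le> 22 * L\<^sup>2 * (1 + Y)\<^sup>2 * N / n0"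
        proof (intro divide_right_mono mult_right_mono)
          have "of_int q * (1 + \<bar>\<beta>\<bar> * N) \<le> (1 + Y) * (1 + Y)" using q bN bN0 Y0 by (intro mult_mono) auto
          then have "(22 * L\<^sup>2) * (of_int q * (1 + \<bar>\<beta>\<bar> * N)) \<le> (22 * L\<^sup>2) * ((1 + Y) * (1 + Y))" by (intro mult_left_mono) auto
          then show "11 * L\<^sup>2 * (2 * of_int q) * (1 + \<bar>\<beta>\<bar> * N) \<le> 22 * L\<^sup>2 * (1 + Y)\<^sup>2"
            by (simp add: power2_eq_square mult_ac)
        qed (use N0 n01 in auto)
        finally have e1: "norm (F d x - of_real (S d a q) * F d \<beta>) \<le> 22 * L\<^sup>2 * (1 + Y)\<^sup>2 * N / n0" .
        have "\<bar>Re (F d x) - S d a q * Re (F d \<beta>)\<bar> \<le> norm (F d x - of_real (S d a q) * F d \<beta>)"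
          using abs_Re_le_cmod[of "F d x - of_real (S d a q) * F d \<beta>"] by simp
        then have 1: "S d a q * Re (F d \<beta>) - 22 * L\<^sup>2 * (1 + Y)\<^sup>2 * N / n0 \<le> Re (F d x)" using e1 by linarith
        have S1: "\<bar>S d a q\<bar> \<le> 1" using q by (intro abs_S_le_1) auto
        have "\<bar>Re (F d \<beta>) - fejer N \<beta>\<bar> \<le> 20 * L * (1 + \<bar>\<beta>\<bar> * N) * N / n0 + N / Z" by (rule fej[OF d])
        also have "\<dots> \<le> 20 * L\<^sup>2 * (1 + Y)\<^sup>2 * N / n0 + N / Z"
        proof (intro add_right_mono divide_right_mono mult_right_mono)
          have "20 * L * (1 + \<bar>\<beta>\<bar> * N) \<le> 20 * L * (1 + Y)" using L bN by (intro mult_left_mono) auto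
          then show "20 * L * (1 + \<bar>\<beta>\<bar> * N) \<le> 20 * L\<^sup>2 * (1 + Y)\<^sup>2" using LY by linarith
        qed (use N0 n01 in auto)
        finally have e2: "\<bar>Re (F d \<beta>) - fejer N \<beta>\<bar> \<le> 20 * L\<^sup>2 * (1 + Y)\<^sup>2 * N / n0 + N / Z" .
        have "\<bar>S d a q * (Re (F d \<beta>) - fejer N \<beta>)\<bar> \<le> 1 * \<bar>Re (F d \<beta>) - fejer N \<beta>\<bar>"
          unfolding abs_mult using S1 by (intro mult_right_mono) auto
        also have "\<dots> \<le> 20 * L\<^sup>2 * (1 + Y)\<^sup>2 * N / n0 + N / Z" unfolding mult_1 by (rule e2)
        finally have "- (20 * L\<^sup>2 * (1 + Y)\<^sup>2 * N / n0 + N / Z) \<le> S d a q * Re (F d \<beta>) - S d a q * fejer N \<beta>"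
          unfolding right_diff_distrib by (simp only: abs_le_iff minus_le_iff)
        then have 2: "S d a q * fejer N \<beta> - (20 * L\<^sup>2 * (1 + Y)\<^sup>2 * N / n0 + N / Z) \<le> S d a q * Re (F d \<beta>)"
          by (simp only: le_diff_eq diff_conv_add_uminus add.commute)
        have "22 * L\<^sup>2 * (1 + Y)\<^sup>2 * N / n0 + 20 * L\<^sup>2 * (1 + Y)\<^sup>2 * N / n0 = N / Z"
          unfolding n0eq[symmetric] by (simp flip: add_divide_distrib)
        then show ?thesis using 1 2 by linarith
      qed
      have fb: "0 \<le> fejer N \<beta>" "fejer N \<beta> \<le> N" using fejer_bounds[of N \<beta>] N0 by auto
      have "- (C1 * (1 / Z)) \<le> (\<Sum>d\<in>D. w d * S d a q)" by (rule D(4)) (use q in \<open>auto simp: le_floor_iff\<close>)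
      \<comment> \<open>Non-negativity of \<open>fejer\<close> enters here: only so does a lower
        bound for the mean of \<open>S\<close> pass to the product.\<close>
      then have "fejer N \<beta> * - (C1 * (1 / Z)) \<le> fejer N \<beta> * (\<Sum>d\<in>D. w d * S d a q)" using fb by (intro mult_left_mono) auto
      moreover have "fejer N \<beta> * (C1 * (1 / Z)) \<le> N * (C1 * (1 / Z))" using fb C1 Z1 by (intro mult_right_mono) auto
      ultimately have "- (N * C1 / Z) \<le> fejer N \<beta> * (\<Sum>d\<in>D. w d * S d a q)" by simp
      moreover have "fejer N \<beta> * (\<Sum>d\<in>D. w d * S d a q) - 2 * (N / Z) = (\<Sum>d\<in>D. w d * (S d a q * fejer N \<beta> - 2 * (N / Z)))"
      proof -
        have "(\<Sum>d\<in>D. w d * (S d a q * fejer N \<beta> - 2 * (N / Z))) = (\<Sum>d\<in>D. fejer N \<beta> * (w d * S d a q)) - (\<Sum>d\<in>D. w d * (2 * (N / Z)))"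
          by (simp add: right_diff_distrib sum_subtractf mult_ac)
        then show ?thesis by (simp only: wsum sum_distrib_left)
      qed
      moreover have "\<dots> \<le> T x" unfolding T_def using each D(2) by (intro sum_mono mult_left_mono) auto
      moreover have "C0 * N / Z = N * C1 / Z + 2 * (N / Z) + 11 * L\<^sup>2 * (N / Z)"
        by (simp add: C0_def add_divide_distrib distrib_right distrib_left)
      moreover have "0 \<le> 11 * L\<^sup>2 * (N / Z)" using N0 Z1 by simp
      ultimately show ?thesis by linarith
    next
      case False
      have each: "- (11 * L\<^sup>2 * N / Z) \<le> Re (F d x)" if d: "d \<in> D" for d
      proof -
        have dd: "1 \<le> d" "real_of_int d \<le> Dm" using D(2)[OF d] by auto
        have "of_int (coeff g k * d ^ k) \<le> bk * Dm ^ k"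
          using dd bk by (simp add: bk_def) (intro mult_left_mono power_mono; simp)
        then have Y1: "real Cw * Z ^ Cw * of_int (coeff g k * d ^ k) \<le> Y"
          unfolding Y_def using c ZC by (intro mult_left_mono) auto
        have "0 \<le> bk * Dm ^ k" using bk Dm by simp
        then have Y2: "real Cw * Z ^ Cw * c \<le> Y" unfolding Y_def using ZC by (intro mult_left_mono) auto
        have "norm (F d x) \<le> 11 * L\<^sup>2 * N / Z"
          using minor[OF conjunct1[OF n[OF d]] dd(1) conjunct2[OF n[OF d]] Z1 Y1 Y2, of x] False unfolding F_def by blast
        then show ?thesis using abs_Re_le_cmod[of "F d x"] by linarith
      qed
      have "- (11 * L\<^sup>2 * N / Z) = (\<Sum>d\<in>D. w d * - (11 * L\<^sup>2 * N / Z))" by (simp only: wsum)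
      also have "\<dots> \<le> T x" unfolding T_def using each D(2) by (intro sum_mono mult_left_mono) auto
      finally have "- (11 * L\<^sup>2 * N / Z) \<le> T x" .
      moreover have "11 * L\<^sup>2 * N / Z \<le> C0 * N / Z"
        using C1 N0 Z1 by (intro divide_right_mono mult_right_mono) (auto simp: C0_def)
      ultimately show ?thesis by linarith
    qed
    have T0: "N / 4 \<le> T 0"
    proof -
      have each: "N / 4 \<le> Re (F d 0)" if d: "d \<in> D" for d
      proof -
        have "\<bar>Re (F d 0) - N / 2\<bar> \<le> 20 * L * N / n0 + N / Z" using fej[OF d, of 0] by (simp add: fejer_def)
        moreover have "20 * L * N / n0 \<le> 42 * L\<^sup>2 * (1 + Y)\<^sup>2 * N / n0"
        proof (intro divide_right_mono mult_right_mono)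
          have "20 * L * 1 \<le> 20 * L * (1 + Y)" using L Y0 by (intro mult_left_mono) auto
          moreover have "20 * L\<^sup>2 * (1 + Y)\<^sup>2 \<le> 42 * L\<^sup>2 * (1 + Y)\<^sup>2" by (intro mult_right_mono) auto
          ultimately show "20 * L \<le> 42 * L\<^sup>2 * (1 + Y)\<^sup>2" using LY by linarith
        qed (use N0 n01 in auto)
        moreover have "N / Z \<le> N / 8" using N0 Z8 by (intro divide_left_mono) auto
        ultimately show ?thesis unfolding n0eq by linarith
      qed
      have "N / 4 = (\<Sum>d\<in>D. w d * (N / 4))" by (simp only: wsum)
      also have "\<dots> \<le> T 0" unfolding T_def using each D(2) by (intro sum_mono mult_left_mono) auto
      finally show ?thesis .
    qed
    define I where "I = (SIGMA d:D. {X0..n d})"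
    define cf where "cf = (\<lambda>(d, j). w d * incr_weight (dil_seq d) N j)"
    define val where "val = (\<lambda>(d, j). poly g (d * int j))"
    have TI: "T x = (\<Sum>i\<in>I. cf i * cos (2 * pi * of_int (val i) * x))" for x
    proof -
      have "T x = (\<Sum>d\<in>D. \<Sum>j=X0..n d. cf (d, j) * cos (2 * pi * of_int (val (d, j)) * x))"
        by (simp add: T_def F_def Re_ee cf_def val_def dil_seq_def sum_distrib_left mult_ac)
      then show ?thesis unfolding I_def using D(1) by (simp add: sum.Sigma case_prod_beta)
    qed
    show ?thesis
    proof (rule exI[of _ I], rule exI[of _ cf], rule exI[of _ val], intro conjI ballI allI)
      show "finite I" using D(1) by (simp add: I_def)
      show "N / 4 \<le> (\<Sum>i\<in>I. cf i)" using T0 unfolding TI by simp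
      show "- (C0 * N * real Q powr (- (1 / real k))) \<le> (\<Sum>i\<in>I. cf i * cos (2 * pi * of_int (val i) * x))" for x
        using lower[of x] unfolding TI Zinv by simp
      fix i assume "i \<in> I"
      then obtain d j where i: "i = (d, j)" "d \<in> D" "X0 \<le> j" "j \<le> n d" by (auto simp: I_def)
      interpret weighted_seq "dil_seq d" X0 "n d" N L using n[OF i(2)] by blast
      show "0 \<le> cf i" using wt_bounds[OF i(3,4)] D(2)[OF i(2)] by (simp add: cf_def i(1))
      have d1: "1 \<le> d" using D(2)[OF i(2)] by simp
      have "real_of_int (val i) = dil_seq d j" by (simp add: val_def i(1) dil_seq_def)
      then show "0 < val i" "of_int (val i) \<le> N" using pos[OF d1 i(3)] u_range[OF i(3,4)] by auto
      have "1 * 1 \<le> d * int j" using d1 i(3) X0 by (intro mult_mono) auto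
      then show "\<exists>j\<ge>1. val i = poly g j" by (intro exI[of _ "d * int j"]) (simp add: val_def i(1))
    qed
  qed
  have K0: "K > 0" unfolding K_def using c L W1 by (intro mult_pos_pos zero_less_power) auto
  have \<kappa>p: "\<kappa> > 0" using k \<kappa>0 by (simp add: \<kappa>_def add_pos_nonneg)
  have C00: "C0 \<ge> 0" using C1 by (simp add: C0_def)
  show ?thesis
    by (rule exI[of _ K], rule exI[of _ \<kappa>], rule exI[of _ C0], rule exI[of _ Q0],
        intro conjI allI impI, fact K0, fact \<kappa>p, fact C00, rule main, assumption+)
qed

end

section \<open>Normalisation of the polynomial and conclusion\<close>

text \<open>\<open>v\<close> is the order of vanishing at 0 and \<open>M\<close> the absolute value
  of the lowest coefficient. In \<open>f (M * x)\<close> the lowest term is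
  \<open>\<sigma> * M^(v+1) * x^v\<close> and every later one is divisible by
  \<open>M^(v+1)\<close>, so this factor \<open>A\<close> splits off and leaves the unit
  \<open>\<sigma>\<close>.\<close>

lemma odd_form_decomposition:
  fixes f :: "int poly"
  assumes deg: "degree f = k" and k: "k \<ge> 3" and odd: "\<And>j. even j \<Longrightarrow> coeff f j = 0" and lead: "coeff f k > 0"
  shows "\<exists>g g1 v \<sigma> M A. odd_form g g1 v k \<sigma> \<and> M \<ge> 1 \<and> A \<ge> 1 \<and> (\<forall>x. poly f (M * x) = A * poly g x)"
proof -
  define v where "v = (LEAST i. coeff f i \<noteq> 0)"
  have cv: "coeff f v \<noteq> 0" unfolding v_def by (rule LeastI[of "\<lambda>i. coeff f i \<noteq> 0" k]) (use lead in simp)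
  have below: "coeff f i = 0" if "i < v" for i using not_less_Least[of i "\<lambda>i. coeff f i \<noteq> 0"] that by (auto simp: v_def)
  have v1: "v \<ge> 1" using cv odd[of 0] by (cases v) auto
  define f1 where "f1 = poly_shift (Suc v) f"
  have f_eq: "f = monom (coeff f v) v + monom 1 (Suc v) * f1"
  proof (rule poly_eqI)
    fix i
    show "coeff f i = coeff (monom (coeff f v) v + monom 1 (Suc v) * f1) i"
    proof (cases "i < Suc v")
      case True
      then show ?thesis using below[of i] by (cases "i = v") (auto simp: coeff_monom_mult)
    next
      case False
      then show ?thesis by (simp add: coeff_monom_mult f1_def coeff_poly_shift)
    qed
  qed
  define M where "M = \<bar>coeff f v\<bar>"
  define \<sigma> where "\<sigma> = sgn (coeff f v)"
  define A where "A = M ^ Suc v"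
  define g1 where "g1 = pcompose f1 [:0, M:]"
  define g where "g = monom \<sigma> v + monom 1 (Suc v) * g1"
  have M: "M \<ge> 1" using cv by (simp add: M_def)
  then have A: "A \<ge> 1" by (simp add: A_def one_le_power del: power_Suc)
  have fM: "poly f (M * x) = A * poly g x" for x
  proof -
    have "poly f y = coeff f v * y ^ v + y ^ Suc v * poly f1 y" for y
      using arg_cong[OF f_eq, of "\<lambda>p. poly p y"] by (simp add: poly_monom)
    then have "poly f (M * x) = coeff f v * (M * x) ^ v + (M * x) ^ Suc v * poly f1 (M * x)" .
    also have "coeff f v = \<sigma> * M" by (simp add: \<sigma>_def M_def sgn_mult_abs)
    also have "\<sigma> * M * (M * x) ^ v + (M * x) ^ Suc v * poly f1 (M * x) = A * poly g x"
      by (simp add: g_def g1_def A_def poly_monom poly_pcompose power_mult_distrib algebra_simps)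
    finally show ?thesis .
  qed
  have comp: "pcompose f [:0, M:] = smult A g"
  proof (rule poly_ext)
    fix x
    have "poly f (x * M) = A * poly g x" using fM[of x] by (simp only: mult.commute)
    then show "poly (pcompose f [:0, M:]) x = poly (smult A g) x" by (simp add: poly_pcompose)
  qed
  have "odd_form g g1 v k \<sigma>"
  proof
    show "g = monom \<sigma> v + monom 1 (Suc v) * g1" by (rule g_def)
    show "\<bar>\<sigma>\<bar> = 1" using cv by (simp add: \<sigma>_def)
    show "1 \<le> v" "3 \<le> k" by (fact v1, fact k)
    have "degree (smult A g) = degree f" unfolding comp[symmetric] using M by (simp add: degree_pcompose)
    then show "degree g = k" using A deg by simp
    have "A * coeff g k = M ^ k * coeff f k" using arg_cong[OF comp, of "\<lambda>p. coeff p k"] by (simp add: coeff_pcompose_linear)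
    moreover have "M ^ k * coeff f k > 0" using M lead by (intro mult_pos_pos) auto
    ultimately have "0 < A * coeff g k" by linarith
    then show "0 < coeff g k" by (rule zero_less_mult_pos) (use A in simp)
    fix x
    have fo: "poly f (- y) = - poly f y" for y
      unfolding poly_altdef sum_negf[symmetric]
    proof (rule sum.cong[OF refl])
      fix i show "coeff f i * (- y) ^ i = - (coeff f i * y ^ i)" using odd[of i] by (cases "even i") auto
    qed
    have "A * poly g (- x) = A * (- poly g x)" using fo[of "M * x"] fM[of "- x"] fM[of x] by simp
    then show "poly g (- x) = - poly g x" by (subst (asm) mult_left_cancel) (use A in auto)
  qed
  then show ?thesis using M A fM by blast
qed

theorem theorem1:
  fixes f :: "int poly" and k :: nat
  assumes "degree f = k" and "k \<ge> 3"
    and "\<And>j. even j \<Longrightarrow> coeff f j = 0"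
    and "coeff f k > 0"
  shows "\<exists>C::real. C > 0 \<and> (\<forall>N::int. N \<ge> 2 \<longrightarrow>
           (\<exists>(b0::real) (b::int \<Rightarrow> real).
              b0 \<ge> 0 \<and> (\<forall>m\<in>poly_values f N. b m \<ge> 0) \<and>
              b0 + (\<Sum>m\<in>poly_values f N. b m) = 1 \<and>
              (\<forall>x::real. cos_poly (poly_values f N) b0 b x \<ge> 0) \<and>
              b0 \<le> C * ln (real_of_int N) powr (- (1 / real k))))"
proof -
  obtain g g1 v \<sigma> M A where of: "odd_form g g1 v k \<sigma>" and M: "M \<ge> 1" and A: "A \<ge> 1"
    and fM: "\<And>x. poly f (M * x) = A * poly g x"
    using odd_form_decomposition[OF assms] by blast
  interpret odd_form g g1 v k \<sigma> by (rule of)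
  obtain K \<kappa> C0 Q0 where K: "K > 0" and \<kappa>: "\<kappa> > 0" and C0: "C0 \<ge> 0"
    and ker: "\<And>(Q::nat) N. Q0 \<le> real Q \<Longrightarrow> 1 \<le> Q \<Longrightarrow> K * exp (\<kappa> * real Q) \<le> N \<Longrightarrow>
     (\<exists>(I :: (int \<times> nat) set) c val. finite I \<and>
        (\<forall>i\<in>I. c i \<ge> 0 \<and> (\<exists>j\<ge>1. val i = poly g j) \<and> 0 < val i \<and> of_int (val i) \<le> N) \<and> N / 4 \<le> (\<Sum>i\<in>I. c i) \<and>
        (\<forall>x. - (C0 * N * real Q powr (- (1 / real k))) \<le> (\<Sum>i\<in>I. c i * cos (2 * pi * of_int (val i) * x))))"
    using kernel by blast
  \<comment> \<open>For \<open>ln N < l\<close> the constant polynomial 1 will do. Otherwise half of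
    \<open>ln N\<close> absorbs \<open>ln (K * A)\<close>, and \<open>Q\<close> reaches
    \<open>Q0\<close>; the entry \<open>4 * \<kappa>\<close> keeps \<open>l\<close>
    positive.\<close>
  define l where "l = max (max (4 * \<kappa>) (2 * \<kappa> * (\<bar>Q0\<bar> + 2))) (2 * \<bar>ln (K * of_int A)\<bar>)"
  have l: "4 * \<kappa> \<le> l" "2 * \<kappa> * (\<bar>Q0\<bar> + 2) \<le> l" "2 * ln (K * of_int A) \<le> l" by (auto simp: l_def)
  have l0: "l > 0" using l(1) \<kappa> by linarith
  define C where "C = l powr (1 / real k) + 4 * C0 * (4 * \<kappa>) powr (1 / real k)"
  have lk: "l powr (1 / real k) > 0" using l0 by simp
  have C: "C > 0" "C \<ge> l powr (1 / real k)" "C \<ge> 4 * C0 * (4 * \<kappa>) powr (1 / real k)"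
    using C0 lk by (auto simp: C_def add_pos_nonneg)
  show ?thesis
  proof (rule exI[of _ C], intro conjI allI impI, rule C(1))
    fix N :: int assume N2: "N \<ge> 2"
    have lnN: "ln (real_of_int N) > 0" using N2 by simp
    let ?V = "poly_values f N"
    have finV: "finite ?V" by (rule finite_poly_values)
    show "\<exists>(b0::real) (b::int \<Rightarrow> real). b0 \<ge> 0 \<and> (\<forall>m\<in>?V. b m \<ge> 0) \<and> b0 + (\<Sum>m\<in>?V. b m) = 1 \<and>
              (\<forall>x::real. cos_poly ?V b0 b x \<ge> 0) \<and> b0 \<le> C * ln (real_of_int N) powr (- (1 / real k))"
    proof (cases "ln (real_of_int N) < l")
      case True
      have "1 = l powr (1 / real k) * l powr (- (1 / real k))" using l0 by (simp flip: powr_add)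
      also have "\<dots> \<le> C * ln (real_of_int N) powr (- (1 / real k))"
        using C lk True lnN less_imp_le[OF C(1)] by (intro mult_mono powr_mono2') auto
      finally show ?thesis by (intro exI[of _ 1] exI[of _ "\<lambda>_. 0"]) (simp add: cos_poly_def)
    next
      case False
      \<comment> \<open>Only half of the available exponent goes into \<open>Q\<close>; the other
        half of \<open>ln N\<close> pays for the constants \<open>K\<close> and
        \<open>A\<close>.\<close>
      define r where "r = ln (real_of_int N) / (2 * \<kappa>)"
      define Q where "Q = nat \<lfloor>r\<rfloor>"
      have r2: "r \<ge> \<bar>Q0\<bar> + 2"
        unfolding r_def using False l(2) \<kappa> by (subst pos_le_divide_eq) (auto simp: mult_ac)
      have Q: "real Q \<le> r" "r - 1 \<le> real Q" using r2 unfolding Q_def by linarith+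
      have Q1: "Q0 \<le> real Q" "1 \<le> Q" using Q r2 by linarith+
      have Qr: "r / 2 \<le> real Q" using Q r2 by linarith
      \<comment> \<open>Values of \<open>f\<close> at multiples of \<open>M\<close> are
        \<open>A\<close> times values of \<open>g\<close>, so the values of \<open>g\<close> are
        needed up to \<open>N / A\<close>.\<close>
      define N' where "N' = real_of_int N / of_int A"
      have N'0: "N' > 0" using N2 A by (simp add: N'_def)
      have "\<kappa> * real Q \<le> ln (real_of_int N) / 2" using Q(1) \<kappa> by (simp add: r_def field_simps)
      then have "ln (K * of_int A) + \<kappa> * real Q \<le> ln (real_of_int N)" using l(3) False by linarith
      then have "exp (ln (K * of_int A) + \<kappa> * real Q) \<le> real_of_int N" using N2 by (simp add: ln_ge_iff)
      then have "K * of_int A * exp (\<kappa> * real Q) \<le> real_of_int N" using K A by (simp add: exp_add)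
      then have "K * exp (\<kappa> * real Q) \<le> N'" using A by (simp add: N'_def pos_le_divide_eq mult_ac)
      from ker[OF Q1 this] obtain I :: "(int \<times> nat) set" and c val where H: "finite I"
        "\<forall>i\<in>I. c i \<ge> 0 \<and> (\<exists>j\<ge>1. val i = poly g j) \<and> 0 < val i \<and> of_int (val i) \<le> N'"
        "N' / 4 \<le> (\<Sum>i\<in>I. c i)"
        "\<forall>x. - (C0 * N' * real Q powr (- (1 / real k))) \<le> (\<Sum>i\<in>I. c i * cos (2 * pi * of_int (val i) * x))"
        by (elim exE conjE) (rule that)
      note I = H(1) bspec[OF H(2)] H(3) spec[OF H(4)]
      define \<delta> where "\<delta> = C0 * N' * real Q powr (- (1 / real k))"
      define s where "s = (\<Sum>i\<in>I. c i)"
      have \<delta>0: "\<delta> \<ge> 0" using C0 N'0 by (simp add: \<delta>_def)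
      have s0: "s > 0" using I(3) N'0 by (simp add: s_def)
      define F where "F = (\<lambda>i. A * val i)"
      have FV: "F ` I \<subseteq> ?V"
      proof
        fix m assume "m \<in> F ` I"
        then obtain i where i: "i \<in> I" "m = A * val i" by (auto simp: F_def)
        obtain j where j: "j \<ge> 1" "val i = poly g j" using I(2)[OF i(1)] by blast
        have "m = poly f (M * j)" using fM[of j] i j by simp
        moreover have "1 * 1 \<le> M * j" using M j by (intro mult_mono) auto
        moreover have "0 < m" using I(2)[OF i(1)] A by (simp add: i(2))
        moreover have "real_of_int m \<le> of_int N"
        proof -
          have "of_int A * real_of_int (val i) \<le> of_int A * N'" using I(2)[OF i(1)] A by (intro mult_left_mono) auto
          then show ?thesis using A by (simp add: i(2) N'_def)
        qed
        ultimately show "m \<in> ?V" unfolding poly_values_def by auto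
      qed
      \<comment> \<open>Several pairs can lead to the same value of \<open>f\<close>, and each value
        carries one coefficient; values not reached receive the empty sum 0.\<close>
      define b where "b = (\<lambda>m. (\<Sum>i\<in>{i \<in> I. F i = m}. c i) / (\<delta> + s))"
      have sumb: "(\<Sum>m\<in>?V. b m * h m) = (\<Sum>i\<in>I. c i * h (F i)) / (\<delta> + s)" for h :: "int \<Rightarrow> real"
      proof -
        have "(\<Sum>m\<in>?V. b m * h m) = (\<Sum>m\<in>?V. \<Sum>i\<in>{i \<in> I. F i = m}. c i * h (F i)) / (\<delta> + s)"
          unfolding b_def sum_divide_distrib by (intro sum.cong refl) (simp add: sum_distrib_right sum_divide_distrib)
        then show ?thesis using sum.group[OF I(1) finV FV, of "\<lambda>i. c i * h (F i)"] by simp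
      qed
      have pos: "\<delta> + s > 0" using \<delta>0 s0 by simp
      show ?thesis
      \<comment> \<open>The cosine sum never drops below \<open>- \<delta>\<close>, so adding
        \<open>\<delta>\<close> makes it non-negative; dividing by \<open>\<delta> + s\<close>, its
        value at 0, normalises it.\<close>
      proof (rule exI[of _ "\<delta> / (\<delta> + s)"], rule exI[of _ b], intro conjI ballI allI)
        show "0 \<le> \<delta> / (\<delta> + s)" using \<delta>0 pos by simp
        show "0 \<le> b m" for m using I(2) pos unfolding b_def by (intro divide_nonneg_pos sum_nonneg) auto
        show "\<delta> / (\<delta> + s) + (\<Sum>m\<in>?V. b m) = 1"
          using sumb[of "\<lambda>_. 1"] pos by (simp add: s_def flip: add_divide_distrib)
        show "0 \<le> cos_poly ?V (\<delta> / (\<delta> + s)) b x" for x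
        proof -
          have "cos_poly ?V (\<delta> / (\<delta> + s)) b x = (\<delta> + (\<Sum>i\<in>I. c i * cos (2 * pi * of_int (F i) * x))) / (\<delta> + s)"
            unfolding cos_poly_def sumb by (simp add: add_divide_distrib)
          moreover have "0 \<le> \<delta> + (\<Sum>i\<in>I. c i * cos (2 * pi * of_int (F i) * x))"
            using I(4)[of "of_int A * x"] by (simp add: \<delta>_def F_def mult_ac)
          ultimately show ?thesis using pos by simp
        qed
        have "\<delta> / (\<delta> + s) \<le> \<delta> / (N' / 4)" using \<delta>0 I(3) N'0 pos by (intro divide_left_mono) (auto simp: s_def)
        also have "\<dots> = 4 * C0 * real Q powr (- (1 / real k))" using N'0 by (simp add: \<delta>_def)
        also have "\<dots> \<le> 4 * C0 * (r / 2) powr (- (1 / real k))"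
          using C0 Qr r2 by (intro mult_left_mono powr_mono2') auto
        also have "(r / 2) powr (- (1 / real k)) = (4 * \<kappa>) powr (1 / real k) * ln (real_of_int N) powr (- (1 / real k))"
        proof -
          have "r / 2 = ln (real_of_int N) / (4 * \<kappa>)" by (simp add: r_def)
          moreover have "0 \<le> ln (real_of_int N)" "0 \<le> 4 * \<kappa>" using lnN \<kappa> by auto
          ultimately have "(r / 2) powr (- (1 / real k)) = ln (real_of_int N) powr (- (1 / real k)) / (4 * \<kappa>) powr (- (1 / real k))"
            by (simp only: powr_divide)
          also have "(4 * \<kappa>) powr (- (1 / real k)) = inverse ((4 * \<kappa>) powr (1 / real k))" by (rule powr_minus)
          finally show ?thesis by (simp only: divide_inverse inverse_inverse_eq mult.commute)
        qed
        also have "4 * C0 * ((4 * \<kappa>) powr (1 / real k) * ln (real_of_int N) powr (- (1 / real k))) \<le> C * ln (real_of_int N) powr (- (1 / real k))"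
          unfolding mult.assoc[symmetric] using C(3) by (intro mult_right_mono) auto
        finally show "\<delta> / (\<delta> + s) \<le> C * ln (real_of_int N) powr (- (1 / real k))" .
      qed
    qed
  qed
qed

end
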